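(* The recursion d--operator $\mathfrak{R}=(h\mathfrak{R},v\mathfrak{R})$ generates two hierarchies of vector mKdV symmetries. The first one is horizontal, $$\overrightarrow{v}^{(0)}_\tau=\overrightarrow{v}_{h\mathbf{l}},\qquad \overrightarrow{v}^{(1)}_\tau=h\mathfrak{R}(\overrightarrow{v}_{h\mathbf{l}})=\overrightarrow{v}_{3h\mathbf{l}}+\tfrac32|\overrightarrow{v}|^2\,\overrightarrow{v}_{h\mathbf{l}},$$ $$\overrightarrow{v}^{(2)}_\tau=h\mathfrak{R}^2(\overrightarrow{v}_{h\mathbf{l}})=\overrightarrow{v}_{5h\mathbf{l}}+\tfrac52\left(|\overrightarrow{v}|^2\,\overrightarrow{v}_{2h\mathbf{l}}\right)_{h\mathbf{l}}+\tfrac52\left((|\overrightarrow{v}|^2)_{h\mathbf{l}\,h\mathbf{l}}+|\overrightarrow{v}_{h\mathbf{l}}|^2+\tfrac34|\overrightarrow{v}|^4\right)\overrightarrow{v}_{h\mathbf{l}}-\tfrac12|\overrightarrow{v}_{h\mathbf{l}}|^2\,\overrightarrow{v},\ \dots,$$ with all such terms commuting with the $-1$ flow $(\overrightarrow{v}_\tau)^{-1}=h\overrightarrow{\mathbf{e}}_\perp$ associated to the vector sine--Gordon equation $$\left(\sqrt{(1-|h\overrightarrow{\mathbf{e}}_\perp|^2)^{-1}}\;\partial_{h\mathbf{l}}(h\overrightarrow{\mathbf{e}}_\perp)\right)_\tau=-h\overrightarrow{\mathbf{e}}_\perp.$$ The second one is vertical, $$\overleftarrow{v}^{(0)}_\tau=\overleftarrow{v}_{v\mathbf{l}},\qquad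 \overleftarrow{v}^{(1)}_\tau=v\mathfrak{R}(\overleftarrow{v}_{v\mathbf{l}})=\overleftarrow{v}_{3v\mathbf{l}}+\tfrac32|\overleftarrow{v}|^2\,\overleftarrow{v}_{v\mathbf{l}},$$ $$\overleftarrow{v}^{(2)}_\tau=v\mathfrak{R}^2(\overleftarrow{v}_{v\mathbf{l}})=\overleftarrow{v}_{5v\mathbf{l}}+\tfrac52\left(|\overleftarrow{v}|^2\,\overleftarrow{v}_{2v\mathbf{l}}\right)_{v\mathbf{l}}+\tfrac52\left((|\overleftarrow{v}|^2)_{v\mathbf{l}\,v\mathbf{l}}+|\overleftarrow{v}_{v\mathbf{l}}|^2+\tfrac34|\overleftarrow{v}|^4\right)\overleftarrow{v}_{v\mathbf{l}}-\tfrac12|\overleftarrow{v}_{v\mathbf{l}}|^2\,\overleftarrow{v},\ \dots,$$ with all such terms commuting with the $-1$ flow $(\overleftarrow{v}_\tau)^{-1}=v\overleftarrow{\mathbf{e}}_\perp$ associated to the vector sine--Gordon equation $$\left(\sqrt{(1-|v\overleftarrow{\mathbf{e}}_\perp|^2)^{-1}}\;\partial_{v\mathbf{l}}(v\overleftarrow{\mathbf{e}}_\perp)\right)_\tau=-v\overleftarrow{\mathbf{e}}_\perp.$$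
   Context: $\overrightarrow{v}$ is an $\mathbb{R}^{n-1}$--valued function of $(\tau,h\mathbf{l})$ and $\overleftarrow{v}$ an $\mathbb{R}^{m-1}$--valued function of $(\tau,v\mathbf{l})$ (the normal frame components of the horizontal and vertical principal normals of a flow of non--stretching curves on a space with a horizontal/vertical splitting and constant curvature coefficients of the canonical d--connection, i.e. the canonical metric compatible linear connection preserving the splitting; $\mathbf{l}=h\mathbf{l}+v\mathbf{l}$ is the arclength parameter). Here $\mathbf{D}_{h\mathbf{X}}=\partial_{h\mathbf{l}}$ and $\mathbf{D}_{v\mathbf{X}}=\partial_{v\mathbf{l}}$ act as ordinary derivatives, with formal inverses; subscripts $h\mathbf{l}$, $2h\mathbf{l}$, $3h\mathbf{l}$, $5h\mathbf{l}$ denote derivatives of order $1,2,3,5$ in $h\mathbf{l}$, and similarly for $v\mathbf{l}$. For row vectors $A\otimes B=A^TB$, $A\wedge B=A\otimes B-B\otimes A$, $A\rfloor(B\otimes C)=(A\cdot B)C$. The horizontal recursion operator is $h\mathfrak{R}=h\mathcal{H}\circ h\mathcal{J}$ with $h\mathcal{J}=\partial_{h\mathbf{l}}+\partial_{h\mathbf{l}}^{-1}(\overrightarrow{v}\cdot\;)\overrightarrow{v}$ and $h\mathcal{H}=\partial_{h\mathbf{l}}+\overrightarrow{v}\rfloor\partial_{h\mathbf{l}}^{-1}(\overrightarrow{v}\wedge\;)$; $v\mathfrak{R}=v\mathcal{H}\circ v\mathcal{J}$ is defined in the same way from $\overleftarrow{v}$ and $\partial_{v\mathbf{l}}$. In the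 $-1$ flow, $h\overrightarrow{\mathbf{e}}_\perp$ is the $\mathbb{R}^{n-1}$--valued normal part of the flow vector, annihilated by $h\mathcal{J}$: $0=-\partial_{h\mathbf{l}}(h\overrightarrow{\mathbf{e}}_\perp)+h\mathbf{e}_\parallel\overrightarrow{v}$, where the tangential part is $h\mathbf{e}_\parallel=-\partial_{h\mathbf{l}}^{-1}(\overrightarrow{v}\cdot h\overrightarrow{\mathbf{e}}_\perp)$, and $\tau$ is rescaled so that $(h\mathbf{e}_\parallel)^2+|h\overrightarrow{\mathbf{e}}_\perp|^2=1$. The corresponding flow equation on $\overrightarrow{v}$ is $\overrightarrow{v}_\tau=-\overrightarrow{R}\,h\overrightarrow{\mathbf{e}}_\perp$, where $\overrightarrow{R}$ is the constant horizontal scalar curvature, rescaled so that $\overrightarrow{R}^2=1$. The vertical $v\overleftarrow{\mathbf{e}}_\perp$, $v\mathbf{e}_\parallel$ are defined analogously, with the vertical scalar curvature $\overleftarrow{S}$ in place of $\overrightarrow{R}$.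
   Formalization: In the second flow of both hierarchies the bracket has −|v_l|² instead of +|v_l|² and the last term −½|v_l|²v is dropped, since the printed expression does not equal R²(v_l); when the scalar curvature is −1, the sine–Gordon equation is taken with τ reversed. *)

theory Defs
  imports "HOL-Analysis.Analysis"
begin

text \<open>
  The horizontal and the vertical principal normals have values in \<open>real^'n\<close> and
  \<open>real^'m\<close>, where \<open>CARD('n) = n - 1\<close> and \<open>CARD('m) = m - 1\<close>. Both halves of the theory
  use the same polymorphic constants below, at these two types. A \<^emph>\<open>functional\<close>
  sends a curve \<open>v\<close> (the principal normal at a fixed flow parameter, as a function of
  arclength) to a function of arclength, and an evolution \<open>v\<^sub>\<tau> = P v\<close> is given by the
  functional \<open>P\<close>.
\<close>

definition dx :: "(real \<Rightarrow> 'b::real_normed_vector) \<Rightarrow> real \<Rightarrow> 'b" where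
  "dx f = (\<lambda>x. vector_derivative f (at x))"

definition smooth :: "(real \<Rightarrow> 'b::real_normed_vector) \<Rightarrow> bool" where
  "smooth f \<longleftrightarrow> (\<forall>k x. (dx ^^ k) f differentiable (at x))"

subsection \<open>Differential polynomials and the formal inverse of the derivative\<close>

text \<open>Functionals matter only through their values on smooth curves; hence the rule \<open>cong\<close>.\<close>

inductive diff_poly :: "((real \<Rightarrow> real^'n) \<Rightarrow> real \<Rightarrow> real) \<Rightarrow> bool" where
  const: "diff_poly (\<lambda>v x. c)"
| jet: "diff_poly (\<lambda>v x. (dx ^^ j) v x $ i)"
| add: "diff_poly F \<Longrightarrow> diff_poly G \<Longrightarrow> diff_poly (\<lambda>v x. F v x + G v x)"
| mult: "diff_poly F \<Longrightarrow> diff_poly G \<Longrightarrow> diff_poly (\<lambda>v x. F v x * G v x)"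
| cong: "diff_poly F \<Longrightarrow> (\<And>v x. smooth v \<Longrightarrow> F v x = G v x) \<Longrightarrow> diff_poly G"

definition diff_poly_vec :: "((real \<Rightarrow> real^'n) \<Rightarrow> real \<Rightarrow> 'b::euclidean_space) \<Rightarrow> bool" where
  "diff_poly_vec F \<longleftrightarrow> (\<forall>b\<in>Basis. diff_poly (\<lambda>v x. F v x \<bullet> b))"

text \<open>
  \<open>G\<close> is the primitive of \<open>F\<close> inside the differential polynomials. The integration constant
  is fixed by requiring that \<open>G\<close> has no constant term, that is, \<open>G\<close> vanishes on the zero
  curve. On smooth curves there is at most one such \<open>G\<close>, because only constants have zero
  total derivative, so the choice operator in \<open>dinv\<close> is harmless.
\<close>

definition formal_primitive ::
    "((real \<Rightarrow> real^'n) \<Rightarrow> real \<Rightarrow> 'b::euclidean_space) \<Rightarrow>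
     ((real \<Rightarrow> real^'n) \<Rightarrow> real \<Rightarrow> 'b) \<Rightarrow> bool" where
  "formal_primitive F G \<longleftrightarrow>
     diff_poly_vec G \<and> (\<forall>x. G (\<lambda>_. 0) x = 0) \<and>
     (\<forall>v x. smooth v \<longrightarrow> (G v has_vector_derivative F v x) (at x))"

definition dinv ::
    "((real \<Rightarrow> real^'n) \<Rightarrow> real \<Rightarrow> 'b::euclidean_space) \<Rightarrow>
     (real \<Rightarrow> real^'n) \<Rightarrow> real \<Rightarrow> 'b" where
  "dinv F = (SOME G. formal_primitive F G)"

subsection \<open>The recursion operator\<close>

text \<open>
  The vectors are row vectors, so the contraction of \<open>A\<close> with a matrix \<open>M\<close> is the
  vector-matrix product \<open>A v* M\<close>; indeed \<open>A v* outer B C = (A \<bullet> B) *\<^sub>R C\<close>.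
\<close>

definition outer :: "real^'n \<Rightarrow> real^'n \<Rightarrow> real^'n^'n" where
  "outer A B = (\<chi> i j. A $ i * B $ j)"

definition wedge :: "real^'n \<Rightarrow> real^'n \<Rightarrow> real^'n^'n" where
  "wedge A B = outer A B - outer B A"

text \<open>\<open>J_with v p u\<close> is \<open>J u\<close>, where \<open>p\<close> is the primitive used for \<open>v \<bullet> u\<close>.\<close>

definition J_with :: "(real \<Rightarrow> real^'n) \<Rightarrow> (real \<Rightarrow> real) \<Rightarrow> (real \<Rightarrow> real^'n) \<Rightarrow> real \<Rightarrow> real^'n" where
  "J_with v p u x = dx u x + p x *\<^sub>R v x"

definition opJ ::
    "((real \<Rightarrow> real^'n) \<Rightarrow> real \<Rightarrow> real^'n) \<Rightarrow> (real \<Rightarrow> real^'n) \<Rightarrow> real \<Rightarrow> real^'n" where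
  "opJ P = (\<lambda>v. J_with v (dinv (\<lambda>w y. w y \<bullet> P w y) v) (P v))"

definition opH ::
    "((real \<Rightarrow> real^'n) \<Rightarrow> real \<Rightarrow> real^'n) \<Rightarrow> (real \<Rightarrow> real^'n) \<Rightarrow> real \<Rightarrow> real^'n" where
  "opH P = (\<lambda>v x. dx (P v) x + v x v* dinv (\<lambda>w y. wedge (w y) (P w y)) v x)"

definition opR ::
    "((real \<Rightarrow> real^'n) \<Rightarrow> real \<Rightarrow> real^'n) \<Rightarrow> (real \<Rightarrow> real^'n) \<Rightarrow> real \<Rightarrow> real^'n" where
  "opR = opH \<circ> opJ"

text \<open>Both formal inverses occurring in \<open>opR P\<close> exist.\<close>

definition opR_defined :: "((real \<Rightarrow> real^'n) \<Rightarrow> real \<Rightarrow> real^'n) \<Rightarrow> bool" where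
  "opR_defined P \<longleftrightarrow>
     (\<exists>G. formal_primitive (\<lambda>v x. v x \<bullet> P v x) G) \<and>
     (\<exists>G. formal_primitive (\<lambda>v x. wedge (v x) (opJ P v x)) G)"

text \<open>The recursion d-operator, acting on pairs of a horizontal and a vertical functional.\<close>

definition d_opR ::
    "((real \<Rightarrow> real^'n) \<Rightarrow> real \<Rightarrow> real^'n) \<times> ((real \<Rightarrow> real^'m) \<Rightarrow> real \<Rightarrow> real^'m) \<Rightarrow>
     ((real \<Rightarrow> real^'n) \<Rightarrow> real \<Rightarrow> real^'n) \<times> ((real \<Rightarrow> real^'m) \<Rightarrow> real \<Rightarrow> real^'m)" where
  "d_opR = map_prod opR opR"

text \<open>
  The term of order five in the literature is often printed with \<open>+ |v\<^sub>x|\<^sup>2\<close> inside the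
  bracket and an extra summand \<open>- 1/2 |v\<^sub>x|\<^sup>2 v\<close>. That expression is not homogeneous under
  scaling and differs from \<open>opR (opR dx)\<close>; the value has \<open>- |v\<^sub>x|\<^sup>2\<close> and no extra summand.
\<close>

definition hierarchy :: "nat \<Rightarrow> (real \<Rightarrow> real^'n) \<Rightarrow> real \<Rightarrow> real^'n" where
  "hierarchy k = (opR ^^ k) dx"

subsection \<open>Commuting flows\<close>

definition gateaux ::
    "((real \<Rightarrow> real^'n) \<Rightarrow> real \<Rightarrow> real^'n) \<Rightarrow> (real \<Rightarrow> real^'n) \<Rightarrow> (real \<Rightarrow> real^'n) \<Rightarrow> real \<Rightarrow> real^'n" where
  "gateaux P v w x = vector_derivative (\<lambda>\<epsilon>. P (\<lambda>y. v y + \<epsilon> *\<^sub>R w y) x) (at 0)"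

definition flows_commute ::
    "((real \<Rightarrow> real^'n) \<Rightarrow> real \<Rightarrow> real^'n) \<Rightarrow> ((real \<Rightarrow> real^'n) \<Rightarrow> real \<Rightarrow> real^'n) \<Rightarrow> bool" where
  "flows_commute P Q \<longleftrightarrow>
     (\<forall>v x. smooth v \<longrightarrow> gateaux P v (Q v) x = gateaux Q v (P v) x)"

text \<open>
  The nonlocal \<open>-1\<close> flow: \<open>e\<close> is the normal part and \<open>a\<close> the tangential part of the flow
  vector. Since \<open>a\<close> is minus the primitive of \<open>v \<bullet> e\<close>, the first component states that \<open>J\<close>
  annihilates \<open>e\<close>, and the second one that \<open>- a\<close> is such a primitive. Here the primitive is
  not a differential polynomial, and its constant is restricted by the normalisation.
\<close>

definition neg_constraint ::
    "(real \<Rightarrow> real^'n) \<Rightarrow> (real \<Rightarrow> real^'n) \<Rightarrow> (real \<Rightarrow> real) \<Rightarrow> real \<Rightarrow> (real^'n) \<times> real \<times> real" where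
  "neg_constraint v e a x =
     (J_with v (\<lambda>y. - a y) e x, dx a x + v x \<bullet> e x, (a x)\<^sup>2 + (norm (e x))\<^sup>2 - 1)"

definition neg_flow_vector ::
    "(real \<Rightarrow> real^'n) \<Rightarrow> (real \<Rightarrow> real^'n) \<Rightarrow> (real \<Rightarrow> real) \<Rightarrow> bool" where
  "neg_flow_vector v e a \<longleftrightarrow>
     smooth v \<and> smooth e \<and> smooth a \<and> (\<forall>x. neg_constraint v e a x = 0)"

text \<open>
  The flows \<open>v\<^sub>t = P v\<close> and \<open>v\<^sub>\<tau> = e\<close> commute when the derivative of \<open>P\<close> along \<open>e\<close> equals the
  derivative of \<open>e\<close> along \<open>P\<close>. As \<open>e\<close> depends on \<open>v\<close> only implicitly, through the
  constraints, the latter derivative is any \<open>f\<close> that together with some variation \<open>g\<close> of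
  \<open>a\<close> preserves the constraints to first order when \<open>v\<close> is varied by \<open>P v\<close>. The condition
  is linear in \<open>e\<close>, so it is the same for \<open>v\<^sub>\<tau> = - e\<close>.
\<close>

definition commutes_with_neg_flow :: "((real \<Rightarrow> real^'n) \<Rightarrow> real \<Rightarrow> real^'n) \<Rightarrow> bool" where
  "commutes_with_neg_flow P \<longleftrightarrow>
     (\<forall>v e a. neg_flow_vector v e a \<longrightarrow>
        (\<exists>g. smooth g \<and>
          (\<forall>x. ((\<lambda>\<epsilon>. neg_constraint (\<lambda>y. v y + \<epsilon> *\<^sub>R P v y)
                                     (\<lambda>y. e y + \<epsilon> *\<^sub>R gateaux P v e y)
                                     (\<lambda>y. a y + \<epsilon> * g y) x)
                has_vector_derivative 0) (at 0))))"

subsection \<open>The vector sine-Gordon equation\<close>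

definition sg_normal :: "(real \<Rightarrow> real^'n) \<Rightarrow> real \<Rightarrow> real^'n" where
  "sg_normal e x = sqrt (inverse (1 - (norm (e x))\<^sup>2)) *\<^sub>R dx e x"

text \<open>The first argument of \<open>e\<close> is the flow parameter, the second one arclength.\<close>

definition sine_gordon_at :: "(real \<Rightarrow> real \<Rightarrow> real^'n) \<Rightarrow> real \<Rightarrow> real \<Rightarrow> bool" where
  "sine_gordon_at e \<tau> x \<longleftrightarrow>
     ((\<lambda>t. sg_normal (e t) x) has_vector_derivative - e \<tau> x) (at \<tau>)"

text \<open>
  The flow \<open>v\<^sub>\<tau> = - R e\<close> of unit flow vectors is the vector sine-Gordon equation for \<open>e\<close>, on
  the region where the square root of \<open>1 - |e|\<^sup>2\<close> is the tangential part. The constant \<open>R\<close>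
  satisfies \<open>R\<^sup>2 = 1\<close>; for \<open>R = - 1\<close>, which is \<open>v\<^sub>\<tau> = e\<close>, the sign printed in the
  equation is obtained by reversing the flow parameter, and this is what \<open>\<tau> \<mapsto> R \<tau>\<close> does.
  The last part says that every \<open>e\<close> with \<open>|e| < 1\<close> arises from some \<open>v\<close>.
\<close>

definition neg_flow_is_sine_gordon :: "'n::finite itself \<Rightarrow> real \<Rightarrow> bool" where
  "neg_flow_is_sine_gordon _ R \<longleftrightarrow>
     (\<forall>(v :: real \<Rightarrow> real \<Rightarrow> real^'n) e a.
        (\<forall>\<tau>. neg_flow_vector (v \<tau>) (e \<tau>) (a \<tau>)) \<longrightarrow>
        (\<forall>x. continuous_on UNIV (\<lambda>\<tau>. a \<tau> x)) \<longrightarrow>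
        (\<forall>\<tau> x. a \<tau> x > 0 \<longrightarrow>
           v \<tau> x = sg_normal (e \<tau>) x \<and>
           (((\<lambda>t. v t x) has_vector_derivative - (R *\<^sub>R e \<tau> x)) (at \<tau>) \<longleftrightarrow>
            sine_gordon_at (\<lambda>s. e (R * s)) (R * \<tau>) x))) \<and>
     (\<forall>e :: real \<Rightarrow> real^'n. smooth e \<longrightarrow> (\<forall>x. norm (e x) < 1) \<longrightarrow>
        neg_flow_vector (sg_normal e) e (\<lambda>x. sqrt (1 - (norm (e x))\<^sup>2)))"

end

theory Submission
  imports Defs
begin

text \<open>
  The off-diagonal parts \<open>q\<close>, \<open>r\<close> and the diagonal parts \<open>p\<close>, \<open>U\<close> of a solution of the Lax equation
  \<open>p' = v \<bullet> q\<close>, \<open>q' = r - p v\<close>, \<open>U' = v \<and> r\<close>, \<open>r' = q / X - v U\<close>, expanded in powers of \<open>X\<close>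
  with \<open>p = 1 + \<dots>\<close>, have as coefficients exactly the hierarchy, its images under \<open>J\<close>,
  and the primitives occurring in \<open>J\<close> and \<open>H\<close>. The solution
  can be chosen of rank two and normalised, \<open>p U = r \<and> q\<close> and
  \<open>p\<^sup>2 + |q|\<^sup>2 - X (|r|\<^sup>2 + |U|\<^sup>2 / 2) = 1\<close>. These two algebraic equations express \<open>p\<close> and \<open>U\<close>
  through \<open>q\<close> and \<open>r\<close> without any integration, which makes the recursion local, and the two
  differential equations that are no longer used as definitions follow from them.

  The linearisation of the equations has only the trivial solution, again order by order in \<open>X\<close>.
  Hence if \<open>V\<close> satisfies the zero curvature equation for a flow of \<open>v\<close>, the variation of
  the solution along this flow is its bracket with \<open>V\<close>. For the \<open>-1\<close> flow \<open>V\<close> is built from the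
  flow vector, for the mKdV flow it is a truncation of the solution itself, and in both cases
  commutation is read off from the coefficients of the bracket.
\<close>

subsection \<open>Vectors over a commutative ring\<close>

text \<open>The obstacle is locality: \<open>opR\<close> takes primitives, and nothing in its form
  shows that they are differential polynomials at every step. The algebraic constraints have a
  geometric origin. For X < 0, after scaling r and U by sqrt (- X), the entries (p, q, r, U) form a
  skew matrix of size n + 1: p couples two distinguished directions, q and r couple these to the
  remaining n - 1, and U acts on the latter. The Lax equation becomes a commutator equation, which
  preserves the rank and the invariant quadratic form. Rank two is the Pluecker relation p U = r
  \<and> q, and the form, with the value it takes at v = 0, p = 1, is the normalisation. The same
  geometry makes a bracket with any V tangent to both constraints. Since p starts with 1 it is a
  unit, so that the constraints can be solved coefficient by coefficient. This also fixes every
  integration constant: at v = 0 the solution is just p = 1.\<close>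

definition vdot :: "'a::comm_ring_1^'n \<Rightarrow> 'a^'n \<Rightarrow> 'a" where
  "vdot a b = (\<Sum>i\<in>UNIV. a $ i * b $ i)"

text \<open>The operations are set up over a commutative ring because they are needed both for real
  vectors and for vectors of power series; \<open>wedge\<close> and the inner product cover the real
  case only.\<close>

definition vwedge :: "'a::comm_ring_1^'n \<Rightarrow> 'a^'n \<Rightarrow> 'a^'n^'n" where
  "vwedge a b = (\<chi> i j. a $ i * b $ j - b $ i * a $ j)"

definition mdot :: "'a::comm_ring_1^'n^'n \<Rightarrow> 'a^'n^'n \<Rightarrow> 'a" where
  "mdot A B = (\<Sum>i\<in>UNIV. \<Sum>j\<in>UNIV. A $ i $ j * B $ i $ j)"

text \<open>On a matrix \<open>*s\<close> would expect a row as its scalar, since the entries of a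
  matrix, seen as a vector, are rows.\<close>

definition mscale :: "'a::comm_ring_1 \<Rightarrow> 'a^'n^'n \<Rightarrow> 'a^'n^'n" where
  "mscale c A = (\<chi> i j. c * A $ i $ j)"

definition skew :: "'a::comm_ring_1^'n^'n \<Rightarrow> bool" where
  "skew A \<longleftrightarrow> (\<forall>i j. A $ i $ j = - A $ j $ i)"

lemma vdot_commute: "vdot a b = vdot b a"
  by (simp add: vdot_def mult.commute)

lemma vdot_add_left: "vdot (a + b) c = vdot a c + vdot b c"
  and vdot_diff_left: "vdot (a - b) c = vdot a c - vdot b c"
  and vdot_scale_left: "vdot (k *s a) c = k * vdot a c"
  and vdot_uminus_left: "vdot (- a) c = - vdot a c"
  by (simp_all add: vdot_def sum.distrib sum_subtractf sum_distrib_left sum_negf algebra_simps)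

lemma vdot_add_right: "vdot c (a + b) = vdot c a + vdot c b"
  and vdot_diff_right: "vdot c (a - b) = vdot c a - vdot c b"
  and vdot_scale_right: "vdot c (k *s a) = k * vdot c a"
  and vdot_uminus_right: "vdot c (- a) = - vdot c a"
  by (simp_all add: vdot_def sum.distrib sum_subtractf sum_distrib_left sum_negf algebra_simps)

lemmas vdot_simps = vdot_add_left vdot_diff_left vdot_scale_left vdot_uminus_left
  vdot_add_right vdot_diff_right vdot_scale_right vdot_uminus_right

lemma row_wedge: "a v* vwedge b c = vdot a b *s c - vdot a c *s b"
  by (simp add: vec_eq_iff vector_matrix_mult_def vwedge_def vdot_def sum_subtractf
      sum_distrib_left sum_distrib_right algebra_simps)

lemma row_add: "(a + b) v* T = a v* T + b v* T"
  and row_diff: "(a - b) v* T = a v* T - b v* T"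
  and row_uminus: "(- a) v* T = - (a v* T)"
  and row_scale: "(k *s a) v* T = k *s (a v* T)"
  for a :: "'a::comm_ring_1^'n" and T :: "'a^'n^'n"
  by (simp_all add: vec_eq_iff vector_matrix_mult_def sum.distrib sum_subtractf
      sum_distrib_left sum_negf algebra_simps)

lemma row_madd: "a v* (S + T) = a v* S + a v* T"
  and row_mdiff: "a v* (S - T) = a v* S - a v* T"
  and row_mscale: "a v* mscale k T = k *s (a v* T)"
  for a :: "'a::comm_ring_1^'n" and T :: "'a^'n^'n"
  by (simp_all add: vec_eq_iff vector_matrix_mult_def mscale_def sum.distrib sum_subtractf
      sum_distrib_left algebra_simps)

lemma row_mult: "a v* (S ** T) = (a v* S) v* T"
  for a :: "'a::comm_ring_1^'n" and T :: "'a^'n^'n"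
  by (simp add: vector_matrix_mul_assoc)

lemmas row_simps = row_add row_diff row_uminus row_scale row_madd row_mdiff row_mscale row_mult row_wedge

lemma vdot_row: "vdot (a v* T) b = (\<Sum>i\<in>UNIV. \<Sum>j\<in>UNIV. T $ i $ j * a $ i * b $ j)"
  unfolding vdot_def vector_matrix_mult_def
  by (simp add: sum_distrib_right sum_distrib_left mult_ac) (rule sum.swap)

lemma vdot_row_skew:
  assumes "skew T" shows "vdot (a v* T) b = - vdot (b v* T) a"
proof -
  have "T $ i $ j * a $ i * b $ j = - (T $ j $ i * b $ j * a $ i)" for i j
  proof -
    have "T $ i $ j = - T $ j $ i" using assms unfolding skew_def by blast
    then show ?thesis by (simp add: mult_ac)
  qed
  then have "vdot (a v* T) b = (\<Sum>i\<in>UNIV. \<Sum>j\<in>UNIV. - (T $ j $ i * b $ j * a $ i))"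
    unfolding vdot_row by (intro sum.cong refl)
  also have "\<dots> = - (\<Sum>i\<in>UNIV. \<Sum>j\<in>UNIV. T $ j $ i * b $ j * a $ i)"
    by (simp only: sum_negf)
  also have "\<dots> = - vdot (b v* T) a"
    unfolding vdot_row by (rule arg_cong[OF sum.swap])
  finally show ?thesis .
qed

text \<open>By skewness both halves of the wedge contribute equally. The resulting 2 is what the
  weight 1/2 of |U|^2 in the normalisation compensates.\<close>

lemma mdot_wedge:
  assumes "skew T" shows "mdot T (vwedge a b) = 2 * vdot (a v* T) b"
proof -
  have "mdot T (vwedge a b) = vdot (a v* T) b - vdot (b v* T) a"
    unfolding vdot_row mdot_def vwedge_def by (simp add: sum_subtractf algebra_simps)
  then show ?thesis by (subst (asm) vdot_row_skew[OF assms, of b a]) simp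
qed

lemma mdot_add_right: "mdot A (B + C) = mdot A B + mdot A C"
  and mdot_diff_right: "mdot A (B - C) = mdot A B - mdot A C"
  and mdot_mscale_right: "mdot A (mscale k B) = k * mdot A B"
  by (simp_all add: mdot_def mscale_def sum.distrib sum_subtractf sum_distrib_left algebra_simps)

lemma mdot_commute: "mdot A B = mdot B A"
  by (simp add: mdot_def mult.commute)

text \<open>For skew A, \<open>mdot A B\<close> is minus the trace of A B, so this is the vanishing
  of tr (A (A B - B A)). In indices, two sign changes turn the triple sum of one product into that
  of the other.\<close>

lemma mdot_commutator:
  assumes "skew A" "skew B" shows "mdot A (A ** B - B ** A) = 0"
proof -
  have a: "A $ i $ j = - A $ j $ i" for i j using assms unfolding skew_def by blast
  have "mdot A (A ** B) = (\<Sum>i\<in>UNIV. \<Sum>j\<in>UNIV. \<Sum>k\<in>UNIV. A $ i $ j * A $ i $ k * B $ k $ j)"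
    by (simp add: mdot_def matrix_matrix_mult_def sum_distrib_left mult.assoc)
  also have "\<dots> = (\<Sum>j\<in>UNIV. \<Sum>i\<in>UNIV. \<Sum>k\<in>UNIV. A $ i $ j * A $ i $ k * B $ k $ j)"
    by (rule sum.swap)
  also have "\<dots> = (\<Sum>j\<in>UNIV. \<Sum>k\<in>UNIV. \<Sum>i\<in>UNIV. A $ i $ j * A $ i $ k * B $ k $ j)"
    by (rule sum.cong[OF refl], rule sum.swap)
  finally have 1: "mdot A (A ** B) = (\<Sum>j\<in>UNIV. \<Sum>k\<in>UNIV. \<Sum>i\<in>UNIV. A $ i $ j * A $ i $ k * B $ k $ j)" .
  have "mdot A (B ** A) = (\<Sum>i\<in>UNIV. \<Sum>j\<in>UNIV. \<Sum>k\<in>UNIV. A $ i $ j * B $ i $ k * A $ k $ j)"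
    by (simp add: mdot_def matrix_matrix_mult_def sum_distrib_left mult.assoc)
  also have "\<dots> = (\<Sum>i\<in>UNIV. \<Sum>k\<in>UNIV. \<Sum>j\<in>UNIV. A $ i $ j * B $ i $ k * A $ k $ j)"
    by (rule sum.cong[OF refl], rule sum.swap)
  also have "\<dots> = (\<Sum>k\<in>UNIV. \<Sum>i\<in>UNIV. \<Sum>j\<in>UNIV. A $ i $ j * B $ i $ k * A $ k $ j)"
    by (rule sum.swap)
  also have "\<dots> = (\<Sum>k\<in>UNIV. \<Sum>i\<in>UNIV. \<Sum>j\<in>UNIV. A $ j $ i * A $ j $ k * B $ i $ k)"
  proof (intro sum.cong refl)
    fix k i j
    show "A $ i $ j * B $ i $ k * A $ k $ j = A $ j $ i * A $ j $ k * B $ i $ k"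
      using a[of i j] a[of k j] by (simp add: mult_ac)
  qed
  finally have 2: "mdot A (B ** A) = (\<Sum>k\<in>UNIV. \<Sum>i\<in>UNIV. \<Sum>j\<in>UNIV. A $ j $ i * A $ j $ k * B $ i $ k)" .
  show ?thesis
    unfolding mdot_diff_right 1 2 by (simp add: mult_ac)
qed

subsection \<open>Differentiation of power series coefficient by coefficient\<close>

text \<open>Differentiation in a real parameter with X held fixed, not the formal derivative
  \<open>fps_deriv\<close>. The parameter is arclength in the Lax equation and the deformation
  parameter in its linearisation.\<close>

definition has_fps_deriv :: "(real \<Rightarrow> real fps) \<Rightarrow> real fps \<Rightarrow> real \<Rightarrow> bool" where
  "has_fps_deriv f f' x \<longleftrightarrow>
     (\<forall>k. ((\<lambda>y. fps_nth (f y) k) has_real_derivative fps_nth f' k) (at x))"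

definition has_fpsv_deriv :: "(real \<Rightarrow> real fps^'n) \<Rightarrow> real fps^'n \<Rightarrow> real \<Rightarrow> bool" where
  "has_fpsv_deriv f f' x \<longleftrightarrow> (\<forall>i. has_fps_deriv (\<lambda>y. f y $ i) (f' $ i) x)"

definition has_fpsm_deriv :: "(real \<Rightarrow> real fps^'n^'n) \<Rightarrow> real fps^'n^'n \<Rightarrow> real \<Rightarrow> bool" where
  "has_fpsm_deriv f f' x \<longleftrightarrow> (\<forall>i. has_fpsv_deriv (\<lambda>y. f y $ i) (f' $ i) x)"

lemma has_fps_deriv_const: "has_fps_deriv (\<lambda>_. c) 0 x"
  by (simp add: has_fps_deriv_def)

lemma has_fps_deriv_add:
  "has_fps_deriv f f' x \<Longrightarrow> has_fps_deriv g g' x \<Longrightarrow> has_fps_deriv (\<lambda>y. f y + g y) (f' + g') x"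
  unfolding has_fps_deriv_def by (auto intro!: derivative_intros)

lemma has_fps_deriv_diff:
  "has_fps_deriv f f' x \<Longrightarrow> has_fps_deriv g g' x \<Longrightarrow> has_fps_deriv (\<lambda>y. f y - g y) (f' - g') x"
  unfolding has_fps_deriv_def by (auto intro!: derivative_intros)

lemma has_fps_deriv_mult:
  assumes "has_fps_deriv f f' x" "has_fps_deriv g g' x"
  shows "has_fps_deriv (\<lambda>y. f y * g y) (f' * g x + f x * g') x"
  unfolding has_fps_deriv_def
proof
  fix k
  have "((\<lambda>y. \<Sum>i=0..k. fps_nth (f y) i * fps_nth (g y) (k - i)) has_real_derivative
     (\<Sum>i=0..k. fps_nth f' i * fps_nth (g x) (k - i) + fps_nth (f x) i * fps_nth g' (k - i))) (at x)"
    using assms unfolding has_fps_deriv_def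
    by (intro DERIV_sum) (auto intro!: derivative_eq_intros)
  then show "((\<lambda>y. fps_nth (f y * g y) k) has_real_derivative fps_nth (f' * g x + f x * g') k) (at x)"
    by (simp add: fps_mult_nth sum.distrib)
qed

lemma has_fps_deriv_sum:
  assumes "\<And>i. i \<in> I \<Longrightarrow> has_fps_deriv (f i) (f' i) x"
  shows "has_fps_deriv (\<lambda>y. \<Sum>i\<in>I. f i y) (\<Sum>i\<in>I. f' i) x"
  using assms unfolding has_fps_deriv_def by (auto simp: fps_sum_nth intro!: DERIV_sum)

lemma has_fps_deriv_unique:
  "has_fps_deriv f f' x \<Longrightarrow> has_fps_deriv f f'' x \<Longrightarrow> f' = f''"
  unfolding has_fps_deriv_def by (auto simp: fps_eq_iff intro: DERIV_unique)

lemma has_fpsv_deriv_unique: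
  "has_fpsv_deriv f f' x \<Longrightarrow> has_fpsv_deriv f f'' x \<Longrightarrow> f' = f''"
  unfolding has_fpsv_deriv_def by (auto simp: vec_eq_iff intro: has_fps_deriv_unique)

lemma has_fpsm_deriv_unique:
  "has_fpsm_deriv f f' x \<Longrightarrow> has_fpsm_deriv f f'' x \<Longrightarrow> f' = f''"
  unfolding has_fpsm_deriv_def by (auto simp: vec_eq_iff[of f'] intro: has_fpsv_deriv_unique)

lemma has_fpsv_deriv_const: "has_fpsv_deriv (\<lambda>_. c) 0 x"
  by (simp add: has_fpsv_deriv_def has_fps_deriv_const)

lemma has_fpsv_deriv_add:
  "has_fpsv_deriv f f' x \<Longrightarrow> has_fpsv_deriv g g' x \<Longrightarrow> has_fpsv_deriv (\<lambda>y. f y + g y) (f' + g') x"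
  unfolding has_fpsv_deriv_def by (auto intro: has_fps_deriv_add)

lemma has_fpsv_deriv_diff:
  "has_fpsv_deriv f f' x \<Longrightarrow> has_fpsv_deriv g g' x \<Longrightarrow> has_fpsv_deriv (\<lambda>y. f y - g y) (f' - g') x"
  unfolding has_fpsv_deriv_def by (auto intro: has_fps_deriv_diff)

lemma has_fpsv_deriv_scale:
  "has_fps_deriv c c' x \<Longrightarrow> has_fpsv_deriv f f' x \<Longrightarrow>
     has_fpsv_deriv (\<lambda>y. c y *s f y) (c' *s f x + c x *s f') x"
  unfolding has_fpsv_deriv_def by (auto intro: has_fps_deriv_mult)

lemma has_fps_deriv_vdot:
  "has_fpsv_deriv f f' x \<Longrightarrow> has_fpsv_deriv g g' x \<Longrightarrow>
     has_fps_deriv (\<lambda>y. vdot (f y) (g y)) (vdot f' (g x) + vdot (f x) g') x"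
  unfolding has_fpsv_deriv_def vdot_def sum.distrib[symmetric]
  by (intro has_fps_deriv_sum has_fps_deriv_mult) auto

lemma has_fps_deriv_mdot:
  "has_fpsm_deriv f f' x \<Longrightarrow> has_fpsm_deriv g g' x \<Longrightarrow>
     has_fps_deriv (\<lambda>y. mdot (f y) (g y)) (mdot f' (g x) + mdot (f x) g') x"
  unfolding has_fpsm_deriv_def has_fpsv_deriv_def mdot_def sum.distrib[symmetric]
  by (intro has_fps_deriv_sum has_fps_deriv_mult) auto

lemma has_fpsv_deriv_row:
  assumes "has_fpsv_deriv f f' x" "has_fpsm_deriv T T' x"
  shows "has_fpsv_deriv (\<lambda>y. f y v* T y) (f' v* T x + f x v* T') x"
proof -
  have "has_fps_deriv (\<lambda>y. \<Sum>i\<in>UNIV. T y $ i $ j * f y $ i)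
      (\<Sum>i\<in>UNIV. T' $ i $ j * f x $ i + T x $ i $ j * f' $ i) x" for j
    using assms unfolding has_fpsv_deriv_def has_fpsm_deriv_def
    by (intro has_fps_deriv_sum has_fps_deriv_mult) auto
  then show ?thesis
    by (simp add: has_fpsv_deriv_def vector_matrix_mult_def sum.distrib add.commute mult.commute)
qed

lemma has_fpsm_deriv_mscale:
  "has_fps_deriv c c' x \<Longrightarrow> has_fpsm_deriv f f' x \<Longrightarrow>
     has_fpsm_deriv (\<lambda>y. mscale (c y) (f y)) (mscale c' (f x) + mscale (c x) f') x"
  unfolding has_fpsm_deriv_def has_fpsv_deriv_def mscale_def by (auto intro: has_fps_deriv_mult)

lemma has_fpsm_deriv_vwedge:
  assumes "has_fpsv_deriv f f' x" "has_fpsv_deriv g g' x"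
  shows "has_fpsm_deriv (\<lambda>y. vwedge (f y) (g y)) (vwedge f' (g x) + vwedge (f x) g') x"
proof -
  have "has_fps_deriv (\<lambda>y. f y $ i * g y $ j - g y $ i * f y $ j)
     ((f' $ i * g x $ j + f x $ i * g' $ j) - (g' $ i * f x $ j + g x $ i * f' $ j)) x" for i j
    using assms unfolding has_fpsv_deriv_def
    by (intro has_fps_deriv_diff has_fps_deriv_mult) auto
  then show ?thesis
    by (simp add: has_fpsm_deriv_def has_fpsv_deriv_def vwedge_def algebra_simps)
qed

lemmas fps_deriv_rules = has_fps_deriv_const has_fps_deriv_add has_fps_deriv_diff has_fps_deriv_mult
  has_fps_deriv_vdot has_fps_deriv_mdot has_fpsv_deriv_const has_fpsv_deriv_add
  has_fpsv_deriv_diff has_fpsv_deriv_scale has_fpsv_deriv_row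
  has_fpsm_deriv_mscale has_fpsm_deriv_vwedge

text \<open>Lets the differentiation rules synthesise a derivative first and leaves its equality
  with the desired one to algebra.\<close>

lemma has_fpsv_deriv_eq: "has_fpsv_deriv f g x \<Longrightarrow> g = h \<Longrightarrow> has_fpsv_deriv f h x"
  by simp

subsection \<open>The bracket\<close>

text \<open>The Jacobi identity: the bracket of two solutions of the Lax equation is again a
  solution. Here V = (P, Q, R, T) misses the equation for R by w, and bracketing this defect with
  the solution produces the extra term - p w.\<close>

lemma bracket_deriv_normal:
  fixes v w :: "real fps^'n"
  assumes "has_fps_deriv P (vdot v (Q x)) x" "has_fpsv_deriv Q (R x - P x *s v) x"
    "has_fpsv_deriv R (Qt x - v v* T x + w) x" "has_fpsm_deriv T (vwedge v (R x)) x"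
  assumes "has_fps_deriv p (vdot v (q x)) x" "has_fpsv_deriv q (r x - p x *s v) x"
    "has_fpsv_deriv r (qt x - v v* U x) x" "has_fpsm_deriv U (vwedge v (r x)) x"
  shows "has_fpsv_deriv (\<lambda>y. P y *s r y - p y *s R y - Q y v* U y + q y v* T y)
     (P x *s qt x - p x *s Qt x - R x v* U x + r x v* T x
       - (vdot (R x) (q x) - vdot (Q x) (r x)) *s v - p x *s w) x"
  by (rule has_fpsv_deriv_eq, (rule assms fps_deriv_rules)+)
    (simp add: row_simps vec_eq_iff vdot_simps vdot_commute algebra_simps)

text \<open>The companion identity for r' = q / X - v U, multiplied by X because power series cannot
  be divided by X. The derivatives of \<open>Qt\<close> and \<open>qt\<close> are known only through
  their multiples by X. The defect w now enters as w U.\<close>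

lemma bracket_deriv_tangential:
  fixes v w :: "real fps^'n"
  assumes "has_fps_deriv P (vdot v (Q x)) x" "has_fpsv_deriv Q (R x - P x *s v) x"
    "has_fpsv_deriv R (Qt x - v v* T x + w) x" "has_fpsm_deriv T (vwedge v (R x)) x"
    "has_fpsv_deriv Qt Qt' x" "fps_X *s Qt' = R x - P x *s v" "Q x = fps_X *s Qt x"
  assumes "has_fps_deriv p (vdot v (q x)) x" "has_fpsv_deriv q (r x - p x *s v) x"
    "has_fpsv_deriv r (qt x - v v* U x) x" "has_fpsm_deriv U (vwedge v (r x)) x"
    "has_fpsv_deriv qt qt' x" "fps_X *s qt' = r x - p x *s v" "q x = fps_X *s qt x"
  shows "\<exists>d. has_fpsv_deriv (\<lambda>y. P y *s qt y - p y *s Qt y - R y v* U y + r y v* T y) d x \<and>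
     P x *s r x - p x *s R x - Q x v* U x + q x v* T x
       = fps_X *s (d + w v* U x
          + v v* (vwedge (R x) (r x) - vwedge (Qt x) (q x) + (U x ** T x - T x ** U x)))"
proof (intro exI conjI)
  show "has_fpsv_deriv (\<lambda>y. P y *s qt y - p y *s Qt y - R y v* U y + r y v* T y)
     (vdot v (Q x) *s qt x + P x *s qt' - (vdot v (q x) *s Qt x + p x *s Qt')
       - ((Qt x - v v* T x + w) v* U x + R x v* vwedge v (r x))
       + ((qt x - v v* U x) v* T x + r x v* vwedge v (R x))) x"
    by (rule assms fps_deriv_rules)+
  have a: "fps_X * Qt' $ i = R x $ i - P x * v $ i" "fps_X * qt' $ i = r x $ i - p x * v $ i" for i
    using arg_cong[OF assms(6), of "\<lambda>a. a $ i"] arg_cong[OF assms(13), of "\<lambda>a. a $ i"] by simp_all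
  \<comment> \<open>The factor X has to reach \<open>qt'\<close> and \<open>Qt'\<close> inside
    products before their equations apply.\<close>
  have b: "fps_X * (P x * qt' $ i) = P x * (r x $ i - p x * v $ i)"
    "fps_X * (p x * Qt' $ i) = p x * (R x $ i - P x * v $ i)" for i
    by (simp_all only: a[symmetric] mult.left_commute)
  show "P x *s r x - p x *s R x - Q x v* U x + q x v* T x
       = fps_X *s ((vdot v (Q x) *s qt x + P x *s qt' - (vdot v (q x) *s Qt x + p x *s Qt')
       - ((Qt x - v v* T x + w) v* U x + R x v* vwedge v (r x))
       + ((qt x - v v* U x) v* T x + r x v* vwedge v (R x))) + w v* U x
          + v v* (vwedge (R x) (r x) - vwedge (Qt x) (q x) + (U x ** T x - T x ** U x)))"
    unfolding assms(7,14)
    by (simp add: row_simps vec_eq_iff vdot_simps vdot_commute b distrib_left right_diff_distrib)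
      (simp add: algebra_simps, simp add: b algebra_simps)
qed

subsection \<open>The algebraic constraints\<close>

lemma mscale_cancel:
  fixes p :: "'a::idom"
  assumes "p \<noteq> 0" "mscale p A = mscale p B" shows "A = B"
  using assms by (simp add: mscale_def vec_eq_iff)

lemma skew_of_plucker:
  fixes p :: "'a::idom"
  assumes "p \<noteq> 0" "mscale p U = vwedge r q" shows "skew U"
  unfolding skew_def
proof (intro allI)
  fix i j
  have e: "p * U $ i $ j = vwedge r q $ i $ j" for i j
    unfolding assms(2)[symmetric] by (simp add: mscale_def)
  have "p * U $ i $ j = p * - U $ j $ i"
    using e[of i j] e[of j i] by (simp add: vwedge_def)
  then show "U $ i $ j = - U $ j $ i" using assms(1) mult_left_cancel by blast
qed

lemma row_plucker:
  fixes p :: "'a::idom"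
  assumes "mscale p U = vwedge r q"
  shows "p *s (a v* U) = vdot a r *s q - vdot a q *s r"
  using row_mscale[of a p U] by (simp add: assms row_wedge)

lemma vwedge_add_left: "vwedge (a + b) c = vwedge a c + vwedge b c"
  and vwedge_diff_left: "vwedge (a - b) c = vwedge a c - vwedge b c"
  and vwedge_scale_left: "vwedge (k *s a) c = mscale k (vwedge a c)"
  and vwedge_add_right: "vwedge c (a + b) = vwedge c a + vwedge c b"
  and vwedge_diff_right: "vwedge c (a - b) = vwedge c a - vwedge c b"
  and vwedge_scale_right: "vwedge c (k *s a) = mscale k (vwedge c a)"
  and vwedge_self: "vwedge a a = 0"
  and vwedge_uminus_left: "vwedge (- a) c = - vwedge a c"
  by (simp_all add: vwedge_def mscale_def vec_eq_iff algebra_simps)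

lemmas vwedge_simps = vwedge_add_left vwedge_diff_left vwedge_scale_left vwedge_add_right
  vwedge_diff_right vwedge_scale_right vwedge_self vwedge_uminus_left

lemma vwedge_swap: "vwedge a b = - vwedge b a"
  by (simp add: vwedge_def vec_eq_iff)

lemma mscale_simps:
  "mscale (a + b) A = mscale a A + mscale b A"
  "mscale (a - b) A = mscale a A - mscale b A"
  "mscale (- a) A = - mscale a A"
  "mscale a (A + B) = mscale a A + mscale a B"
  "mscale a (A - B) = mscale a A - mscale a B"
  "mscale a (- A) = - mscale a A"
  "mscale a (mscale b A) = mscale (a * b) A"
  by (simp_all add: mscale_def vec_eq_iff algebra_simps)

text \<open>After multiplication by p, a U is a combination of q and r. The wedge with q kills the
  first part and leaves a multiple of r \<and> q = p U; then p is cancelled.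
  \<open>plucker_wedge_r\<close> is the same with the roles of q and r exchanged.\<close>

lemma plucker_wedge_q:
  fixes p :: "'a::idom"
  assumes "p \<noteq> 0" "mscale p U = vwedge r q"
  shows "vwedge (a v* U) q = - mscale (vdot a q) U"
proof (rule mscale_cancel[OF assms(1)])
  have "mscale p (vwedge (a v* U) q) = - mscale (vdot a q) (mscale p U)"
    by (simp add: vwedge_scale_left[symmetric] row_plucker[OF assms(2)])
      (simp add: vwedge_simps assms(2) mscale_simps, simp add: mscale_def vec_eq_iff)
  then show "mscale p (vwedge (a v* U) q) = mscale p (- mscale (vdot a q) U)"
    by (simp add: mscale_simps mult.commute)
qed

lemma plucker_wedge_r:
  fixes p :: "'a::idom"
  assumes "p \<noteq> 0" "mscale p U = vwedge r q"
  shows "vwedge r (a v* U) = mscale (vdot a r) U"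
proof (rule mscale_cancel[OF assms(1)])
  have "mscale p (vwedge r (a v* U)) = mscale (vdot a r) (mscale p U)"
    by (simp add: vwedge_scale_right[symmetric] row_plucker[OF assms(2)])
      (simp add: vwedge_simps assms(2) mscale_simps, simp add: mscale_def vec_eq_iff)
  then show "mscale p (vwedge r (a v* U)) = mscale p (mscale (vdot a r) U)"
    by (simp add: mscale_simps mult.commute)
qed

text \<open>The commutator with a skew matrix acts on bivectors as a derivation, and p U is the
  bivector r \<and> q.\<close>

lemma plucker_commutator:
  fixes p :: "'a::idom"
  assumes "mscale p U = vwedge r q" "skew T"
  shows "mscale p (U ** T - T ** U) = vwedge (r v* T) q + vwedge r (q v* T)"
proof -
  have e: "p * U $ i $ j = r $ i * q $ j - q $ i * r $ j" for i j
    using arg_cong[OF assms(1), of "\<lambda>A. A $ i $ j"] by (simp add: mscale_def vwedge_def)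
  have t: "T $ i $ k = - T $ k $ i" for i k using assms(2) unfolding skew_def by blast
  have "p * (U ** T) $ i $ j = (\<Sum>k\<in>UNIV. (p * U $ i $ k) * T $ k $ j)" for i j
    by (simp add: matrix_matrix_mult_def sum_distrib_left mult.assoc)
  also have "\<dots> i j = r $ i * (q v* T) $ j - q $ i * (r v* T) $ j" for i j
    by (simp add: e vector_matrix_mult_def sum_distrib_left sum_subtractf algebra_simps)
  finally have 1: "p * (U ** T) $ i $ j = r $ i * (q v* T) $ j - q $ i * (r v* T) $ j" for i j .
  have "p * (T ** U) $ i $ j = (\<Sum>k\<in>UNIV. T $ i $ k * (p * U $ k $ j))" for i j
    by (simp add: matrix_matrix_mult_def sum_distrib_left mult_ac)
  also have "\<dots> i j = (\<Sum>k\<in>UNIV. - (T $ k $ i * (r $ k * q $ j - q $ k * r $ j)))" for i j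
    by (simp only: e t[of i] mult_minus_left)
  also have "\<dots> i j = - ((r v* T) $ i * q $ j) + (q v* T) $ i * r $ j" for i j
    by (simp add: vector_matrix_mult_def sum_distrib_left sum_distrib_right sum_subtractf sum_negf algebra_simps)
  finally have 2: "p * (T ** U) $ i $ j = - ((r v* T) $ i * q $ j) + (q v* T) $ i * r $ j" for i j .
  show ?thesis
    by (simp add: vec_eq_iff mscale_def right_diff_distrib 1 2 vwedge_def)
qed

text \<open>Bracketing with V is an infinitesimal rotation, hence tangent to the level sets of the
  invariant form. The identity is the linearised normalisation, evaluated on the components of the
  bracket.\<close>

lemma bracket_norm:
  fixes P :: "'a::idom"
  assumes "skew T" "skew U" "Q = m *s Qt" "q = m *s qt" "(2::'a) \<noteq> 0"
  shows "2 * p * (vdot R q - vdot Q r) + 2 * vdot q (P *s r - p *s R - Q v* U + q v* T)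
    - m * (2 * vdot r (P *s qt - p *s Qt - R v* U + r v* T)
        + mdot U (vwedge R r - vwedge Qt q + (U ** T - T ** U))) = 0"
proof -
  \<comment> \<open>Skewness gives only that twice this number vanishes, whence the assumption on
    2.\<close>
  have 0: "vdot a (a v* T) = 0" for a
  proof -
    have "2 * vdot a (a v* T) = 0"
      using vdot_row_skew[OF assms(1), of a a] unfolding vdot_commute[of "a v* T"]
      by (metis eq_neg_iff_add_eq_0 mult_2)
    then show ?thesis using assms(5) mult_eq_0_iff by blast
  qed
  have 1: "mdot U (vwedge R r - vwedge Qt q + (U ** T - T ** U)) = 2 * vdot (R v* U) r - 2 * vdot (Qt v* U) q"
    by (simp add: mdot_add_right mdot_diff_right[of U "vwedge R r"] mdot_commutator[OF assms(2,1)] mdot_wedge[OF assms(2)])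
  have 2: "vdot a (b v* U) = vdot (b v* U) a" for a b by (rule vdot_commute)
  show ?thesis
    unfolding 1 unfolding assms(3,4)
    by (simp add: vdot_simps row_simps 2 algebra_simps 0)
     (simp add: vdot_commute algebra_simps)
qed

text \<open>An infinitesimal rotation maps r \<and> q to a sum of two wedges by the product rule, so
  it stays tangent to the matrices of rank two. This is the linearised relation p U = r \<and> q on
  the bracket.\<close>

lemma bracket_plucker:
  fixes P :: "'a::idom"
  assumes "p \<noteq> 0" "mscale p U = vwedge r q" "skew T" "Q = m *s Qt" "q = m *s qt"
  shows "mscale (vdot R q - vdot Q r) U + mscale p (vwedge R r - vwedge Qt q + (U ** T - T ** U))
    = vwedge (P *s qt - p *s Qt - R v* U + r v* T) q + vwedge r (P *s r - p *s R - Q v* U + q v* T)"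
proof -
  have 0: "vwedge qt q = 0" unfolding assms(5) by (simp add: vwedge_simps) (simp add: mscale_def vec_eq_iff)
  have 1: "mscale p (vwedge R r - vwedge Qt q + (U ** T - T ** U))
    = mscale p (vwedge R r) - mscale p (vwedge Qt q) + vwedge (r v* T) q + vwedge r (q v* T)"
    by (simp only: mscale_simps(4,5) add.assoc plucker_commutator[OF assms(2,3), symmetric])
  show ?thesis
    unfolding 1
    by (simp add: vwedge_simps 0 plucker_wedge_q[OF assms(1,2)] plucker_wedge_r[OF assms(1,2)])
      (simp add: vwedge_swap[of r R] mscale_simps vdot_commute, simp add: mscale_def vec_eq_iff algebra_simps)
qed

text \<open>
  With \<open>A = p' - v \<bullet> q\<close> and \<open>B = U' - v \<and> r\<close> the differentiated constraints read
  \<open>2 p A = m U : B\<close> and \<open>p B = - A U\<close>, whence \<open>(2 p\<^sup>2 + m U : U) A = 0\<close>.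
\<close>

lemma constraints_determine_derivatives:
  fixes p :: "'a::idom"
  assumes "p \<noteq> 0" and pl: "mscale p U = vwedge r q"
    and nz: "2 * p * p + m * mdot U U \<noteq> 0"
    and n': "2 * (p * p') + 2 * vdot q (r - p *s v)
             - m * (2 * vdot r r' + mdot U U') = 0"
    and pl': "mscale p' U + mscale p U' = vwedge r' q + vwedge r (r - p *s v)"
    and r': "r' = qt - v v* U" and q: "q = m *s qt"
  shows "p' = vdot v q" "U' = vwedge v r"
proof -
  define A where "A = p' - vdot v q"
  define B where "B = U' - vwedge v r"
  have sk: "skew U" by (rule skew_of_plucker[OF assms(1,2)])
  have p': "p' = A + vdot v q" and U': "U' = B + vwedge v r" by (simp_all add: A_def B_def)
  have 1: "2 * p * A = m * mdot U B"
    using n' unfolding p' U' r' q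
    by (simp add: mdot_add_right mdot_wedge[OF sk] vdot_simps vdot_commute[of r "v v* U"]
        vdot_commute[of qt] algebra_simps)
  have 0: "vwedge qt q = 0" unfolding q by (simp add: vwedge_simps) (simp add: mscale_def vec_eq_iff)
  have 2: "mscale p B = - mscale A U"
    using pl' unfolding p' U' r'
    by (simp add: mscale_simps vwedge_simps plucker_wedge_q[OF assms(1,2)] 0 vwedge_swap[of r v])
      (simp add: algebra_simps add_eq_0_iff)
  have "p * (2 * p * A) = m * mdot U (mscale p B)"
    unfolding 1 by (simp add: mdot_mscale_right algebra_simps)
  also have "mdot U (mscale p B) = - (A * mdot U U)"
    unfolding 2 by (simp add: mdot_def mscale_def sum_distrib_left sum_negf algebra_simps)
  finally have "(2 * p * p + m * mdot U U) * A = 0" by (simp add: algebra_simps)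
  with nz have A: "A = 0" by simp
  then show "p' = vdot v q" by (simp add: A_def)
  from 2 A have "mscale p B = mscale p 0" by (simp add: mscale_def vec_eq_iff)
  then have "B = 0" using mscale_cancel[OF assms(1)] by blast
  then show "U' = vwedge v r" by (simp add: B_def)
qed

section \<open>Uniqueness for the linearised equations, by divisibility by powers of X\<close>

lemma X_power_dvd_iff: "fps_X ^ k dvd (f :: real fps) \<longleftrightarrow> (\<forall>i<k. fps_nth f i = 0)"
proof
  assume "fps_X ^ k dvd f"
  then obtain g where "f = fps_X ^ k * g" by blast
  then show "\<forall>i<k. fps_nth f i = 0" by (simp add: fps_X_power_mult_nth)
next
  assume "\<forall>i<k. fps_nth f i = 0"
  then have "f = fps_X ^ k * Abs_fps (\<lambda>i. fps_nth f (i + k))"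
    by (auto simp: fps_eq_iff fps_X_power_mult_nth)
  then show "fps_X ^ k dvd f" by (metis dvd_triv_left)
qed

lemma dvd_vdot_right: "(\<And>i. c dvd b $ i) \<Longrightarrow> c dvd vdot a b"
  unfolding vdot_def by (intro dvd_sum dvd_mult)

lemma dvd_mdot_right: "(\<And>i j. c dvd B $ i $ j) \<Longrightarrow> c dvd mdot A B"
  unfolding mdot_def by (intro dvd_sum dvd_mult)

lemma dvd_row: "(\<And>i j. c dvd (T :: real fps^'n^'n) $ i $ j) \<Longrightarrow> c dvd (a v* T) $ j"
  unfolding vector_matrix_mult_def by (simp, intro dvd_sum) simp

text \<open>The divisibility is assumed at all parameters: the low coefficients are then zero
  functions, and so are their derivatives.\<close>

lemma X_power_dvd_deriv:
  assumes "\<And>y. fps_X ^ k dvd f y" "has_fps_deriv f f' x"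
  shows "fps_X ^ k dvd f'"
  unfolding X_power_dvd_iff
proof (intro allI impI)
  fix i assume "i < k"
  then have "(\<lambda>y. fps_nth (f y) i) = (\<lambda>_. 0)" using assms(1) by (auto simp: X_power_dvd_iff)
  moreover have "((\<lambda>y. fps_nth (f y) i) has_real_derivative fps_nth f' i) (at x)"
    using assms(2) by (auto simp: has_fps_deriv_def)
  ultimately show "fps_nth f' i = 0" using DERIV_const DERIV_unique by metis
qed

text \<open>If X^k divides all four unknowns, so does X^(k+1), provided that they are treated in the
  right order. Q gains a power from its factor X in \<open>d2\<close>. P follows from
  \<open>c1\<close>, where the remaining terms contain X or Q. R follows from R = Q' + P v, and T
  from \<open>c2\<close>. In the steps for P and T the coefficient p is cancelled, which is possible
  because its constant term is 1.\<close>

lemma linearised_unique: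
  fixes v q qt r Q R :: "real \<Rightarrow> real fps^'n"
  assumes p0: "\<And>y. fps_nth (p y) 0 = 1" and q: "\<And>y. q y = fps_X *s qt y"
    and d1: "\<And>y. has_fpsv_deriv Q (R y - P y *s v y) y"
    and d2: "\<And>y. \<exists>d. has_fpsv_deriv R d y \<and> Q y = fps_X *s (d + v y v* T y)"
    and c1: "\<And>y. 2 * p y * P y + 2 * vdot (q y) (Q y)
                - fps_X * (2 * vdot (r y) (R y) + mdot (U y) (T y)) = 0"
    and c2: "\<And>y. mscale (P y) (U y) + mscale (p y) (T y) = vwedge (R y) (q y) + vwedge (r y) (Q y)"
  shows "P y = 0" "Q y = 0" "R y = 0" "T y = 0"
proof -
  have cancel: "fps_X ^ k dvd f" if "fps_X ^ k dvd p y * f" for k f y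
  proof -
    have "p y dvd 1" using p0[of y] by simp
    then show ?thesis using that by (simp add: dvd_mult_unit_iff' mult.commute dvd_mult_unit_iff)
  qed
  have "\<forall>y i j. fps_X ^ k dvd P y \<and> fps_X ^ k dvd Q y $ i \<and> fps_X ^ k dvd R y $ i \<and> fps_X ^ k dvd T y $ i $ j" for k
  proof (induction k)
    case 0 then show ?case by simp
  next
    case (Suc k)
    then have IP: "fps_X ^ k dvd P y" and IQ: "fps_X ^ k dvd Q y $ i" and IR: "fps_X ^ k dvd R y $ i"
      and IT: "fps_X ^ k dvd T y $ i $ j" for y i j by auto
    have S: "fps_X ^ Suc k dvd fps_X * f" if "fps_X ^ k dvd f" for f :: "real fps"
      using that by simp
    have Q: "fps_X ^ Suc k dvd Q y $ i" for y i
    proof -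
      obtain d where d: "has_fpsv_deriv R d y" "Q y = fps_X *s (d + v y v* T y)" using d2 by blast
      have "fps_X ^ k dvd d $ i"
        by (rule X_power_dvd_deriv[where f = "\<lambda>y. R y $ i"]) (use IR d in \<open>auto simp: has_fpsv_deriv_def\<close>)
      then have "fps_X ^ k dvd (d + v y v* T y) $ i" using dvd_row[OF IT] by simp
      then show ?thesis unfolding d(2) vector_smult_component by (rule S)
    qed
    have P: "fps_X ^ Suc k dvd P y" for y
    proof (rule cancel)
      have "fps_X ^ Suc k dvd fps_X * (2 * vdot (r y) (R y) + mdot (U y) (T y)) - 2 * vdot (q y) (Q y)"
        by (intro dvd_diff S dvd_add dvd_mult dvd_vdot_right Q dvd_mdot_right IT IR)
      also have "\<dots> = 2 * (p y * P y)" using c1[of y] by (simp add: algebra_simps)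
      finally have "fps_X ^ Suc k dvd 2 * (p y * P y)" .
      moreover have "(2 :: real fps) dvd 1" by simp
      ultimately show "fps_X ^ Suc k dvd p y * P y" by (simp add: dvd_mult_unit_iff')
    qed
    have R: "fps_X ^ Suc k dvd R y $ i" for y i
    proof -
      have "fps_X ^ Suc k dvd (R y - P y *s v y) $ i"
        by (rule X_power_dvd_deriv[where f = "\<lambda>y. Q y $ i"]) (use Q d1 in \<open>auto simp: has_fpsv_deriv_def\<close>)
      moreover have "fps_X ^ Suc k dvd P y * v y $ i" using P by (rule dvd_mult2)
      ultimately have "fps_X ^ Suc k dvd (R y - P y *s v y) $ i + P y * v y $ i" by (rule dvd_add)
      then show ?thesis by simp
    qed
    have T: "fps_X ^ Suc k dvd T y $ i $ j" for y i j
    proof (rule cancel)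
      have "p y * T y $ i $ j = (R y $ i * q y $ j - q y $ i * R y $ j)
         + (r y $ i * Q y $ j - Q y $ i * r y $ j) - P y * U y $ i $ j"
        using arg_cong[OF c2[of y], of "\<lambda>A. A $ i $ j"] by (simp add: mscale_def vwedge_def algebra_simps)
      also have "fps_X ^ Suc k dvd \<dots>"
        by (rule dvd_diff[OF dvd_add[OF dvd_diff[OF dvd_mult2[OF R] dvd_mult[OF R]]
              dvd_diff[OF dvd_mult[OF Q] dvd_mult2[OF Q]]] dvd_mult2[OF P]])
      finally show "fps_X ^ Suc k dvd p y * T y $ i $ j" .
    qed
    show ?case using P Q R T by blast
  qed
  then have z: "fps_nth (P y) k = 0" "fps_nth (Q y $ i) k = 0" "fps_nth (R y $ i) k = 0"
    "fps_nth (T y $ i $ j) k = 0" for k i j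
    using X_power_dvd_iff[of "Suc k"] by blast+
  show "P y = 0" "Q y = 0" "R y = 0" "T y = 0"
    by (simp_all add: vec_eq_iff fps_eq_iff z)
qed

subsection \<open>Smooth curves\<close>

lemma dx_eqI: "(f has_vector_derivative D) (at x) \<Longrightarrow> dx f x = D"
  unfolding dx_def by (rule vector_derivative_at)

lemma smooth_has_derivative:
  "smooth v \<Longrightarrow> ((dx ^^ k) v has_vector_derivative (dx ^^ Suc k) v x) (at x)"
  unfolding smooth_def dx_def using vector_derivative_works by (auto simp: dx_def)

lemma smooth_has_derivative':
  "smooth v \<Longrightarrow> (v has_vector_derivative dx v x) (at x)"
  using smooth_has_derivative[of v 0 x] by simp

lemma smooth_dx: "smooth v \<Longrightarrow> smooth (dx v)"
  unfolding smooth_def by (metis funpow_Suc_right o_apply)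

text \<open>Smoothness is the largest property that implies differentiability and is stable under
  \<open>dx\<close>, so an invariant set replaces any computation of iterated derivatives.\<close>

lemma smooth_coinduct:
  assumes "f \<in> S" "\<And>g. g \<in> S \<Longrightarrow> (\<forall>x. g differentiable (at x)) \<and> dx g \<in> S"
  shows "smooth f"
proof -
  have "(dx ^^ k) f \<in> S" for k by (induction k) (use assms in auto)
  then show ?thesis using assms(2) unfolding smooth_def by blast
qed

lemma dx_comb:
  assumes "smooth v" "smooth w"
  shows "(dx ^^ k) (\<lambda>y. v y + e *\<^sub>R w y) = (\<lambda>y. (dx ^^ k) v y + e *\<^sub>R (dx ^^ k) w y)"
proof (induction k)
  case (Suc k)
  have "((\<lambda>y. (dx ^^ k) v y + e *\<^sub>R (dx ^^ k) w y) has_vector_derivative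
      (dx ^^ Suc k) v x + e *\<^sub>R (dx ^^ Suc k) w x) (at x)" for x
    by (auto intro!: derivative_eq_intros smooth_has_derivative[OF assms(1)] smooth_has_derivative[OF assms(2)]
        simp del: funpow.simps)
  then have "dx (\<lambda>y. (dx ^^ k) v y + e *\<^sub>R (dx ^^ k) w y) x
      = (dx ^^ Suc k) v x + e *\<^sub>R (dx ^^ Suc k) w x" for x
    by (rule dx_eqI)
  then show ?case by (simp add: Suc fun_eq_iff)
qed simp

lemma smooth_comb:
  assumes "smooth v" "smooth w" shows "smooth (\<lambda>y. v y + e *\<^sub>R w y)"
  unfolding smooth_def dx_comb[OF assms]
  using assms unfolding smooth_def by (auto intro!: derivative_intros)

lemma has_vector_derivative_vec_iff:
  fixes f :: "real \<Rightarrow> real^'n"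
  shows "(f has_vector_derivative f') (at x) \<longleftrightarrow> (\<forall>i. ((\<lambda>y. f y $ i) has_real_derivative f' $ i) (at x))"
proof
  assume "(f has_vector_derivative f') (at x)"
  then show "\<forall>i. ((\<lambda>y. f y $ i) has_real_derivative f' $ i) (at x)"
    using bounded_linear.has_vector_derivative[OF bounded_linear_vec_nth]
    unfolding has_real_derivative_iff_has_vector_derivative by blast
next
  assume "\<forall>i. ((\<lambda>y. f y $ i) has_real_derivative f' $ i) (at x)"
  then show "(f has_vector_derivative f') (at x)"
    unfolding has_vector_derivative_def has_field_derivative_def
    by (subst has_derivative_componentwise_within) (auto simp: Basis_vec_def inner_axis mult_commute_abs)
qed

subsection \<open>Calculus of differential polynomials\<close>

text \<open>\<open>DF\<close> is the total derivative of \<open>F\<close>, and \<open>GF\<close>, \<open>GDF\<close> are the variations of \<open>F\<close>, \<open>DF\<close>.\<close>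

definition total_derivs ::
    "((real \<Rightarrow> real^'n) \<Rightarrow> real \<Rightarrow> real) \<Rightarrow> ((real \<Rightarrow> real^'n) \<Rightarrow> real \<Rightarrow> real) \<Rightarrow>
     ((real \<Rightarrow> real^'n) \<Rightarrow> (real \<Rightarrow> real^'n) \<Rightarrow> real \<Rightarrow> real) \<Rightarrow>
     ((real \<Rightarrow> real^'n) \<Rightarrow> (real \<Rightarrow> real^'n) \<Rightarrow> real \<Rightarrow> real) \<Rightarrow> bool" where
  "total_derivs F DF GF GDF \<longleftrightarrow>
     (\<forall>v x. smooth v \<longrightarrow> (F v has_real_derivative DF v x) (at x)) \<and>
     (\<forall>v w x. smooth v \<longrightarrow> smooth w \<longrightarrow>
        ((\<lambda>e. F (\<lambda>y. v y + e *\<^sub>R w y) x) has_real_derivative GF v w x) (at 0) \<and>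
        ((\<lambda>e. DF (\<lambda>y. v y + e *\<^sub>R w y) x) has_real_derivative GDF v w x) (at 0) \<and>
        (GF v w has_real_derivative GDF v w x) (at x))"

text \<open>The last two clauses of \<open>total_derivs\<close> share \<open>GDF\<close>, which says
  that variation and total derivative commute. For jets this is clear because they are affine in the
  deformation parameter, and sums and products inherit it; hence all four functionals go through one
  induction and no theorem on mixed partial derivatives enters.\<close>

lemma diff_poly_total_derivs:
  assumes "diff_poly (F :: (real \<Rightarrow> real^'n) \<Rightarrow> real \<Rightarrow> real)"
  shows "\<exists>DF GF GDF. diff_poly DF \<and> total_derivs F DF GF GDF"
  using assms
proof (induction F rule: diff_poly.induct)
  case (const c)
  have "total_derivs (\<lambda>(v :: real \<Rightarrow> real^'n) x. c) (\<lambda>v x. 0) (\<lambda>v w x. 0) (\<lambda>v w x. 0)"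
    by (simp add: total_derivs_def)
  then show ?case using diff_poly.const by blast
next
  case (jet j i)
  have J: "((\<lambda>x. (dx ^^ j) v x $ i) has_real_derivative (dx ^^ Suc j) v x $ i) (at x)"
    if "smooth v" for v :: "real \<Rightarrow> real^'n" and j x
    using smooth_has_derivative[OF that, of j x] unfolding has_vector_derivative_vec_iff by blast
  have G: "((\<lambda>e. (dx ^^ j) (\<lambda>y. v y + e *\<^sub>R w y) x $ i) has_real_derivative (dx ^^ j) w x $ i) (at 0)"
    if "smooth v" "smooth w" for v w :: "real \<Rightarrow> real^'n" and j x
    unfolding dx_comb[OF that] by (auto intro!: derivative_eq_intros)
  have "total_derivs (\<lambda>(v :: real \<Rightarrow> real^'n) x. (dx ^^ j) v x $ i) (\<lambda>v x. (dx ^^ Suc j) v x $ i)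
      (\<lambda>v w x. (dx ^^ j) w x $ i) (\<lambda>v w x. (dx ^^ Suc j) w x $ i)"
    unfolding total_derivs_def using J G by (simp del: funpow.simps)
  then show ?case using diff_poly.jet by blast
next
  case (add F G)
  then obtain DF GF GDF DG GG GDG where d: "diff_poly DF" "diff_poly DG"
    and F: "total_derivs F DF GF GDF" and G: "total_derivs G DG GG GDG" by blast
  have "total_derivs (\<lambda>v x. F v x + G v x) (\<lambda>v x. DF v x + DG v x)
      (\<lambda>v w x. GF v w x + GG v w x) (\<lambda>v w x. GDF v w x + GDG v w x)"
    unfolding total_derivs_def
    by (intro conjI allI impI DERIV_add)
      (use F G in \<open>simp_all add: total_derivs_def\<close>)
  then show ?case using diff_poly.add[OF d] by blast
next
  case (mult F G)
  then obtain DF GF GDF DG GG GDG where d: "diff_poly DF" "diff_poly DG"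
    and F: "total_derivs F DF GF GDF" and G: "total_derivs G DG GG GDG" by blast
  have D: "diff_poly (\<lambda>v x. DF v x * G v x + F v x * DG v x)"
    by (intro diff_poly.add diff_poly.mult d mult.hyps)
  have "total_derivs (\<lambda>v x. F v x * G v x) (\<lambda>v x. DF v x * G v x + F v x * DG v x)
      (\<lambda>v w x. GF v w x * G v x + F v x * GG v w x)
      (\<lambda>v w x. GDF v w x * G v x + DF v x * GG v w x + (GF v w x * DG v x + F v x * GDG v w x))"
    unfolding total_derivs_def
  proof (intro conjI allI impI)
    fix v w :: "real \<Rightarrow> real^'n" and x
    assume s: "smooth v"
    have f2: "(F v has_real_derivative DF v x) (at x)" and g2: "(G v has_real_derivative DG v x) (at x)"
      using F G s unfolding total_derivs_def by blast+
    show "((\<lambda>x. F v x * G v x) has_real_derivative DF v x * G v x + F v x * DG v x) (at x)"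
      using DERIV_mult[OF f2 g2] by (simp add: mult.commute)
    assume w: "smooth w"
    note f = F[unfolded total_derivs_def, THEN conjunct2, rule_format, OF s w, of x]
    note g = G[unfolded total_derivs_def, THEN conjunct2, rule_format, OF s w, of x]
    note f3 = f[THEN conjunct1] and f4 = f[THEN conjunct2, THEN conjunct1]
      and f5 = f[THEN conjunct2, THEN conjunct2]
    note g3 = g[THEN conjunct1] and g4 = g[THEN conjunct2, THEN conjunct1]
      and g5 = g[THEN conjunct2, THEN conjunct2]
    show "((\<lambda>e. F (\<lambda>y. v y + e *\<^sub>R w y) x * G (\<lambda>y. v y + e *\<^sub>R w y) x) has_real_derivative
        GF v w x * G v x + F v x * GG v w x) (at 0)"
      using DERIV_mult[OF f3 g3] by (simp add: mult.commute)
    show "((\<lambda>e. DF (\<lambda>y. v y + e *\<^sub>R w y) x * G (\<lambda>y. v y + e *\<^sub>R w y) x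
         + F (\<lambda>y. v y + e *\<^sub>R w y) x * DG (\<lambda>y. v y + e *\<^sub>R w y) x) has_real_derivative
        GDF v w x * G v x + DF v x * GG v w x + (GF v w x * DG v x + F v x * GDG v w x)) (at 0)"
      using DERIV_add[OF DERIV_mult[OF f4 g3] DERIV_mult[OF f3 g4]] by (simp add: mult.commute)
    show "((\<lambda>x. GF v w x * G v x + F v x * GG v w x) has_real_derivative
        GDF v w x * G v x + DF v x * GG v w x + (GF v w x * DG v x + F v x * GDG v w x)) (at x)"
      using DERIV_add[OF DERIV_mult[OF f5 g2] DERIV_mult[OF f2 g5]]
      by (simp add: algebra_simps)
  qed
  then show ?case using D by blast
next
  case (cong F G)
  have e: "G v = F v" if "smooth v" for v using cong.hyps(2)[OF that] by auto
  have e2: "G (\<lambda>y. v y + t *\<^sub>R w y) = F (\<lambda>y. v y + t *\<^sub>R w y)" if "smooth v" "smooth w" for v w t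
    by (rule e[OF smooth_comb[OF that]])
  obtain DF GF GDF where d: "diff_poly DF" and F: "total_derivs F DF GF GDF"
    using cong.IH by blast
  have "total_derivs G DF GF GDF"
    using F unfolding total_derivs_def by (simp add: e e2)
  then show ?case using d by blast
qed

definition variation ::
    "((real \<Rightarrow> real^'n) \<Rightarrow> real \<Rightarrow> real) \<Rightarrow> (real \<Rightarrow> real^'n) \<Rightarrow> (real \<Rightarrow> real^'n) \<Rightarrow> real \<Rightarrow> real" where
  "variation F v w x = deriv (\<lambda>e. F (\<lambda>y. v y + e *\<^sub>R w y) x) 0"

lemma dx_real_eqI: "(f has_real_derivative D) (at x) \<Longrightarrow> dx f x = D"
  by (rule dx_eqI) (simp add: has_real_derivative_iff_has_vector_derivative)

lemma diff_poly_has_derivative: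
  assumes "diff_poly F" "smooth v"
  shows "(F v has_real_derivative dx (F v) x) (at x)"
proof -
  obtain DF GF GDF where "total_derivs F DF GF GDF" using diff_poly_total_derivs[OF assms(1)] by blast
  then have "(F v has_real_derivative DF v x) (at x)" using assms(2) by (simp add: total_derivs_def)
  then show ?thesis using dx_real_eqI by metis
qed

lemma diff_poly_dx:
  assumes "diff_poly F" shows "diff_poly (\<lambda>v. dx (F v))"
proof -
  obtain DF GF GDF where d: "diff_poly DF" "total_derivs F DF GF GDF"
    using diff_poly_total_derivs[OF assms(1)] by blast
  show ?thesis
  proof (rule diff_poly.cong[OF d(1)])
    fix v :: "real \<Rightarrow> real^'a" and x assume "smooth v"
    then have "(F v has_real_derivative DF v x) (at x)" using d by (simp add: total_derivs_def)
    then show "DF v x = dx (F v) x" using dx_real_eqI by metis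
  qed
qed

lemma diff_poly_has_variation:
  assumes "diff_poly F" "smooth v" "smooth w"
  shows "((\<lambda>e. F (\<lambda>y. v y + e *\<^sub>R w y) x) has_real_derivative variation F v w x) (at 0)"
proof -
  obtain DF GF GDF where "total_derivs F DF GF GDF" using diff_poly_total_derivs[OF assms(1)] by blast
  then have "((\<lambda>e. F (\<lambda>y. v y + e *\<^sub>R w y) x) has_real_derivative GF v w x) (at 0)"
    using assms(2,3) by (simp add: total_derivs_def)
  then show ?thesis unfolding variation_def by (simp add: DERIV_imp_deriv)
qed

lemma variation_has_derivative:
  assumes "diff_poly F" "smooth v" "smooth w"
  shows "(variation F v w has_real_derivative variation (\<lambda>v. dx (F v)) v w x) (at x)"
proof -
  obtain DF GF GDF where d: "diff_poly DF" "total_derivs F DF GF GDF"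
    using diff_poly_total_derivs[OF assms(1)] by blast
  have "DF u y = dx (F u) y" if "smooth u" for u y
    using d(2) that dx_real_eqI unfolding total_derivs_def by metis
  then have e: "dx (F (\<lambda>y. v y + e *\<^sub>R w y)) = DF (\<lambda>y. v y + e *\<^sub>R w y)" for e
    using smooth_comb[OF assms(2,3)] by (simp add: fun_eq_iff)
  have g: "variation F v w = GF v w"
    using d(2) assms(2,3) by (auto simp: fun_eq_iff total_derivs_def variation_def DERIV_imp_deriv)
  have "variation (\<lambda>v. dx (F v)) v w x = GDF v w x"
    using d(2) assms(2,3) by (auto simp: total_derivs_def variation_def e DERIV_imp_deriv)
  then show ?thesis unfolding g using d(2) assms(2,3) by (simp add: total_derivs_def)
qed

lemma smooth_diff_poly:
  assumes "diff_poly F" "smooth v" shows "smooth (F v)"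
proof (rule smooth_coinduct)
  show "F v \<in> {F v |F. diff_poly F}" using assms by blast
  fix g assume "g \<in> {F v |F. diff_poly F}"
  then obtain F where F: "diff_poly F" "g = F v" by blast
  then have "\<forall>x. g differentiable (at x)"
    using diff_poly_has_derivative[OF F(1) assms(2)] by (meson field_differentiable_def field_differentiable_imp_differentiable)
  moreover have "dx g \<in> {F v |F. diff_poly F}"
    using F(2) diff_poly_dx[OF F(1)] by (intro CollectI exI[of _ "\<lambda>v. dx (F v)"]) simp
  ultimately show "(\<forall>x. g differentiable (at x)) \<and> dx g \<in> {F v |F. diff_poly F}" by (rule conjI)
qed

lemma diff_poly_uminus: "diff_poly F \<Longrightarrow> diff_poly (\<lambda>v x. - F v x)"
  using diff_poly.mult[OF diff_poly.const[of "-1"], of F] by simp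

lemma diff_poly_diff: "diff_poly F \<Longrightarrow> diff_poly G \<Longrightarrow> diff_poly (\<lambda>v x. F v x - G v x)"
  using diff_poly.add[OF _ diff_poly_uminus, of F G] by simp

lemma diff_poly_sum: "(\<And>i. i \<in> I \<Longrightarrow> diff_poly (F i)) \<Longrightarrow> diff_poly (\<lambda>v x. \<Sum>i\<in>I. F i v x)"
proof (induction I rule: infinite_finite_induct)
  case (insert i I)
  then show ?case using diff_poly.add[of "F i" "\<lambda>v x. \<Sum>i\<in>I. F i v x"] by simp
qed (simp_all add: diff_poly.const)

lemma diff_poly_component: "diff_poly (\<lambda>v x. v x $ i)"
  using diff_poly.jet[of 0 i] by simp

subsection \<open>Uniqueness of formal primitives\<close>

lemma diff_poly_finite_order:
  assumes "diff_poly F"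
  shows "\<exists>N. \<forall>v w x. smooth v \<longrightarrow> smooth w \<longrightarrow> (\<forall>k\<le>N. (dx ^^ k) v x = (dx ^^ k) w x) \<longrightarrow> F v x = F w x"
  using assms
proof (induction F rule: diff_poly.induct)
  case (const c) then show ?case by simp
next
  case (jet j i) then show ?case by (intro exI[of _ j]) simp
next
  case (add F G)
  then obtain M N where
    "\<And>v w x. smooth v \<Longrightarrow> smooth w \<Longrightarrow> (\<forall>k\<le>M. (dx ^^ k) v x = (dx ^^ k) w x) \<Longrightarrow> F v x = F w x"
    "\<And>v w x. smooth v \<Longrightarrow> smooth w \<Longrightarrow> (\<forall>k\<le>N. (dx ^^ k) v x = (dx ^^ k) w x) \<Longrightarrow> G v x = G w x"
    by metis
  then show ?case by (intro exI[of _ "max M N"]) (metis max.coboundedI1 max.coboundedI2)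
next
  case (mult F G)
  then obtain M N where
    "\<And>v w x. smooth v \<Longrightarrow> smooth w \<Longrightarrow> (\<forall>k\<le>M. (dx ^^ k) v x = (dx ^^ k) w x) \<Longrightarrow> F v x = F w x"
    "\<And>v w x. smooth v \<Longrightarrow> smooth w \<Longrightarrow> (\<forall>k\<le>N. (dx ^^ k) v x = (dx ^^ k) w x) \<Longrightarrow> G v x = G w x"
    by metis
  then show ?case by (intro exI[of _ "max M N"]) (metis max.coboundedI1 max.coboundedI2)
next
  case (cong F G)
  then show ?case by metis
qed

section \<open>Constant terms as limits along decaying curves\<close>

lemma dx_const: "dx (\<lambda>_. c) = (\<lambda>_. 0)"
  by (simp add: dx_def)

lemma dx_zero: "(dx ^^ k) (\<lambda>_. 0) = (\<lambda>_. 0)"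
  by (induction k) (simp_all add: dx_const)

lemma smooth_const: "smooth (\<lambda>_. c)"
  by (rule smooth_coinduct[where S = "range (\<lambda>c _. c)"]) (auto simp: dx_const)

lemma diff_poly_tendsto:
  assumes "diff_poly F" "smooth w" "\<And>k. ((dx ^^ k) w \<longlongrightarrow> 0) at_top"
  shows "(F w \<longlongrightarrow> F (\<lambda>_. 0) 0) at_top"
  using assms(1)
proof (induction F rule: diff_poly.induct)
  case (jet j i)
  show ?case using tendsto_vec_nth[OF assms(3)[of j], of i] by (simp add: dx_zero)
next
  case (cong F G)
  then have "F w = G w" "F (\<lambda>_. 0) 0 = G (\<lambda>_. 0) 0" using assms(2) smooth_const by auto
  then show ?case using cong.IH by simp
qed (auto intro: tendsto_add tendsto_mult)

text \<open>Curves of this form realise every finite jet at \<open>x0\<close>, and all their derivatives decay.\<close>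

definition exp_poly :: "real \<Rightarrow> nat \<Rightarrow> (nat \<Rightarrow> 'b::real_normed_vector) \<Rightarrow> real \<Rightarrow> 'b" where
  "exp_poly x0 N c y = exp (- y) *\<^sub>R (\<Sum>j\<le>N. ((y - x0) ^ j / fact j) *\<^sub>R c j)"

text \<open>Differentiating \<open>exp_poly\<close> acts on the coefficients as shift minus
  identity: the shift comes from the polynomial, the minus sign from exp (- y). The shift is cut off
  at degree N.\<close>

definition trunc_diff :: "nat \<Rightarrow> (nat \<Rightarrow> 'b::real_normed_vector) \<Rightarrow> nat \<Rightarrow> 'b" where
  "trunc_diff N c j = (if j < N then c (Suc j) else 0) - c j"

lemma exp_poly_derivative:
  "(exp_poly x0 N c has_vector_derivative exp_poly x0 N (trunc_diff N c) y) (at y)"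
proof -
  have m: "((\<lambda>y. ((y - x0) ^ j / fact j) *\<^sub>R c j) has_vector_derivative
      (real j * (y - x0) ^ (j - 1) / fact j) *\<^sub>R c j) (at y)" for j
    by (auto intro!: derivative_eq_intros)
  have "(\<Sum>j\<le>N. (real j * (y - x0) ^ (j - 1) / fact j) *\<^sub>R c j)
      = (\<Sum>j<N. ((y - x0) ^ j / fact j) *\<^sub>R c (Suc j))"
    by (subst lessThan_Suc_atMost[symmetric], subst sum.lessThan_Suc_shift) (simp add: field_simps del: of_nat_Suc)
  also have "\<dots> = (\<Sum>j\<le>N. ((y - x0) ^ j / fact j) *\<^sub>R (if j < N then c (Suc j) else 0))"
    by (simp add: lessThan_Suc_atMost[symmetric])
  finally have s: "(\<Sum>j\<le>N. (real j * (y - x0) ^ (j - 1) / fact j) *\<^sub>R c j)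
     = (\<Sum>j\<le>N. ((y - x0) ^ j / fact j) *\<^sub>R (if j < N then c (Suc j) else 0))" .
  have "((\<lambda>y. \<Sum>j\<le>N. ((y - x0) ^ j / fact j) *\<^sub>R c j) has_vector_derivative
     (\<Sum>j\<le>N. ((y - x0) ^ j / fact j) *\<^sub>R (if j < N then c (Suc j) else 0))) (at y)"
    unfolding s[symmetric] by (intro has_vector_derivative_sum m)
  moreover have "((\<lambda>y. exp (- y)) has_real_derivative - exp (- y)) (at y)"
    by (auto intro!: derivative_eq_intros)
  ultimately have "((\<lambda>y. exp (- y) *\<^sub>R (\<Sum>j\<le>N. ((y - x0) ^ j / fact j) *\<^sub>R c j)) has_vector_derivative
     (exp (- y) *\<^sub>R (\<Sum>j\<le>N. ((y - x0) ^ j / fact j) *\<^sub>R (if j < N then c (Suc j) else 0))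
       + (- exp (- y)) *\<^sub>R (\<Sum>j\<le>N. ((y - x0) ^ j / fact j) *\<^sub>R c j))) (at y)"
    by (rule has_vector_derivative_scaleR[rotated])
  moreover have "exp (- y) *\<^sub>R (\<Sum>j\<le>N. ((y - x0) ^ j / fact j) *\<^sub>R (if j < N then c (Suc j) else 0))
       + (- exp (- y)) *\<^sub>R (\<Sum>j\<le>N. ((y - x0) ^ j / fact j) *\<^sub>R c j) = exp_poly x0 N (trunc_diff N c) y"
    unfolding exp_poly_def trunc_diff_def scaleR_diff_right sum_subtractf by simp
  ultimately show ?thesis unfolding exp_poly_def[abs_def] by simp
qed

lemma dx_exp_poly: "(dx ^^ k) (exp_poly x0 N c) = exp_poly x0 N ((trunc_diff N ^^ k) c)"
proof -
  have "dx (exp_poly x0 N c) = exp_poly x0 N (trunc_diff N c)" for c :: "nat \<Rightarrow> 'a"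
    by (rule ext, rule dx_eqI, rule exp_poly_derivative)
  then show ?thesis by (induction k) simp_all
qed

lemma smooth_exp_poly: "smooth (exp_poly x0 N c)"
  unfolding smooth_def dx_exp_poly by (intro allI differentiableI_vector[OF exp_poly_derivative])

lemma exp_poly_at: "exp_poly x0 N c x0 = exp (- x0) *\<^sub>R c 0"
  by (simp add: exp_poly_def sum.atMost_shift)

lemma exp_poly_tendsto: "(exp_poly x0 N c \<longlongrightarrow> 0) at_top"
proof -
  have s: "filterlim (\<lambda>y. y - x0) at_top at_top"
    using filterlim_tendsto_add_at_top[OF tendsto_const[of "- x0"] filterlim_ident] by simp
  have "((\<lambda>y. (y - x0) ^ j / exp (y - x0)) \<longlongrightarrow> 0) at_top" for j
    using filterlim_compose[OF tendsto_power_div_exp_0 s] .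
  then have "((\<lambda>y. \<Sum>j\<le>N. (exp (- x0) / fact j * ((y - x0) ^ j / exp (y - x0))) *\<^sub>R c j)
      \<longlongrightarrow> (\<Sum>j\<le>N. (exp (- x0) / fact j * 0) *\<^sub>R c j)) at_top"
    by (intro tendsto_intros)
  moreover have "exp_poly x0 N c = (\<lambda>y. \<Sum>j\<le>N. (exp (- x0) / fact j * ((y - x0) ^ j / exp (y - x0))) *\<^sub>R c j)"
    unfolding exp_poly_def scaleR_sum_right
    by (intro ext sum.cong refl) (simp add: exp_diff exp_minus field_simps)
  ultimately show ?thesis by simp
qed

text \<open>The binomial transform inverts finite differences, by Pascal's rule: the k-th difference
  at 0 of the transform of b is b k. The cut-off at N is not felt while j + k \<le> N.\<close>

lemma trunc_diff_binomial:
  assumes "j + k \<le> N"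
  shows "(trunc_diff N ^^ k) (\<lambda>j. \<Sum>i\<le>j. real (j choose i) *\<^sub>R b i) j
    = (\<Sum>i\<le>j. real (j choose i) *\<^sub>R (b (i + k) :: 'b::real_normed_vector))"
  using assms
proof (induction k arbitrary: j)
  case (Suc k)
  have "(trunc_diff N ^^ Suc k) (\<lambda>j. \<Sum>i\<le>j. real (j choose i) *\<^sub>R b i) j
      = (\<Sum>i\<le>Suc j. real (Suc j choose i) *\<^sub>R b (i + k)) - (\<Sum>i\<le>j. real (j choose i) *\<^sub>R b (i + k))"
    using Suc.prems by (simp add: trunc_diff_def Suc.IH del: binomial_Suc_Suc sum.atMost_Suc)
  also have "(\<Sum>i\<le>Suc j. real (Suc j choose i) *\<^sub>R b (i + k))
      = b k + (\<Sum>i\<le>j. real (Suc j choose Suc i) *\<^sub>R b (Suc i + k))"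
    by (subst sum.atMost_Suc_shift) simp
  also have "(\<Sum>i\<le>j. real (Suc j choose Suc i) *\<^sub>R b (Suc i + k))
      = (\<Sum>i\<le>j. real (j choose i) *\<^sub>R b (i + Suc k)) + (\<Sum>i\<le>j. real (j choose Suc i) *\<^sub>R b (Suc i + k))"
    by (simp add: sum.distrib scaleR_add_left)
  also have "b k + ((\<Sum>i\<le>j. real (j choose i) *\<^sub>R b (i + Suc k)) + (\<Sum>i\<le>j. real (j choose Suc i) *\<^sub>R b (Suc i + k)))
      = (\<Sum>i\<le>j. real (j choose i) *\<^sub>R b (i + Suc k)) + (\<Sum>i\<le>Suc j. real (j choose i) *\<^sub>R b (i + k))"
    using sum.atMost_Suc_shift[of "\<lambda>i. real (j choose i) *\<^sub>R b (i + k)" j] by simp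
  finally show ?case by simp
qed simp

lemma exists_decaying_jet:
  fixes v :: "real \<Rightarrow> 'b::real_normed_vector"
  shows "\<exists>w. smooth w \<and> (\<forall>k\<le>N. (dx ^^ k) w x0 = (dx ^^ k) v x0) \<and> (\<forall>k. ((dx ^^ k) w \<longlongrightarrow> 0) at_top)"
proof (intro exI conjI allI impI)
  \<comment> \<open>The factor exp x0 compensates the value exp (- x0) of the exponential at x0; c
    is the binomial transform, chosen so that its k-th difference at 0 is
    \<open>b k\<close>.\<close>
  define b where "b = (\<lambda>k. exp x0 *\<^sub>R (dx ^^ k) v x0)"
  define c where "c = (\<lambda>j. \<Sum>i\<le>j. real (j choose i) *\<^sub>R b i)"
  show "smooth (exp_poly x0 N c)" by (rule smooth_exp_poly)
  show "((dx ^^ k) (exp_poly x0 N c) \<longlongrightarrow> 0) at_top" for k unfolding dx_exp_poly by (rule exp_poly_tendsto)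
  show "(dx ^^ k) (exp_poly x0 N c) x0 = (dx ^^ k) v x0" if "k \<le> N" for k
    using trunc_diff_binomial[of 0 k N b] that
    by (simp add: dx_exp_poly exp_poly_at c_def b_def exp_minus)
qed

text \<open>Only a finite jet of v at x matters, so v may be replaced by a curve with this jet all
  of whose derivatives decay. Along that curve G is constant, and its limit at infinity is the
  constant term, which is zero.\<close>

lemma diff_poly_zero_derivative:
  assumes "diff_poly G" and d: "\<And>v x. smooth v \<Longrightarrow> (G v has_real_derivative 0) (at x)"
    and z: "G (\<lambda>_. 0) 0 = 0" and "smooth v"
  shows "G v x = 0"
proof -
  obtain N where N: "\<And>v w x. smooth v \<Longrightarrow> smooth w \<Longrightarrow> (\<forall>k\<le>N. (dx ^^ k) v x = (dx ^^ k) w x) \<Longrightarrow> G v x = G w x"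
    using diff_poly_finite_order[OF assms(1)] by metis
  obtain w where w: "smooth w" "\<forall>k\<le>N. (dx ^^ k) w x = (dx ^^ k) v x" "\<And>k. ((dx ^^ k) w \<longlongrightarrow> 0) at_top"
    using exists_decaying_jet[of N x v] by blast
  have "G w y = G w x" for y
    using DERIV_isconst_all[of "G w" y x] d[OF w(1)] by blast
  then have "G w = (\<lambda>_. G w x)" by blast
  moreover have "(G w \<longlongrightarrow> 0) at_top" using diff_poly_tendsto[OF assms(1) w(1,3)] z by simp
  ultimately have "((\<lambda>_::real. G w x) \<longlongrightarrow> 0) at_top" by simp
  then have "G w x = 0" by (simp add: tendsto_const_iff)
  then show ?thesis using N[OF w(1) assms(4)] w(2) by simp
qed

lemma formal_primitive_unique:
  fixes v :: "real \<Rightarrow> real^'n"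
  assumes "formal_primitive F G" "formal_primitive F H" "smooth v"
  shows "G v x = H v x"
proof -
  have "G v x \<bullet> b = H v x \<bullet> b" if "b \<in> Basis" for b
  proof -
    have "G v x \<bullet> b - H v x \<bullet> b = 0"
    proof (rule diff_poly_zero_derivative[where G = "\<lambda>v x. G v x \<bullet> b - H v x \<bullet> b" and v = v and x = x])
      show "diff_poly (\<lambda>v x. G v x \<bullet> b - H v x \<bullet> b)"
        using assms(1,2) that unfolding formal_primitive_def diff_poly_vec_def
        by (intro diff_poly_diff) auto
      fix u :: "real \<Rightarrow> real^'n" and y assume "smooth u"
      then have "(G u has_vector_derivative F u y) (at y)" "(H u has_vector_derivative F u y) (at y)"
        using assms(1,2) unfolding formal_primitive_def by auto
      then have "((\<lambda>y. G u y - H u y) has_vector_derivative 0) (at y)"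
        using has_vector_derivative_diff by fastforce
      then have "((\<lambda>y. (G u y - H u y) \<bullet> b) has_vector_derivative 0 \<bullet> b) (at y)"
        by (rule bounded_linear.has_vector_derivative[OF bounded_linear_inner_left])
      then show "((\<lambda>x. G u x \<bullet> b - H u x \<bullet> b) has_real_derivative 0) (at y)"
        by (simp add: has_real_derivative_iff_has_vector_derivative inner_diff_left)
    next
      show "G (\<lambda>_. 0) 0 \<bullet> b - H (\<lambda>_. 0) 0 \<bullet> b = 0"
        using assms(1,2) unfolding formal_primitive_def by simp
    qed fact
    then show ?thesis by simp
  qed
  then show ?thesis by (metis euclidean_eqI)
qed

lemma dinv_eq:
  assumes "formal_primitive F G" "smooth v" shows "dinv F v = G v"
proof -
  have "formal_primitive F (dinv F)" unfolding dinv_def by (rule someI[of "formal_primitive F", OF assms(1)])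
  then show ?thesis using formal_primitive_unique[OF _ assms(1,2)] by blast
qed

subsection \<open>Local solution of the Lax equation\<close>

text \<open>
  \<open>lax_p\<close> is solved from the normalisation and \<open>lax_U\<close> from \<open>p U = r \<and> q\<close>, while \<open>lax_q\<close> and
  \<open>lax_r\<close> come from the differential equations for \<open>r'\<close> and \<open>q'\<close>.
\<close>

function lax_p :: "nat \<Rightarrow> (real \<Rightarrow> real^'n) \<Rightarrow> real \<Rightarrow> real"
  and lax_q :: "nat \<Rightarrow> (real \<Rightarrow> real^'n) \<Rightarrow> real \<Rightarrow> real^'n"
  and lax_r :: "nat \<Rightarrow> (real \<Rightarrow> real^'n) \<Rightarrow> real \<Rightarrow> real^'n"
  and lax_U :: "nat \<Rightarrow> (real \<Rightarrow> real^'n) \<Rightarrow> real \<Rightarrow> real^'n^'n" where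
  "lax_p 0 = (\<lambda>v x. 1)"
| "lax_q 0 = (\<lambda>v x. 0)"
| "lax_r 0 = (\<lambda>v x. v x)"
| "lax_U 0 = (\<lambda>v x. 0)"
| "lax_p (Suc j) = (\<lambda>v x.
     ((\<Sum>a=0..j. lax_r a v x \<bullet> lax_r (j - a) v x) + (\<Sum>a=0..j. lax_U a v x \<bullet> lax_U (j - a) v x) / 2
      - (\<Sum>a=1..j. lax_p a v x * lax_p (Suc j - a) v x) - (\<Sum>a=1..j. lax_q a v x \<bullet> lax_q (Suc j - a) v x)) / 2)"
| "lax_q (Suc j) = (\<lambda>v x. dx (lax_r j v) x + v x v* lax_U j v x)"
| "lax_r (Suc j) = (\<lambda>v x. dx (lax_q (Suc j) v) x + lax_p (Suc j) v x *\<^sub>R v x)"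
| "lax_U (Suc j) = (\<lambda>v x. (\<Sum>a=0..j. wedge (lax_r a v x) (lax_q (Suc j - a) v x))
      - (\<Sum>a=1..Suc j. lax_p a v x *\<^sub>R lax_U (Suc j - a) v x))"
  by pat_completeness auto
termination
  \<comment> \<open>At equal index r and U call q, and one of them p, so they rank one higher. From
    index j + 1, p and q call r and U at index j at most, and 2 * j + 1 < 2 * (j + 1).\<close>
  by (relation "Wellfounded.measure (\<lambda>s. case s of Inl (Inl j) \<Rightarrow> 2 * j | Inl (Inr j) \<Rightarrow> 2 * j
        | Inr (Inl j) \<Rightarrow> 2 * j + 1 | Inr (Inr j) \<Rightarrow> 2 * j + 1)") auto

section \<open>Vector and matrix valued differential polynomials, componentwise\<close>

definition diff_polyv :: "((real \<Rightarrow> real^'n) \<Rightarrow> real \<Rightarrow> real^'m) \<Rightarrow> bool" where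
  "diff_polyv F \<longleftrightarrow> (\<forall>i. diff_poly (\<lambda>v x. F v x $ i))"

definition diff_polym :: "((real \<Rightarrow> real^'n) \<Rightarrow> real \<Rightarrow> real^'m^'l) \<Rightarrow> bool" where
  "diff_polym F \<longleftrightarrow> (\<forall>i. diff_polyv (\<lambda>v x. F v x $ i))"

lemma diff_polyv_has_derivative:
  assumes "diff_polyv F" "smooth v"
  shows "(F v has_vector_derivative dx (F v) x) (at x)"
    and "dx (F v) x $ i = dx (\<lambda>y. F v y $ i) x"
proof -
  have "((\<lambda>y. F v y $ i) has_real_derivative dx (\<lambda>y. F v y $ i) x) (at x)" for i
    using assms(1) unfolding diff_polyv_def
    by (intro diff_poly_has_derivative[of "\<lambda>v y. F v y $ i", OF _ assms(2)]) blast
  then have "(F v has_vector_derivative (\<chi> i. dx (\<lambda>y. F v y $ i) x)) (at x)"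
    unfolding has_vector_derivative_vec_iff by simp
  moreover from this have "dx (F v) x = (\<chi> i. dx (\<lambda>y. F v y $ i) x)" by (rule dx_eqI)
  ultimately show "(F v has_vector_derivative dx (F v) x) (at x)" "dx (F v) x $ i = dx (\<lambda>y. F v y $ i) x"
    by simp_all
qed

lemma diff_polyv_dx: "diff_polyv F \<Longrightarrow> diff_polyv (\<lambda>v. dx (F v))"
  unfolding diff_polyv_def
proof
  fix i assume F: "\<forall>i. diff_poly (\<lambda>v x. F v x $ i)"
  show "diff_poly (\<lambda>v x. dx (F v) x $ i)"
  proof (rule diff_poly.cong)
    show "diff_poly (\<lambda>v. dx (\<lambda>x. F v x $ i))" using F by (intro diff_poly_dx) simp
    show "dx (\<lambda>x. F v x $ i) x = dx (F v) x $ i" if "smooth v" for v x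
      using diff_polyv_has_derivative(2)[of F v x i] F that unfolding diff_polyv_def by simp
  qed
qed

lemma diff_polyv_add: "diff_polyv F \<Longrightarrow> diff_polyv G \<Longrightarrow> diff_polyv (\<lambda>v x. F v x + G v x)"
  unfolding diff_polyv_def by (simp add: diff_poly.add)

lemma diff_polyv_scale: "diff_poly F \<Longrightarrow> diff_polyv G \<Longrightarrow> diff_polyv (\<lambda>v x. F v x *\<^sub>R G v x)"
  unfolding diff_polyv_def by (simp add: diff_poly.mult)

lemma diff_poly_inner: "diff_polyv F \<Longrightarrow> diff_polyv G \<Longrightarrow> diff_poly (\<lambda>v x. F v x \<bullet> G v x)"
  unfolding diff_polyv_def inner_vec_def by (simp add: diff_poly_sum diff_poly.mult)

lemma diff_poly_minner: "diff_polym F \<Longrightarrow> diff_polym G \<Longrightarrow> diff_poly (\<lambda>v x. F v x \<bullet> G v x)"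
  unfolding diff_polym_def by (subst inner_vec_def, intro diff_poly_sum diff_poly_inner) blast+

lemma diff_polyv_row: "diff_polyv F \<Longrightarrow> diff_polym G \<Longrightarrow> diff_polyv (\<lambda>v x. F v x v* G v x)"
  unfolding diff_polyv_def diff_polym_def vector_matrix_mult_def
  by (simp add: diff_poly_sum diff_poly.mult)

lemma wedge_component: "wedge A B $ i $ j = A $ i * B $ j - B $ i * A $ j"
  by (simp add: wedge_def outer_def)

lemma diff_polym_wedge: "diff_polyv F \<Longrightarrow> diff_polyv G \<Longrightarrow> diff_polym (\<lambda>v x. wedge (F v x) (G v x))"
  unfolding diff_polyv_def diff_polym_def
  by (simp add: wedge_component diff_poly_diff diff_poly.mult)

lemma diff_poly_const_half: "diff_poly F \<Longrightarrow> diff_poly (\<lambda>v x. F v x / 2)"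
  using diff_poly.mult[OF _ diff_poly.const[of "1/2"], of F] by simp

lemma diff_polyv_id: "diff_polyv (\<lambda>v. v)"
  unfolding diff_polyv_def by (intro allI diff_poly_component)

lemma diff_poly_lax:
  "diff_poly (lax_p k :: (real \<Rightarrow> real^'n) \<Rightarrow> _) \<and> diff_polyv (lax_q k :: (real \<Rightarrow> real^'n) \<Rightarrow> _) \<and>
   diff_polyv (lax_r k :: (real \<Rightarrow> real^'n) \<Rightarrow> _) \<and> diff_polym (lax_U k :: (real \<Rightarrow> real^'n) \<Rightarrow> _)"
proof (induction k rule: less_induct)
  case (less k)
  show ?case
  proof (cases k)
    case 0
    then show ?thesis
      using diff_polyv_id by (simp add: diff_polyv_def diff_polym_def diff_poly.const)
  next
    case (Suc j)
    have I: "diff_poly (lax_p a :: (real \<Rightarrow> real^'n) \<Rightarrow> _)" "diff_polyv (lax_q a :: (real \<Rightarrow> real^'n) \<Rightarrow> _)" "diff_polyv (lax_r a :: (real \<Rightarrow> real^'n) \<Rightarrow> _)" "diff_polym (lax_U a :: (real \<Rightarrow> real^'n) \<Rightarrow> _)" if "a \<le> j" for a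
      using less.IH[of a] that Suc by simp_all
    have p: "diff_poly (lax_p (Suc j) :: (real \<Rightarrow> real^'n) \<Rightarrow> _)"
      unfolding lax_p.simps
      by (intro diff_poly_const_half diff_poly_diff diff_poly.add diff_poly_sum diff_poly_inner diff_poly_minner
          diff_poly.mult I) auto
    have q: "diff_polyv (lax_q (Suc j) :: (real \<Rightarrow> real^'n) \<Rightarrow> _)"
      unfolding lax_q.simps by (intro diff_polyv_add diff_polyv_dx diff_polyv_row diff_polyv_id I) auto
    have r: "diff_polyv (lax_r (Suc j) :: (real \<Rightarrow> real^'n) \<Rightarrow> _)"
      unfolding lax_r.simps by (intro diff_polyv_add diff_polyv_dx diff_polyv_scale diff_polyv_id p q)
    \<comment> \<open>The convolution defining U at index j + 1 involves p and q up to that same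
      index, beyond the reach of the induction hypothesis.\<close>
    have p': "diff_poly (lax_p a :: (real \<Rightarrow> real^'n) \<Rightarrow> _)" and q': "diff_polyv (lax_q a :: (real \<Rightarrow> real^'n) \<Rightarrow> _)" if "a \<le> Suc j" for a
      using p q I that by (auto simp: le_Suc_eq)
    have "diff_poly (\<lambda>(v :: real \<Rightarrow> real^'n) x. (\<Sum>a=0..j. wedge (lax_r a v x) (lax_q (Suc j - a) v x) $ i $ l)
      - (\<Sum>a=1..Suc j. lax_p a v x * lax_U (Suc j - a) v x $ i $ l))" for i l
    proof (intro diff_poly_diff diff_poly_sum diff_poly.mult)
      show "diff_poly (\<lambda>(v :: real \<Rightarrow> real^'n) x. wedge (lax_r a v x) (lax_q (Suc j - a) v x) $ i $ l)" if "a \<in> {0..j}" for a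
        using diff_polym_wedge[OF I(3) q', of a "Suc j - a"] that by (auto simp: diff_polym_def diff_polyv_def)
      show "diff_poly (\<lambda>(v :: real \<Rightarrow> real^'n) x. lax_U (Suc j - a) v x $ i $ l)" if "a \<in> {1..Suc j}" for a
        using I(4)[of "Suc j - a"] that by (auto simp: diff_polym_def diff_polyv_def)
      show "diff_poly (lax_p a :: (real \<Rightarrow> real^'n) \<Rightarrow> _)" if "a \<in> {1..Suc j}" for a
        using p'[of a] that by auto
    qed
    then have "diff_polym (lax_U (Suc j) :: (real \<Rightarrow> real^'n) \<Rightarrow> _)"
      unfolding lax_U.simps diff_polym_def diff_polyv_def
      by (simp del: sum.cl_ivl_Suc)
    with p q r show ?thesis unfolding Suc by blast
  qed
qed

lemmas diff_poly_lax_p = diff_poly_lax[THEN conjunct1]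
  and diff_polyv_lax_q = diff_poly_lax[THEN conjunct2, THEN conjunct1]
  and diff_polyv_lax_r = diff_poly_lax[THEN conjunct2, THEN conjunct2, THEN conjunct1]
  and diff_polym_lax_U = diff_poly_lax[THEN conjunct2, THEN conjunct2, THEN conjunct2]

lemma diff_polyv_nth: "diff_polyv F \<Longrightarrow> diff_poly (\<lambda>v x. F v x $ i)"
  unfolding diff_polyv_def by blast

lemma diff_polym_nth: "diff_polym F \<Longrightarrow> diff_poly (\<lambda>v x. F v x $ i $ j)"
  unfolding diff_polym_def diff_polyv_def by blast

section \<open>Generating series in X, their constraints and the Lax equation\<close>

definition ser :: "(nat \<Rightarrow> (real \<Rightarrow> real^'n) \<Rightarrow> real \<Rightarrow> real) \<Rightarrow> (real \<Rightarrow> real^'n) \<Rightarrow> real \<Rightarrow> real fps" where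
  "ser F v x = Abs_fps (\<lambda>k. F k v x)"

definition serv :: "(nat \<Rightarrow> (real \<Rightarrow> real^'n) \<Rightarrow> real \<Rightarrow> real^'m) \<Rightarrow> (real \<Rightarrow> real^'n) \<Rightarrow> real \<Rightarrow> real fps^'m" where
  "serv F v x = (\<chi> i. ser (\<lambda>k v x. F k v x $ i) v x)"

definition serm :: "(nat \<Rightarrow> (real \<Rightarrow> real^'n) \<Rightarrow> real \<Rightarrow> real^'m^'m) \<Rightarrow> (real \<Rightarrow> real^'n) \<Rightarrow> real \<Rightarrow> real fps^'m^'m" where
  "serm F v x = (\<chi> i. serv (\<lambda>k v x. F k v x $ i) v x)"

definition cvec :: "real^'n \<Rightarrow> real fps^'n" where
  "cvec a = (\<chi> i. fps_const (a $ i))"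

abbreviation "Lp \<equiv> ser lax_p"
abbreviation "Lq \<equiv> serv lax_q"
text \<open>This is q / X, a power series because \<open>lax_q 0\<close> vanishes.\<close>

abbreviation "Lqt \<equiv> serv (\<lambda>k. lax_q (Suc k))"
abbreviation "Lr \<equiv> serv lax_r"
abbreviation "LU \<equiv> serm lax_U"

lemma fps_nth_ser: "fps_nth (ser F v x) k = F k v x"
  and fps_nth_serv: "fps_nth (serv H v x $ i) k = H k v x $ i"
  and fps_nth_serm: "fps_nth (serm G v x $ i $ j) k = G k v x $ i $ j"
  and fps_nth_cvec: "fps_nth (cvec a $ i) k = (if k = 0 then a $ i else 0)"
  by (simp_all add: ser_def serv_def serm_def cvec_def)

lemmas fps_nth_sers = fps_nth_ser fps_nth_serv fps_nth_serm

lemma Lp_nth_0: "fps_nth (Lp v x) 0 = 1"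
  by (simp add: fps_nth_ser)

lemma Lp_nonzero: "Lp v x \<noteq> 0"
  using Lp_nth_0[of v x] by auto

lemma Lq_eq: "Lq v x = fps_X *s Lqt v x"
proof -
  have "fps_nth (Lq v x $ i) k = fps_nth (fps_X * Lqt v x $ i) k" for i k
    by (cases k) (simp_all add: fps_nth_sers)
  then show ?thesis by (simp add: vec_eq_iff fps_eq_iff)
qed

text \<open>The recursion for \<open>lax_U\<close> is one coefficient of this identity, solved for
  the term with factor \<open>lax_p 0\<close> = 1. Its sum of wedges may stop one index early
  because \<open>lax_q 0\<close> vanishes.\<close>

lemma lax_plucker: "mscale (Lp v x) (LU v x) = vwedge (Lr v x) (Lq v x)"
proof -
  have "fps_nth (Lp v x * LU v x $ i $ j) k = fps_nth (Lr v x $ i * Lq v x $ j - Lr v x $ j * Lq v x $ i) k" for i j k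
  proof (cases k)
    case 0
    then show ?thesis by (simp add: fps_nth_sers)
  next
    case (Suc l)
    have "fps_nth (Lp v x * LU v x $ i $ j) k
       = lax_U (Suc l) v x $ i $ j + (\<Sum>a=1..Suc l. lax_p a v x * lax_U (Suc l - a) v x $ i $ j)"
      unfolding Suc fps_mult_nth fps_nth_sers by (subst sum.atLeast_Suc_atMost) (simp_all add: One_nat_def)
    also have "\<dots> = (\<Sum>a=0..l. wedge (lax_r a v x) (lax_q (Suc l - a) v x) $ i $ j)"
      by (simp del: sum.cl_ivl_Suc)
    also have "\<dots> = (\<Sum>a=0..l. lax_r a v x $ i * lax_q (Suc l - a) v x $ j)
        - (\<Sum>a=0..l. lax_r a v x $ j * lax_q (Suc l - a) v x $ i)"
      by (simp add: wedge_component sum_subtractf mult.commute)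
    also have "\<dots> = fps_nth (Lr v x $ i * Lq v x $ j - Lr v x $ j * Lq v x $ i) k"
      unfolding Suc fps_sub_nth fps_mult_nth fps_nth_sers by (simp add: sum.cl_ivl_Suc)
    finally show ?thesis .
  qed
  then show ?thesis
    by (simp add: vec_eq_iff fps_eq_iff mscale_def vwedge_def mult.commute)
qed

text \<open>Twice the normalisation, which removes the fraction in front of |U|^2. The coefficient
  of X^(j+1) is the recursion for \<open>lax_p (Suc j)\<close>.\<close>

lemma lax_norm:
  "2 * Lp v x * Lp v x + 2 * vdot (Lq v x) (Lq v x)
    - fps_X * (2 * vdot (Lr v x) (Lr v x) + mdot (LU v x) (LU v x)) = 2"
proof -
  have rr: "fps_nth (vdot (Lr v x) (Lr v x)) k = (\<Sum>a=0..k. lax_r a v x \<bullet> lax_r (k - a) v x)" for k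
    unfolding vdot_def fps_sum_nth fps_mult_nth fps_nth_sers inner_vec_def by (subst sum.swap) simp
  have qq: "fps_nth (vdot (Lq v x) (Lq v x)) k = (\<Sum>a=0..k. lax_q a v x \<bullet> lax_q (k - a) v x)" for k
    unfolding vdot_def fps_sum_nth fps_mult_nth fps_nth_sers inner_vec_def by (subst sum.swap) simp
  have "fps_nth (mdot (LU v x) (LU v x)) k
      = (\<Sum>i\<in>UNIV. \<Sum>a=0..k. \<Sum>j\<in>UNIV. lax_U a v x $ i $ j * lax_U (k - a) v x $ i $ j)" for k
    unfolding mdot_def fps_sum_nth fps_mult_nth fps_nth_sers
    by (intro sum.cong refl sum.swap)
  also have "\<dots> k = (\<Sum>a=0..k. lax_U a v x \<bullet> lax_U (k - a) v x)" for k
    unfolding inner_vec_def by (subst sum.swap) simp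
  finally have UU: "fps_nth (mdot (LU v x) (LU v x)) k = (\<Sum>a=0..k. lax_U a v x \<bullet> lax_U (k - a) v x)" for k .
  have "fps_nth (Lp v x * Lp v x + vdot (Lq v x) (Lq v x)
    - fps_X * (vdot (Lr v x) (Lr v x) + fps_const (1/2) * mdot (LU v x) (LU v x))) k = fps_nth 1 k" for k
  proof (cases k)
    case 0
    then show ?thesis by (simp add: qq fps_nth_sers)
  next
    case (Suc j)
    \<comment> \<open>Both boundary terms are split off. For p they add up to 2 *
      \<open>lax_p (Suc j)\<close>, since \<open>lax_p 0\<close> = 1, which explains the final
      division by 2 in the recursion; for q they vanish.\<close>
    have s: "(\<Sum>a=0..Suc j. f a) = f 0 + (\<Sum>a=1..j. f a) + f (Suc j)" for f :: "nat \<Rightarrow> real"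
      by (subst sum.atLeast_Suc_atMost) (simp_all add: One_nat_def)
    have "fps_nth (Lp v x * Lp v x) k = 2 * lax_p (Suc j) v x + (\<Sum>a=1..j. lax_p a v x * lax_p (Suc j - a) v x)"
      unfolding Suc fps_mult_nth fps_nth_sers s by (simp del: lax_p.simps(2))
    moreover have "fps_nth (vdot (Lq v x) (Lq v x)) k = (\<Sum>a=1..j. lax_q a v x \<bullet> lax_q (Suc j - a) v x)"
      unfolding Suc qq s by (simp del: lax_q.simps(2))
    moreover have "fps_nth (fps_X * (vdot (Lr v x) (Lr v x) + fps_const (1/2) * mdot (LU v x) (LU v x))) k
       = (\<Sum>a=0..j. lax_r a v x \<bullet> lax_r (j - a) v x) + (\<Sum>a=0..j. lax_U a v x \<bullet> lax_U (j - a) v x) / 2"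
      unfolding Suc by (simp add: rr UU)
    moreover have "2 * lax_p (Suc j) v x = (\<Sum>a=0..j. lax_r a v x \<bullet> lax_r (j - a) v x)
      + (\<Sum>a=0..j. lax_U a v x \<bullet> lax_U (j - a) v x) / 2
      - (\<Sum>a=1..j. lax_p a v x * lax_p (Suc j - a) v x) - (\<Sum>a=1..j. lax_q a v x \<bullet> lax_q (Suc j - a) v x)"
      by (subst lax_p.simps) simp
    moreover have "fps_nth (1 :: real fps) k = 0" by (simp add: Suc)
    ultimately show ?thesis unfolding fps_add_nth fps_sub_nth by linarith
  qed
  then have "Lp v x * Lp v x + vdot (Lq v x) (Lq v x)
    - fps_X * (vdot (Lr v x) (Lr v x) + fps_const (1/2) * mdot (LU v x) (LU v x)) = 1"
    by (rule fps_ext)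
  then have "2 * (Lp v x * Lp v x + vdot (Lq v x) (Lq v x)
    - fps_X * (vdot (Lr v x) (Lr v x) + fps_const (1/2) * mdot (LU v x) (LU v x))) = 2" by simp
  moreover have "2 * (fps_const (1/2) * a) = a" for a :: "real fps"
    by (simp add: fps_eq_iff numeral_fps_const)
  moreover have "2 * (a + b - fps_X * (c + d)) = 2 * a + 2 * b - fps_X * (2 * c + 2 * d)" for a b c d :: "real fps"
    by (simp add: algebra_simps)
  ultimately show ?thesis by (simp only: mult.assoc)
qed

lemma LU_skew: "skew (LU v x)"
  by (rule skew_of_plucker[OF Lp_nonzero lax_plucker])

lemma Lr_deriv:
  assumes "smooth v"
  shows "has_fpsv_deriv (Lr v) (Lqt v x - cvec (v x) v* LU v x) x"
proof -
  have "((\<lambda>y. lax_r k v y $ i) has_real_derivative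
      fps_nth ((Lqt v x - cvec (v x) v* LU v x) $ i) k) (at x)" for k i
  proof -
    have "fps_nth ((cvec (v x) v* LU v x) $ i) k = (v x v* lax_U k v x) $ i"
      by (simp add: vector_matrix_mult_def fps_sum_nth cvec_def fps_nth_sers)
    then have "fps_nth ((Lqt v x - cvec (v x) v* LU v x) $ i) k = dx (lax_r k v) x $ i"
      by (simp add: fps_nth_sers)
    then show ?thesis
      using diff_polyv_has_derivative(1)[OF diff_polyv_lax_r assms] unfolding has_vector_derivative_vec_iff by metis
  qed
  then show ?thesis by (simp add: has_fpsv_deriv_def has_fps_deriv_def fps_nth_sers)
qed

lemma Lq_deriv:
  assumes "smooth v"
  shows "has_fpsv_deriv (Lq v) (Lr v x - Lp v x *s cvec (v x)) x"
proof -
  have "((\<lambda>y. lax_q k v y $ i) has_real_derivative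
      fps_nth ((Lr v x - Lp v x *s cvec (v x)) $ i) k) (at x)" for k i
  proof (cases k)
    case 0
    then show ?thesis by (simp add: fps_nth_sers cvec_def)
  next
    case (Suc j)
    then have "fps_nth ((Lr v x - Lp v x *s cvec (v x)) $ i) k = dx (lax_q k v) x $ i"
      by (simp add: fps_nth_sers cvec_def del: lax_p.simps lax_q.simps)
    then show ?thesis
      using diff_polyv_has_derivative(1)[OF diff_polyv_lax_q assms] unfolding has_vector_derivative_vec_iff by metis
  qed
  then show ?thesis by (simp add: has_fpsv_deriv_def has_fps_deriv_def fps_nth_sers)
qed

lemma serv_has_deriv:
  assumes "\<And>k. diff_polyv (F k)" "smooth v"
  shows "has_fpsv_deriv (serv F v) (serv (\<lambda>k v. dx (F k v)) v x) x"
  unfolding has_fpsv_deriv_def has_fps_deriv_def fps_nth_sers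
  using diff_polyv_has_derivative(1)[OF assms] has_vector_derivative_vec_iff by blast

lemma Lqt_deriv:
  assumes "smooth v"
  obtains d where "has_fpsv_deriv (Lqt v) d x" "fps_X *s d = Lr v x - Lp v x *s cvec (v x)"
proof
  show d: "has_fpsv_deriv (Lqt v) (serv (\<lambda>k v. dx (lax_q (Suc k) v)) v x) x"
    by (rule serv_has_deriv[OF diff_polyv_lax_q assms])
  have "has_fpsv_deriv (\<lambda>y. fps_X *s Lqt v y) (0 *s Lqt v x + fps_X *s serv (\<lambda>k v. dx (lax_q (Suc k) v)) v x) x"
    by (intro has_fpsv_deriv_scale has_fps_deriv_const d)
  then show "fps_X *s serv (\<lambda>k v. dx (lax_q (Suc k) v)) v x = Lr v x - Lp v x *s cvec (v x)"
    unfolding Lq_eq[symmetric] using has_fpsv_deriv_unique[OF _ Lq_deriv[OF assms]] by fastforce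
qed

lemma fps_two_neq_0: "(2 :: real fps) \<noteq> 0"
  by (simp add: numeral_fps_const)

lemma fps_double_eq_0: "2 * a = 0 \<Longrightarrow> a = 0" for a :: "real fps"
  using fps_two_neq_0 mult_eq_0_iff by blast

text \<open>Here locality is won: p and U were defined without integration and yet are primitives of
  v \<bullet> q and v \<and> r. Their coefficients are differential polynomials, so derivatives p'
  and U' exist, and the differentiated constraints leave only one possibility for them.\<close>

lemma Lp_LU_deriv:
  fixes v :: "real \<Rightarrow> real^'n"
  assumes "smooth v"
  shows "has_fps_deriv (Lp v) (vdot (cvec (v x)) (Lq v x)) x"
    and "has_fpsm_deriv (LU v) (vwedge (cvec (v x)) (Lr v x)) x"
proof -
  define p' where "p' = Abs_fps (\<lambda>k. dx (lax_p k v) x)"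
  define U' where "U' = (\<chi> i j. Abs_fps (\<lambda>k. dx (\<lambda>y. lax_U k v y $ i $ j) x))"
  have p: "has_fps_deriv (Lp v) p' x"
    unfolding has_fps_deriv_def p'_def fps_nth_sers
    using diff_poly_has_derivative[OF diff_poly_lax_p assms] by simp
  have U: "has_fpsm_deriv (LU v) U' x"
    unfolding has_fpsm_deriv_def has_fpsv_deriv_def has_fps_deriv_def U'_def fps_nth_sers
    using diff_poly_has_derivative[OF diff_polym_nth[OF diff_polym_lax_U] assms] by simp
  have "has_fps_deriv (\<lambda>y. 2 * Lp v y * Lp v y + 2 * vdot (Lq v y) (Lq v y)
    - fps_X * (2 * vdot (Lr v y) (Lr v y) + mdot (LU v y) (LU v y)))
    ((0 * Lp v x + 2 * p') * Lp v x + 2 * Lp v x * p' + (0 * vdot (Lq v x) (Lq v x)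
      + 2 * (vdot (Lr v x - Lp v x *s cvec (v x)) (Lq v x) + vdot (Lq v x) (Lr v x - Lp v x *s cvec (v x))))
    - (0 * (2 * vdot (Lr v x) (Lr v x) + mdot (LU v x) (LU v x)) + fps_X * (0 * vdot (Lr v x) (Lr v x)
      + 2 * (vdot (Lqt v x - cvec (v x) v* LU v x) (Lr v x) + vdot (Lr v x) (Lqt v x - cvec (v x) v* LU v x))
      + (mdot U' (LU v x) + mdot (LU v x) U')))) x"
    by (rule fps_deriv_rules p U Lr_deriv[OF assms] Lq_deriv[OF assms])+
  from has_fps_deriv_unique[OF this[unfolded lax_norm] has_fps_deriv_const]
  have "2 * (2 * (Lp v x * p') + 2 * vdot (Lq v x) (Lr v x - Lp v x *s cvec (v x))
             - fps_X * (2 * vdot (Lr v x) (Lqt v x - cvec (v x) v* LU v x) + mdot (LU v x) U')) = 0"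
    unfolding vdot_commute[of "Lr v x - Lp v x *s cvec (v x)" "Lq v x"]
      vdot_commute[of "Lqt v x - cvec (v x) v* LU v x" "Lr v x"] mdot_commute[of U' "LU v x"]
    by (simp only: algebra_simps mult_zero_left add_0_left mult_2 mult_2_right add_0_right)
  then have n: "2 * (Lp v x * p') + 2 * vdot (Lq v x) (Lr v x - Lp v x *s cvec (v x))
             - fps_X * (2 * vdot (Lr v x) (Lqt v x - cvec (v x) v* LU v x) + mdot (LU v x) U') = 0"
    by (rule fps_double_eq_0)
  have 1: "has_fpsm_deriv (\<lambda>y. mscale (Lp v y) (LU v y)) (mscale p' (LU v x) + mscale (Lp v x) U') x"
    by (rule fps_deriv_rules p U)+
  have 2: "has_fpsm_deriv (\<lambda>y. vwedge (Lr v y) (Lq v y)) (vwedge (Lqt v x - cvec (v x) v* LU v x) (Lq v x)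
      + vwedge (Lr v x) (Lr v x - Lp v x *s cvec (v x))) x"
    by (rule fps_deriv_rules Lr_deriv[OF assms] Lq_deriv[OF assms])+
  have pl: "mscale p' (LU v x) + mscale (Lp v x) U' = vwedge (Lqt v x - cvec (v x) v* LU v x) (Lq v x)
      + vwedge (Lr v x) (Lr v x - Lp v x *s cvec (v x))"
    by (rule has_fpsm_deriv_unique[OF 1[unfolded lax_plucker] 2])
  \<comment> \<open>The determinant of the linear system for p' and U' is a nonzero power series
    because its constant term is 2.\<close>
  have "fps_nth (2 * Lp v x * Lp v x + fps_X * mdot (LU v x) (LU v x)) 0 = 2"
    by (simp add: Lp_nth_0)
  then have nz: "2 * Lp v x * Lp v x + fps_X * mdot (LU v x) (LU v x) \<noteq> 0"
    by (metis fps_zero_nth zero_neq_numeral)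
  note d = constraints_determine_derivatives[OF Lp_nonzero lax_plucker nz n pl refl Lq_eq]
  show "has_fps_deriv (Lp v) (vdot (cvec (v x)) (Lq v x)) x" using p unfolding d(1) .
  show "has_fpsm_deriv (LU v) (vwedge (cvec (v x)) (Lr v x)) x" using U unfolding d(2) .
qed

subsection \<open>Variations of the solution\<close>

definition dser :: "(nat \<Rightarrow> (real \<Rightarrow> real^'n) \<Rightarrow> real \<Rightarrow> real) \<Rightarrow> (real \<Rightarrow> real^'n) \<Rightarrow> (real \<Rightarrow> real^'n) \<Rightarrow> real \<Rightarrow> real fps" where
  "dser F v w x = Abs_fps (\<lambda>k. variation (F k) v w x)"

definition dserv :: "(nat \<Rightarrow> (real \<Rightarrow> real^'n) \<Rightarrow> real \<Rightarrow> real^'m) \<Rightarrow> (real \<Rightarrow> real^'n) \<Rightarrow> (real \<Rightarrow> real^'n) \<Rightarrow> real \<Rightarrow> real fps^'m" where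
  "dserv F v w x = (\<chi> i. dser (\<lambda>k v x. F k v x $ i) v w x)"

definition dserm :: "(nat \<Rightarrow> (real \<Rightarrow> real^'n) \<Rightarrow> real \<Rightarrow> real^'m^'m) \<Rightarrow> (real \<Rightarrow> real^'n) \<Rightarrow> (real \<Rightarrow> real^'n) \<Rightarrow> real \<Rightarrow> real fps^'m^'m" where
  "dserm F v w x = (\<chi> i. dserv (\<lambda>k v x. F k v x $ i) v w x)"

lemma fps_nth_dser: "fps_nth (dser F v w x) k = variation (F k) v w x"
  and fps_nth_dserv: "fps_nth (dserv H v w x $ i) k = variation (\<lambda>v x. H k v x $ i) v w x"
  and fps_nth_dserm: "fps_nth (dserm G v w x $ i $ j) k = variation (\<lambda>v x. G k v x $ i $ j) v w x"
  by (simp_all add: dser_def dserv_def dserm_def)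

lemmas fps_nth_dsers = fps_nth_dser fps_nth_dserv fps_nth_dserm

abbreviation "dLp \<equiv> dser lax_p"
abbreviation "dLq \<equiv> dserv lax_q"
abbreviation "dLqt \<equiv> dserv (\<lambda>k. lax_q (Suc k))"
abbreviation "dLr \<equiv> dserv lax_r"
abbreviation "dLU \<equiv> dserm lax_U"

lemma ser_variation:
  assumes "\<And>k. diff_poly (F k)" "smooth v" "smooth w"
  shows "has_fps_deriv (\<lambda>e. ser F (\<lambda>y. v y + e *\<^sub>R w y) x) (dser F v w x) 0"
  unfolding has_fps_deriv_def fps_nth_sers fps_nth_dsers
  using diff_poly_has_variation[OF assms] by simp

lemma serv_variation:
  assumes "\<And>k. diff_polyv (F k)" "smooth v" "smooth w"
  shows "has_fpsv_deriv (\<lambda>e. serv F (\<lambda>y. v y + e *\<^sub>R w y) x) (dserv F v w x) 0"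
  unfolding has_fpsv_deriv_def has_fps_deriv_def fps_nth_sers fps_nth_dsers
  using diff_poly_has_variation[OF diff_polyv_nth[OF assms(1)] assms(2,3)] by simp

lemma serm_variation:
  assumes "\<And>k. diff_polym (F k)" "smooth v" "smooth w"
  shows "has_fpsm_deriv (\<lambda>e. serm F (\<lambda>y. v y + e *\<^sub>R w y) x) (dserm F v w x) 0"
  unfolding has_fpsm_deriv_def has_fpsv_deriv_def has_fps_deriv_def fps_nth_sers fps_nth_dsers
  using diff_poly_has_variation[OF diff_polym_nth[OF assms(1)] assms(2,3)] by simp

lemma cvec_variation: "has_fpsv_deriv (\<lambda>e. cvec (v x + e *\<^sub>R w x)) (cvec (w x)) 0"
  unfolding has_fpsv_deriv_def has_fps_deriv_def fps_nth_cvec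
  by (auto intro!: derivative_eq_intros)

text \<open>Total derivative and variation commute, so a formula \<open>B\<close> for the total
  derivative, valid along every smooth curve, may be varied instead. This yields the linearised Lax
  equation from the Lax equation.\<close>

lemma dserv_deriv:
  fixes F :: "nat \<Rightarrow> (real \<Rightarrow> real^'n) \<Rightarrow> real \<Rightarrow> real^'m"
  assumes F: "\<And>k. diff_polyv (F k)" and s: "smooth v" "smooth w"
    and B: "\<And>u. smooth u \<Longrightarrow> has_fpsv_deriv (serv F u) (B u) x"
    and D: "has_fpsv_deriv (\<lambda>e. B (\<lambda>y. v y + e *\<^sub>R w y)) D 0"
  shows "has_fpsv_deriv (dserv F v w) D x"
  unfolding has_fpsv_deriv_def has_fps_deriv_def fps_nth_dsers
proof (intro allI)
  fix i k
  have "dx (\<lambda>x. F k u x $ i) x = fps_nth (B u $ i) k" if "smooth u" for u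
    using B[OF that] unfolding has_fpsv_deriv_def has_fps_deriv_def fps_nth_sers
    by (intro dx_real_eqI) blast
  then have "variation (\<lambda>v. dx (\<lambda>x. F k v x $ i)) v w x
      = deriv (\<lambda>e. fps_nth (B (\<lambda>y. v y + e *\<^sub>R w y) $ i) k) 0"
    unfolding variation_def using smooth_comb[OF s] by simp
  also have "\<dots> = fps_nth (D $ i) k"
    using D unfolding has_fpsv_deriv_def has_fps_deriv_def by (intro DERIV_imp_deriv) blast
  finally show "(variation (\<lambda>v x. F k v x $ i) v w has_real_derivative fps_nth (D $ i) k) (at x)"
    using variation_has_derivative[OF diff_polyv_nth[OF F] s] by metis
qed

lemma dLq_eq: "dLq v w x = fps_X *s dLqt v w x"
proof -
  have "fps_nth (dLq v w x $ i) k = fps_nth (fps_X * dLqt v w x $ i) k" for i k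
    by (cases k) (simp_all add: fps_nth_dsers variation_def del: lax_q.simps(2))
  then show ?thesis by (simp add: vec_eq_iff fps_eq_iff)
qed

context
  fixes v w :: "real \<Rightarrow> real^'n"
  assumes v: "smooth v" and w: "smooth w"
begin

lemmas lax_variations =
  ser_variation[OF diff_poly_lax_p v w] serv_variation[OF diff_polyv_lax_q v w]
  serv_variation[OF diff_polyv_lax_r v w] serm_variation[OF diff_polym_lax_U v w] cvec_variation

lemma dLq_deriv: "has_fpsv_deriv (dLq v w) (dLr v w x - dLp v w x *s cvec (v x) - Lp v x *s cvec (w x)) x"
proof (rule dserv_deriv[OF diff_polyv_lax_q v w Lq_deriv])
  show "has_fpsv_deriv (\<lambda>e. Lr (\<lambda>y. v y + e *\<^sub>R w y) x - Lp (\<lambda>y. v y + e *\<^sub>R w y) x *s cvec (v x + e *\<^sub>R w x))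
     (dLr v w x - dLp v w x *s cvec (v x) - Lp v x *s cvec (w x)) 0"
    by (rule has_fpsv_deriv_eq, (rule fps_deriv_rules lax_variations)+) (simp add: algebra_simps)
qed

lemma dLr_deriv: "has_fpsv_deriv (dLr v w) (dLqt v w x - cvec (w x) v* LU v x - cvec (v x) v* dLU v w x) x"
proof (rule dserv_deriv[OF diff_polyv_lax_r v w Lr_deriv])
  show "has_fpsv_deriv (\<lambda>e. Lqt (\<lambda>y. v y + e *\<^sub>R w y) x - cvec (v x + e *\<^sub>R w x) v* LU (\<lambda>y. v y + e *\<^sub>R w y) x)
     (dLqt v w x - cvec (w x) v* LU v x - cvec (v x) v* dLU v w x) 0"
    by (rule has_fpsv_deriv_eq, (rule fps_deriv_rules lax_variations serv_variation[OF diff_polyv_lax_q v w])+)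
       (simp add: algebra_simps)
qed

lemma norm_variation:
  "2 * Lp v x * dLp v w x + 2 * vdot (Lq v x) (dLq v w x)
    - fps_X * (2 * vdot (Lr v x) (dLr v w x) + mdot (LU v x) (dLU v w x)) = 0"
proof -
  have "has_fps_deriv (\<lambda>e. 2 * Lp (\<lambda>y. v y + e *\<^sub>R w y) x * Lp (\<lambda>y. v y + e *\<^sub>R w y) x
    + 2 * vdot (Lq (\<lambda>y. v y + e *\<^sub>R w y) x) (Lq (\<lambda>y. v y + e *\<^sub>R w y) x)
    - fps_X * (2 * vdot (Lr (\<lambda>y. v y + e *\<^sub>R w y) x) (Lr (\<lambda>y. v y + e *\<^sub>R w y) x)
       + mdot (LU (\<lambda>y. v y + e *\<^sub>R w y) x) (LU (\<lambda>y. v y + e *\<^sub>R w y) x)))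
    (2 * (2 * Lp v x * dLp v w x + 2 * vdot (Lq v x) (dLq v w x)
    - fps_X * (2 * vdot (Lr v x) (dLr v w x) + mdot (LU v x) (dLU v w x)))) 0"
    (is "has_fps_deriv _ ?D 0")
  proof -
    \<comment> \<open>\<open>?E\<close> is the literal output of the differentiation rules: the base
      point appears as v + 0 w, and the zero summands come from constant factors.\<close>
    have "has_fps_deriv (\<lambda>e. 2 * Lp (\<lambda>y. v y + e *\<^sub>R w y) x * Lp (\<lambda>y. v y + e *\<^sub>R w y) x
    + 2 * vdot (Lq (\<lambda>y. v y + e *\<^sub>R w y) x) (Lq (\<lambda>y. v y + e *\<^sub>R w y) x)
    - fps_X * (2 * vdot (Lr (\<lambda>y. v y + e *\<^sub>R w y) x) (Lr (\<lambda>y. v y + e *\<^sub>R w y) x)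
       + mdot (LU (\<lambda>y. v y + e *\<^sub>R w y) x) (LU (\<lambda>y. v y + e *\<^sub>R w y) x)))
     ((0 * Lp (\<lambda>y. v y + 0 *\<^sub>R w y) x + 2 * dLp v w x) * Lp (\<lambda>y. v y + 0 *\<^sub>R w y) x
        + 2 * Lp (\<lambda>y. v y + 0 *\<^sub>R w y) x * dLp v w x
       + (0 * vdot (Lq (\<lambda>y. v y + 0 *\<^sub>R w y) x) (Lq (\<lambda>y. v y + 0 *\<^sub>R w y) x)
          + 2 * (vdot (dLq v w x) (Lq (\<lambda>y. v y + 0 *\<^sub>R w y) x) + vdot (Lq (\<lambda>y. v y + 0 *\<^sub>R w y) x) (dLq v w x)))
       - (0 * (2 * vdot (Lr (\<lambda>y. v y + 0 *\<^sub>R w y) x) (Lr (\<lambda>y. v y + 0 *\<^sub>R w y) x)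
             + mdot (LU (\<lambda>y. v y + 0 *\<^sub>R w y) x) (LU (\<lambda>y. v y + 0 *\<^sub>R w y) x))
          + fps_X * (0 * vdot (Lr (\<lambda>y. v y + 0 *\<^sub>R w y) x) (Lr (\<lambda>y. v y + 0 *\<^sub>R w y) x)
            + 2 * (vdot (dLr v w x) (Lr (\<lambda>y. v y + 0 *\<^sub>R w y) x) + vdot (Lr (\<lambda>y. v y + 0 *\<^sub>R w y) x) (dLr v w x))
            + (mdot (dLU v w x) (LU (\<lambda>y. v y + 0 *\<^sub>R w y) x) + mdot (LU (\<lambda>y. v y + 0 *\<^sub>R w y) x) (dLU v w x))))) 0"
      (is "has_fps_deriv _ ?E 0")
      by (rule fps_deriv_rules lax_variations)+
    moreover have "?E = ?D"
      unfolding vdot_commute[of "dLq v w x" "Lq v x"] vdot_commute[of "dLr v w x" "Lr v x"]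
        mdot_commute[of "dLU v w x" "LU v x"] scaleR_zero_left add_0_right
      by (simp only: algebra_simps mult_zero_left add_0_left mult_2 mult_2_right add_0_right)
    ultimately show ?thesis by (simp only:)
  qed
  from has_fps_deriv_unique[OF this[unfolded lax_norm] has_fps_deriv_const]
  show ?thesis by (rule fps_double_eq_0)
qed

lemma plucker_variation:
  "mscale (dLp v w x) (LU v x) + mscale (Lp v x) (dLU v w x) = vwedge (dLr v w x) (Lq v x) + vwedge (Lr v x) (dLq v w x)"
proof -
  have 1: "has_fpsm_deriv (\<lambda>e. mscale (Lp (\<lambda>y. v y + e *\<^sub>R w y) x) (LU (\<lambda>y. v y + e *\<^sub>R w y) x))
     (mscale (dLp v w x) (LU (\<lambda>y. v y + 0 *\<^sub>R w y) x) + mscale (Lp (\<lambda>y. v y + 0 *\<^sub>R w y) x) (dLU v w x)) 0"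
    by (rule fps_deriv_rules lax_variations)+
  have 2: "has_fpsm_deriv (\<lambda>e. vwedge (Lr (\<lambda>y. v y + e *\<^sub>R w y) x) (Lq (\<lambda>y. v y + e *\<^sub>R w y) x))
     (vwedge (dLr v w x) (Lq (\<lambda>y. v y + 0 *\<^sub>R w y) x) + vwedge (Lr (\<lambda>y. v y + 0 *\<^sub>R w y) x) (dLq v w x)) 0"
    by (rule fps_deriv_rules lax_variations)+
  show ?thesis using has_fpsm_deriv_unique[OF 1[unfolded lax_plucker] 2] by simp
qed

text \<open>
  Here \<open>V = (P, Q, R, T)\<close>. The factor \<open>m\<close> serves to clear the pole of \<open>V\<close> at \<open>X = 0\<close>, and
  \<open>Qt\<close> replaces the quotient \<open>Q / X\<close>.
\<close>

lemma variation_eq_bracket: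
  fixes Q Qt R :: "real \<Rightarrow> real fps^'n"
  assumes dP: "\<And>y. has_fps_deriv P (vdot (cvec (v y)) (Q y)) y"
    and dQ: "\<And>y. has_fpsv_deriv Q (R y - P y *s cvec (v y)) y"
    and dR: "\<And>y. has_fpsv_deriv R (Qt y - cvec (v y) v* T y + m *s cvec (w y)) y"
    and dT: "\<And>y. has_fpsm_deriv T (vwedge (cvec (v y)) (R y)) y"
    and dQt: "\<And>y. \<exists>d. has_fpsv_deriv Qt d y \<and> fps_X *s d = R y - P y *s cvec (v y)"
    and Q: "\<And>y. Q y = fps_X *s Qt y" and T: "\<And>y. skew (T y)"
  shows "m * dLp v w x = vdot (R x) (Lq v x) - vdot (Q x) (Lr v x)"
    and "m *s dLq v w x = P x *s Lr v x - Lp v x *s R x - Q x v* LU v x + Lq v x v* T x"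
    and "m *s dLr v w x = P x *s Lqt v x - Lp v x *s Qt x - R x v* LU v x + Lr v x v* T x"
proof -
  define bp where "bp = (\<lambda>y. vdot (R y) (Lq v y) - vdot (Q y) (Lr v y))"
  define bq where "bq = (\<lambda>y. P y *s Lr v y - Lp v y *s R y - Q y v* LU v y + Lq v y v* T y)"
  define br where "br = (\<lambda>y. P y *s Lqt v y - Lp v y *s Qt y - R y v* LU v y + Lr v y v* T y)"
  define bU where "bU = (\<lambda>y. vwedge (R y) (Lr v y) - vwedge (Qt y) (Lq v y) + (LU v y ** T y - T y ** LU v y))"
  \<comment> \<open>The bracket satisfies the same linearised system as m times the variation:
    \<open>1\<close> and \<open>2\<close> are the differential equations, with the forcing w scaled
    by m, and \<open>3\<close> and \<open>4\<close> the two linearised constraints.\<close>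
  have 1: "has_fpsv_deriv bq (br y - bp y *s cvec (v y) - Lp v y *s (m *s cvec (w y))) y" for y
    unfolding bq_def br_def bp_def
    by (rule bracket_deriv_normal[OF dP dQ dR dT Lp_LU_deriv(1)[OF v] Lq_deriv[OF v] Lr_deriv[OF v] Lp_LU_deriv(2)[OF v]])
  have 2: "\<exists>d. has_fpsv_deriv br d y \<and>
      bq y = fps_X *s (d + (m *s cvec (w y)) v* LU v y + cvec (v y) v* bU y)" for y
  proof -
    obtain d where d: "has_fpsv_deriv Qt d y" "fps_X *s d = R y - P y *s cvec (v y)" using dQt by blast
    obtain d' where d': "has_fpsv_deriv (Lqt v) d' y" "fps_X *s d' = Lr v y - Lp v y *s cvec (v y)"
      by (rule Lqt_deriv[OF v])
    show ?thesis
      unfolding bq_def br_def bU_def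
      by (rule bracket_deriv_tangential[OF dP dQ dR dT d Q Lp_LU_deriv(1)[OF v] Lq_deriv[OF v]
          Lr_deriv[OF v] Lp_LU_deriv(2)[OF v] d' Lq_eq])
  qed
  have 3: "2 * Lp v y * bp y + 2 * vdot (Lq v y) (bq y)
      - fps_X * (2 * vdot (Lr v y) (br y) + mdot (LU v y) (bU y)) = 0" for y
    unfolding bp_def bq_def br_def bU_def by (rule bracket_norm[OF T LU_skew Q Lq_eq fps_two_neq_0])
  have 4: "mscale (bp y) (LU v y) + mscale (Lp v y) (bU y) = vwedge (br y) (Lq v y) + vwedge (Lr v y) (bq y)" for y
    unfolding bp_def bq_def br_def bU_def by (rule bracket_plucker[OF Lp_nonzero lax_plucker T Q Lq_eq])
  \<comment> \<open>In the difference of m times the variation and the bracket the forcing terms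
    cancel, which leaves the homogeneous system.\<close>
  note z = linearised_unique[where p = "Lp v" and q = "Lq v" and qt = "Lqt v" and r = "Lr v" and U = "LU v"
      and v = "\<lambda>y. cvec (v y)" and P = "\<lambda>y. m * dLp v w y - bp y" and Q = "\<lambda>y. m *s dLq v w y - bq y"
      and R = "\<lambda>y. m *s dLr v w y - br y" and T = "\<lambda>y. mscale m (dLU v w y) - bU y", OF Lp_nth_0 Lq_eq]
  have A: "has_fpsv_deriv (\<lambda>y. m *s dLq v w y - bq y)
      (m *s dLr v w y - br y - (m * dLp v w y - bp y) *s cvec (v y)) y" for y
    by (rule has_fpsv_deriv_eq, (rule fps_deriv_rules dLq_deriv 1)+) (simp add: vec_eq_iff algebra_simps)
  have B: "\<exists>d. has_fpsv_deriv (\<lambda>y. m *s dLr v w y - br y) d y \<and>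
      m *s dLq v w y - bq y = fps_X *s (d + cvec (v y) v* (mscale m (dLU v w y) - bU y))" for y
  proof -
    obtain d where d: "has_fpsv_deriv br d y"
      "bq y = fps_X *s (d + (m *s cvec (w y)) v* LU v y + cvec (v y) v* bU y)" using 2 by blast
    have "has_fpsv_deriv (\<lambda>y. m *s dLr v w y - br y)
       (0 *s dLr v w y + m *s (dLqt v w y - cvec (w y) v* LU v y - cvec (v y) v* dLU v w y) - d) y"
      by (rule fps_deriv_rules dLr_deriv d(1))+
    moreover have "m *s dLq v w y - bq y = fps_X *s ((0 *s dLr v w y
        + m *s (dLqt v w y - cvec (w y) v* LU v y - cvec (v y) v* dLU v w y) - d)
        + cvec (v y) v* (mscale m (dLU v w y) - bU y))"
      unfolding d(2) dLq_eq by (simp add: vec_eq_iff row_simps algebra_simps)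
    ultimately show ?thesis by blast
  qed
  have C: "2 * Lp v y * (m * dLp v w y - bp y) + 2 * vdot (Lq v y) (m *s dLq v w y - bq y)
      - fps_X * (2 * vdot (Lr v y) (m *s dLr v w y - br y) + mdot (LU v y) (mscale m (dLU v w y) - bU y)) = 0" for y
  proof -
    have "2 * Lp v y * (m * dLp v w y - bp y) + 2 * vdot (Lq v y) (m *s dLq v w y - bq y)
      - fps_X * (2 * vdot (Lr v y) (m *s dLr v w y - br y) + mdot (LU v y) (mscale m (dLU v w y) - bU y))
     = m * (2 * Lp v y * dLp v w y + 2 * vdot (Lq v y) (dLq v w y)
        - fps_X * (2 * vdot (Lr v y) (dLr v w y) + mdot (LU v y) (dLU v w y)))
      - (2 * Lp v y * bp y + 2 * vdot (Lq v y) (bq y)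
      - fps_X * (2 * vdot (Lr v y) (br y) + mdot (LU v y) (bU y)))"
      by (simp add: vdot_simps mdot_diff_right mdot_mscale_right algebra_simps)
    then show ?thesis unfolding norm_variation 3 by simp
  qed
  have D: "mscale (m * dLp v w y - bp y) (LU v y) + mscale (Lp v y) (mscale m (dLU v w y) - bU y)
     = vwedge (m *s dLr v w y - br y) (Lq v y) + vwedge (Lr v y) (m *s dLq v w y - bq y)" for y
  proof -
    have "mscale (m * dLp v w y - bp y) (LU v y) + mscale (Lp v y) (mscale m (dLU v w y) - bU y)
     = mscale m (mscale (dLp v w y) (LU v y) + mscale (Lp v y) (dLU v w y))
       - (mscale (bp y) (LU v y) + mscale (Lp v y) (bU y))"
      by (simp add: mscale_def vec_eq_iff algebra_simps)
    also have "\<dots> = vwedge (m *s dLr v w y - br y) (Lq v y) + vwedge (Lr v y) (m *s dLq v w y - bq y)"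
      unfolding plucker_variation 4 by (simp add: vwedge_simps mscale_simps)
    finally show ?thesis .
  qed
  note Z = z[OF A B C D, of x]
  show "m * dLp v w x = vdot (R x) (Lq v x) - vdot (Q x) (Lr v x)"
    using Z(1) by (simp add: bp_def)
  show "m *s dLq v w x = P x *s Lr v x - Lp v x *s R x - Q x v* LU v x + Lq v x v* T x"
    using Z(2) by (simp add: bq_def)
  show "m *s dLr v w x = P x *s Lqt v x - Lp v x *s Qt x - R x v* LU v x + Lr v x v* T x"
    using Z(3) by (simp add: br_def)
qed

end

subsection \<open>The hierarchy\<close>

lemma vdot_cvec: "fps_nth (vdot (cvec a) b) k = (\<Sum>i\<in>UNIV. a $ i * fps_nth (b $ i) k)"
  by (simp add: vdot_def fps_sum_nth cvec_def)

lemma lax_p_deriv: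
  assumes "smooth v" shows "(lax_p k v has_real_derivative v x \<bullet> lax_q k v x) (at x)"
  using Lp_LU_deriv(1)[OF assms, of x]
  unfolding has_fps_deriv_def fps_nth_ser vdot_cvec fps_nth_serv by (simp add: inner_vec_def)

lemma lax_q_deriv:
  fixes v :: "real \<Rightarrow> real^'n"
  assumes "smooth v"
  shows "(lax_q k v has_vector_derivative lax_r k v x - lax_p k v x *\<^sub>R v x) (at x)"
  using Lq_deriv[OF assms, of x]
  unfolding has_fpsv_deriv_def has_fps_deriv_def has_vector_derivative_vec_iff
  by (simp add: fps_nth_sers cvec_def)

lemma lax_r_deriv:
  fixes v :: "real \<Rightarrow> real^'n"
  assumes "smooth v"
  shows "(lax_r k v has_vector_derivative lax_q (Suc k) v x - v x v* lax_U k v x) (at x)"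
  using diff_polyv_has_derivative(1)[OF diff_polyv_lax_r assms, of k x] by simp

lemma lax_U_deriv:
  fixes v :: "real \<Rightarrow> real^'n"
  assumes "smooth v"
  shows "(lax_U k v has_vector_derivative wedge (v x) (lax_r k v x)) (at x)"
    and "((\<lambda>y. lax_U k v y $ i $ j) has_real_derivative wedge (v x) (lax_r k v x) $ i $ j) (at x)"
proof -
  have "fps_nth (vwedge (cvec (v x)) (Lr v x) $ i $ j) k = wedge (v x) (lax_r k v x) $ i $ j" for i j
    by (simp add: vwedge_def wedge_component cvec_def fps_nth_sers mult.commute)
  then have e: "((\<lambda>y. lax_U k v y $ i $ j) has_real_derivative wedge (v x) (lax_r k v x) $ i $ j) (at x)" for i j
    using Lp_LU_deriv(2)[OF assms, of x]
    unfolding has_fpsm_deriv_def has_fpsv_deriv_def has_fps_deriv_def fps_nth_serm by metis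
  then have "((\<lambda>y. lax_U k v y $ i $ j) has_derivative (\<lambda>h. h * wedge (v x) (lax_r k v x) $ i $ j)) (at x)" for i j
    by (simp add: has_field_derivative_def mult_commute_abs)
  then show "(lax_U k v has_vector_derivative wedge (v x) (lax_r k v x)) (at x)"
    unfolding has_vector_derivative_def
    by (subst has_derivative_componentwise_within) (auto simp: Basis_vec_def inner_axis)
  show "((\<lambda>y. lax_U k v y $ i $ j) has_real_derivative wedge (v x) (lax_r k v x) $ i $ j) (at x)" by (rule e)
qed

text \<open>This provides the vanishing constant terms that \<open>formal_primitive\<close> demands.
  The coefficient p of index 0 is left out, being 1.\<close>

lemma lax_zero:
  "lax_p (Suc k) (\<lambda>_. 0 :: real^'n) = (\<lambda>_. 0)" "lax_q k (\<lambda>_. 0 :: real^'n) = (\<lambda>_. 0)"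
  "lax_r k (\<lambda>_. 0 :: real^'n) = (\<lambda>_. 0)" "lax_U k (\<lambda>_. 0 :: real^'n) = (\<lambda>_. 0)"
proof -
  have "lax_p (Suc k) (\<lambda>_. 0 :: real^'n) = (\<lambda>_. 0) \<and> lax_q k (\<lambda>_. 0 :: real^'n) = (\<lambda>_. 0) \<and>
    lax_r k (\<lambda>_. 0 :: real^'n) = (\<lambda>_. 0) \<and> lax_U k (\<lambda>_. 0 :: real^'n) = (\<lambda>_. 0)"
  proof (induction k rule: less_induct)
    case (less k)
    have q: "lax_q k (\<lambda>_. 0 :: real^'n) = (\<lambda>_. 0)"
    proof (cases k)
      case (Suc j)
      then show ?thesis using less.IH[of j] by (simp add: dx_const del: lax_p.simps)
    qed simp
    have r: "lax_r k (\<lambda>_. 0 :: real^'n) = (\<lambda>_. 0)"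
      using q by (cases k) (auto simp: dx_const simp del: lax_q.simps(2) lax_p.simps(2))
    have qa: "lax_q a (\<lambda>_. 0 :: real^'n) = (\<lambda>_. 0)" and ra: "lax_r a (\<lambda>_. 0 :: real^'n) = (\<lambda>_. 0)" if "a \<le> k" for a
      using that q r less.IH[of a] by (auto simp: le_less)
    have pa: "lax_p a (\<lambda>_. 0 :: real^'n) = (\<lambda>_. 0)" if "1 \<le> a" "a \<le> k" for a
      using less.IH[of "a - 1"] that by (cases a) (auto simp del: lax_p.simps(2))
    have w: "wedge 0 b = (0 :: real^'n^'n)" for b by (simp add: vec_eq_iff wedge_component)
    have U: "lax_U k (\<lambda>_. 0 :: real^'n) = (\<lambda>_. 0)"
    proof (cases k)
      case (Suc j)
      have "(\<Sum>a = 1..Suc j. lax_p a (\<lambda>_. 0 :: real^'n) x *\<^sub>R lax_U (Suc j - a) (\<lambda>_. 0 :: real^'n) x) = 0" for x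
        using pa Suc by (intro sum.neutral) auto
      moreover have "(\<Sum>a = 0..j. wedge (lax_r a (\<lambda>_. 0 :: real^'n) x) (lax_q (Suc j - a) (\<lambda>_. 0 :: real^'n) x)) = 0" for x
        using ra Suc by (intro sum.neutral) (auto simp: w)
      ultimately show ?thesis unfolding Suc lax_U.simps by (simp only: diff_self fun_eq_iff)  simp
    qed simp
    have Ua: "lax_U a (\<lambda>_. 0 :: real^'n) = (\<lambda>_. 0)" if "a \<le> k" for a
      using that U less.IH[of a] by (auto simp: le_less)
    have "lax_p (Suc k) (\<lambda>_. 0 :: real^'n) x = 0" for x
      unfolding lax_p.simps using pa qa ra Ua by simp
    then show ?case using q r U by blast
  qed
  then show "lax_p (Suc k) (\<lambda>_. 0 :: real^'n) = (\<lambda>_. 0)" "lax_q k (\<lambda>_. 0 :: real^'n) = (\<lambda>_. 0)"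
  "lax_r k (\<lambda>_. 0 :: real^'n) = (\<lambda>_. 0)" "lax_U k (\<lambda>_. 0 :: real^'n) = (\<lambda>_. 0)" by auto
qed

section \<open>From the coefficients of the solution to the recursion operator\<close>

lemma diff_poly_vec_vec: "diff_polyv F \<Longrightarrow> diff_poly_vec F"
  unfolding diff_poly_vec_def diff_polyv_def by (auto simp: Basis_vec_def inner_axis)

lemma diff_poly_vec_mat: "diff_polym F \<Longrightarrow> diff_poly_vec F"
  unfolding diff_poly_vec_def diff_polym_def diff_polyv_def by (auto simp: Basis_vec_def inner_axis)

lemma diff_poly_vec_real: "diff_poly F \<Longrightarrow> diff_poly_vec F"
  unfolding diff_poly_vec_def by simp

lemma diff_poly_vec_cong:
  "diff_poly_vec F \<Longrightarrow> (\<And>v x. smooth v \<Longrightarrow> F v x = G v x) \<Longrightarrow> diff_poly_vec G"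
  unfolding diff_poly_vec_def by (metis (mono_tags, lifting) diff_poly.cong)

text \<open>Restricted to positive indices: \<open>lax_p 0\<close> = 1 has a constant term.\<close>

lemma lax_p_primitive: "formal_primitive (\<lambda>v x. v x \<bullet> lax_q (Suc k) v x) (lax_p (Suc k))"
  unfolding formal_primitive_def lax_zero
  using lax_p_deriv diff_poly_vec_real[OF diff_poly_lax_p]
  by (auto simp: has_real_derivative_iff_has_vector_derivative simp del: lax_q.simps lax_p.simps)

lemma lax_U_primitive: "formal_primitive (\<lambda>v x. wedge (v x) (lax_r k v x)) (lax_U k)"
  unfolding formal_primitive_def lax_zero
  using lax_U_deriv(1) diff_poly_vec_mat[OF diff_polym_lax_U] by auto

lemma formal_primitive_cong:
  "formal_primitive F G \<Longrightarrow> (\<And>v. smooth v \<Longrightarrow> F v = F' v) \<Longrightarrow> formal_primitive F' G"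
  unfolding formal_primitive_def by auto

lemma opJ_lax:
  assumes "\<And>v. smooth v \<Longrightarrow> P v = lax_q (Suc k) v" and "smooth v"
  shows "opJ P v = lax_r (Suc k) v" "formal_primitive (\<lambda>v x. v x \<bullet> P v x) (lax_p (Suc k))"
proof -
  show p: "formal_primitive (\<lambda>v x. v x \<bullet> P v x) (lax_p (Suc k))"
    by (rule formal_primitive_cong[OF lax_p_primitive]) (simp add: assms(1))
  show "opJ P v = lax_r (Suc k) v"
    unfolding opJ_def J_with_def[abs_def] dinv_eq[OF p assms(2)] assms(1)[OF assms(2)] lax_r.simps ..
qed

text \<open>J takes the coefficient q of index k + 1 to r of the same index, and H takes that to q
  of index k + 2, so \<open>opR\<close> raises the index by one. The primitives met on the way are p
  and U of index k + 1, which also shows that both formal inverses exist.\<close>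

lemma opR_lax:
  assumes "\<And>v. smooth v \<Longrightarrow> P v = lax_q (Suc k) v"
  shows "\<And>v. smooth v \<Longrightarrow> opR P v = lax_q (Suc (Suc k)) v" and "opR_defined P"
proof -
  have U: "formal_primitive (\<lambda>v x. wedge (v x) (opJ P v x)) (lax_U (Suc k))"
    by (rule formal_primitive_cong[OF lax_U_primitive]) (simp add: opJ_lax(1)[OF assms])
  show "opR P v = lax_q (Suc (Suc k)) v" if "smooth v" for v
  proof -
    have "opJ P v = lax_r (Suc k) v" by (rule opJ_lax(1)[OF assms that])
    then show ?thesis
      unfolding opR_def o_def opH_def dinv_eq[OF U that] lax_q.simps by (simp only:)
  qed
  show "opR_defined P"
    unfolding opR_defined_def using U opJ_lax(2)[OF assms smooth_const] by blast
qed

lemma lax_q_1: "lax_q (Suc 0) v = dx v"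
  by (simp add: fun_eq_iff)

lemma hierarchy_eq_lax_q: "smooth v \<Longrightarrow> hierarchy k v = lax_q (Suc k) v"
proof (induction k arbitrary: v)
  case 0
  then show ?case by (simp add: hierarchy_def lax_q_1 del: lax_q.simps)
next
  case (Suc k)
  show ?case using opR_lax(1)[OF Suc.IH Suc.prems] by (simp add: hierarchy_def)
qed

lemma hierarchy_opR_defined: "opR_defined (hierarchy k)"
  by (rule opR_lax(2)[OF hierarchy_eq_lax_q])

lemma hierarchy_diff_poly: "diff_poly_vec (hierarchy k)"
  by (rule diff_poly_vec_cong[OF diff_poly_vec_vec[OF diff_polyv_lax_q[of "Suc k"]]])
    (simp add: hierarchy_eq_lax_q del: lax_q.simps)

lemma hierarchy_d_opR: "(d_opR ^^ k) (dx, dx) = (hierarchy k, hierarchy k)"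
  by (induction k) (simp_all add: hierarchy_def d_opR_def)

lemma row_wedge_real: "a v* wedge b c = (a \<bullet> b) *\<^sub>R c - (a \<bullet> c) *\<^sub>R (b :: real^'n)"
  using row_wedge[of a b c]
  by (simp add: vwedge_def vdot_def wedge_def outer_def inner_vec_def vec_eq_iff vector_matrix_mult_def
      sum_subtractf algebra_simps)

lemma inner_row_lax_U: "a \<bullet> (b v* lax_U k v x) = - (b \<bullet> (a v* lax_U k v x))"
proof -
  have "lax_U k v x $ i $ j = - lax_U k v x $ j $ i" for i j
    using LU_skew[of v x] unfolding skew_def by (metis fps_nth_serm fps_neg_nth)
  then have "skew (lax_U k v x)" unfolding skew_def by blast
  from vdot_row_skew[OF this, of b a] show ?thesis
    by (simp add: vdot_def inner_vec_def mult.commute)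
qed

lemma has_vector_derivative_row:
  fixes f :: "real \<Rightarrow> real^'n" and U :: "real \<Rightarrow> real^'n^'n"
  assumes "(f has_vector_derivative f') (at x)"
    "\<And>i j. ((\<lambda>y. U y $ i $ j) has_real_derivative U' $ i $ j) (at x)"
  shows "((\<lambda>y. f y v* U y) has_vector_derivative f' v* U x + f x v* U') (at x)"
proof -
  have "((\<lambda>y. \<Sum>i\<in>UNIV. U y $ i $ j * f y $ i) has_real_derivative
     (\<Sum>i\<in>UNIV. U x $ i $ j * f' $ i + U' $ i $ j * f x $ i)) (at x)" for j
    using assms unfolding has_vector_derivative_vec_iff
    by (intro DERIV_sum DERIV_mult') blast+
  then show ?thesis
    unfolding has_vector_derivative_vec_iff by (simp add: vector_matrix_mult_def sum.distrib mult.commute)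
qed

subsection \<open>Smoothness of algebraic expressions\<close>

text \<open>If the derivatives of the generators lie in the algebra, so do all higher derivatives of
  its elements. This yields smoothness without Leibniz or chain rule formulas of higher
  order.\<close>

inductive_set algebra_generated :: "(real \<Rightarrow> real) set \<Rightarrow> (real \<Rightarrow> real) set" for S where
  base: "f \<in> S \<Longrightarrow> f \<in> algebra_generated S"
| const: "(\<lambda>_. c) \<in> algebra_generated S"
| add: "f \<in> algebra_generated S \<Longrightarrow> g \<in> algebra_generated S \<Longrightarrow> (\<lambda>x. f x + g x) \<in> algebra_generated S"
| mult: "f \<in> algebra_generated S \<Longrightarrow> g \<in> algebra_generated S \<Longrightarrow> (\<lambda>x. f x * g x) \<in> algebra_generated S"

lemma smooth_algebra_generated:
  assumes S: "\<And>f. f \<in> S \<Longrightarrow> \<exists>f'\<in>algebra_generated S. \<forall>x. (f has_real_derivative f' x) (at x)"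
    and "f \<in> algebra_generated S"
  shows "smooth f"
proof (rule smooth_coinduct[OF assms(2)])
  fix g assume "g \<in> algebra_generated S"
  then have "\<exists>g'\<in>algebra_generated S. \<forall>x. (g has_real_derivative g' x) (at x)"
  proof induction
    case (base f)
    then show ?case by (rule S)
  next
    case (const c)
    show ?case by (rule bexI[of _ "\<lambda>_. 0"]) (auto intro: algebra_generated.const)
  next
    case (add f g)
    then obtain f' g' where d: "f' \<in> algebra_generated S" "g' \<in> algebra_generated S"
      "\<And>x. (f has_real_derivative f' x) (at x)" "\<And>x. (g has_real_derivative g' x) (at x)" by blast
    show ?case
      by (rule bexI[of _ "\<lambda>x. f' x + g' x"]) (auto intro!: DERIV_add d algebra_generated.add)
  next
    case (mult f g)
    then obtain f' g' where d: "f' \<in> algebra_generated S" "g' \<in> algebra_generated S"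
      "\<And>x. (f has_real_derivative f' x) (at x)" "\<And>x. (g has_real_derivative g' x) (at x)" by blast
    show ?case
      by (rule bexI[of _ "\<lambda>x. f x * g' x + f' x * g x"])
        (auto intro!: DERIV_mult' d algebra_generated.add algebra_generated.mult mult.hyps)
  qed
  then obtain g' where g': "g' \<in> algebra_generated S" "\<And>x. (g has_real_derivative g' x) (at x)" by blast
  have "dx g = g'" using dx_real_eqI[OF g'(2)] by blast
  then show "(\<forall>x. g differentiable (at x)) \<and> dx g \<in> algebra_generated S"
    using g' by (metis field_differentiable_def field_differentiable_imp_differentiable)
qed

lemma smooth_real_derivative:
  "smooth f \<Longrightarrow> (f has_real_derivative dx f x) (at x)"
  using smooth_has_derivative' by (auto simp: has_real_derivative_iff_has_vector_derivative)

lemma smooth_base: "f \<in> {f. smooth f} \<Longrightarrow> \<exists>f'\<in>algebra_generated {f. smooth f}. \<forall>x. (f has_real_derivative f' x) (at x)"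
  by (rule bexI[of _ "dx f"]) (auto intro: smooth_real_derivative algebra_generated.base smooth_dx)

lemma smooth_mult: "smooth f \<Longrightarrow> smooth g \<Longrightarrow> smooth (\<lambda>x. f x * g x :: real)"
  by (rule smooth_algebra_generated[OF smooth_base])
    (auto intro: algebra_generated.mult algebra_generated.base)

lemma smooth_add: "smooth f \<Longrightarrow> smooth g \<Longrightarrow> smooth (\<lambda>x. f x + g x :: real)"
  by (rule smooth_algebra_generated[OF smooth_base])
    (auto intro: algebra_generated.add algebra_generated.base)

lemma smooth_uminus: "smooth f \<Longrightarrow> smooth (\<lambda>x. - f x :: real)"
  using smooth_mult[OF smooth_const[of "-1"], of f] by simp

lemma smooth_sum: "(\<And>i. i \<in> I \<Longrightarrow> smooth (f i)) \<Longrightarrow> smooth (\<lambda>x. \<Sum>i\<in>I. f i x :: real)"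
proof (induction I rule: infinite_finite_induct)
  case (insert i I)
  then show ?case using smooth_add[of "f i" "\<lambda>x. \<Sum>i\<in>I. f i x"] by simp
qed (simp_all add: smooth_const)

lemma smooth_vec_iff:
  fixes v :: "real \<Rightarrow> real^'n"
  shows "smooth v \<longleftrightarrow> (\<forall>i. smooth (\<lambda>x. v x $ i))"
proof
  assume "smooth v"
  then show "\<forall>i. smooth (\<lambda>x. v x $ i)"
    using smooth_diff_poly[OF diff_poly_component] by blast
next
  assume c: "\<forall>i. smooth (\<lambda>x. v x $ i)"
  show "smooth v"
  proof (rule smooth_coinduct[where S = "{v. \<forall>i. smooth (\<lambda>x. v x $ i)}"])
    fix g :: "real \<Rightarrow> real^'n" assume "g \<in> {v. \<forall>i. smooth (\<lambda>x. v x $ i)}"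
    then have g: "smooth (\<lambda>x. g x $ i)" for i by blast
    have d: "(g has_vector_derivative (\<chi> i. dx (\<lambda>x. g x $ i) x)) (at x)" for x
      unfolding has_vector_derivative_vec_iff using smooth_real_derivative[OF g] by simp
    have "dx g = (\<lambda>x. \<chi> i. dx (\<lambda>x. g x $ i) x)" by (rule ext, rule dx_eqI, rule d)
    then have "smooth (\<lambda>x. dx g x $ i)" for i using smooth_dx[OF g[of i]] by simp
    then show "(\<forall>x. g differentiable (at x)) \<and> dx g \<in> {v. \<forall>i. smooth (\<lambda>x. v x $ i)}"
      using differentiableI_vector[OF d] by blast
  qed (use c in blast)
qed

lemma smooth_inner: "smooth f \<Longrightarrow> smooth g \<Longrightarrow> smooth (\<lambda>x. f x \<bullet> (g x :: real^'n))"
  unfolding smooth_vec_iff inner_vec_def by (auto intro!: smooth_sum smooth_mult)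

lemma smooth_diff_polyv: "diff_polyv F \<Longrightarrow> smooth v \<Longrightarrow> smooth (F v)"
  unfolding diff_polyv_def smooth_vec_iff[of "F v"] using smooth_diff_poly by blast

subsection \<open>Commutation with the \<open>-1\<close> flow\<close>

lemma gateaux_hierarchy:
  assumes "smooth v" "smooth w"
  shows "gateaux (hierarchy k) v w x $ i = variation (\<lambda>v x. lax_q (Suc k) v x $ i) v w x"
proof -
  have "((\<lambda>e. lax_q (Suc k) (\<lambda>y. v y + e *\<^sub>R w y) x) has_vector_derivative
      (\<chi> i. variation (\<lambda>v x. lax_q (Suc k) v x $ i) v w x)) (at 0)"
    unfolding has_vector_derivative_vec_iff
    using diff_poly_has_variation[OF diff_polyv_nth[OF diff_polyv_lax_q[of "Suc k"]] assms]
    by (simp del: lax_q.simps)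
  then have "gateaux (hierarchy k) v w x = (\<chi> i. variation (\<lambda>v x. lax_q (Suc k) v x $ i) v w x)"
    unfolding gateaux_def hierarchy_eq_lax_q[OF smooth_comb[OF assms]] by (rule vector_derivative_at)
  then show ?thesis by (simp only: vec_lambda_beta)
qed

lemma cvec_deriv:
  "(f has_vector_derivative f') (at x) \<Longrightarrow> has_fpsv_deriv (\<lambda>y. cvec (f y)) (cvec f') x"
  unfolding has_vector_derivative_vec_iff has_fpsv_deriv_def has_fps_deriv_def fps_nth_cvec
  by auto

lemma fps_const_deriv:
  "(f has_real_derivative f') (at x) \<Longrightarrow> has_fps_deriv (\<lambda>y. fps_const (f y)) (fps_const f') x"
  unfolding has_fps_deriv_def by auto

lemma vdot_cvec_cvec: "vdot (cvec a) (cvec b) = fps_const (a \<bullet> b)"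
  by (simp add: fps_eq_iff vdot_cvec fps_nth_cvec inner_vec_def)

lemma cvec_simps:
  "cvec (a + b) = cvec a + cvec b" "cvec (a - b) = cvec a - cvec b" "cvec (- a) = - cvec a"
  "cvec (c *\<^sub>R a) = fps_const c *s cvec a"
  by (simp_all add: vec_eq_iff fps_eq_iff fps_nth_cvec)

text \<open>The matrix of the -1 flow is V = (X a, - X e, 0, 0), with m = 1. The equations e' = a v
  and a' = - v \<bullet> e are exactly its zero curvature equation for the flow e, so the variation
  of q along e is a bracket with this V.\<close>

lemma gateaux_hierarchy_neg_flow:
  fixes v e :: "real \<Rightarrow> real^'n"
  assumes v: "smooth v" and e: "smooth e"
    and e': "\<And>x. (e has_vector_derivative a x *\<^sub>R v x) (at x)"
    and a': "\<And>x. (a has_real_derivative - (v x \<bullet> e x)) (at x)"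
  shows "gateaux (hierarchy k) v e x = a x *\<^sub>R lax_r k v x + e x v* lax_U k v x"
proof -
  have A: "has_fps_deriv (\<lambda>y. fps_X * fps_const (a y)) (vdot (cvec (v y)) ((- fps_X) *s cvec (e y))) y" for y
  proof -
    have "has_fps_deriv (\<lambda>y. fps_X * fps_const (a y)) (0 * fps_const (a y) + fps_X * fps_const (- (v y \<bullet> e y))) y"
      by (rule fps_deriv_rules fps_const_deriv a')+
    moreover have "0 * fps_const (a y) + fps_X * fps_const (- (v y \<bullet> e y)) = vdot (cvec (v y)) ((- fps_X) *s cvec (e y))"
      by (simp add: vdot_scale_right vdot_cvec_cvec flip: fps_const_neg)
    ultimately show ?thesis by simp
  qed
  have B: "has_fpsv_deriv (\<lambda>y. (- fps_X) *s cvec (e y)) (0 - (fps_X * fps_const (a y)) *s cvec (v y)) y" for y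
    by (rule has_fpsv_deriv_eq, (rule fps_deriv_rules cvec_deriv e')+) (simp add: cvec_simps vec_eq_iff algebra_simps)
  \<comment> \<open>R vanishes identically, and its equation holds because the forcing e cancels Q /
    X = - e.\<close>
  have C: "has_fpsv_deriv (\<lambda>y. 0) (- cvec (e y) - cvec (v y) v* 0 + 1 *s cvec (e y)) y" for y
    by (simp add: has_fpsv_deriv_const)
  have D: "has_fpsm_deriv (\<lambda>y. 0) (vwedge (cvec (v y)) 0) y" for y
  proof -
    have "vwedge (cvec (v y)) 0 = 0" by (simp add: vwedge_def vec_eq_iff)
    then show ?thesis by (simp add: has_fpsm_deriv_def has_fpsv_deriv_def has_fps_deriv_const)
  qed
  have E: "\<exists>d. has_fpsv_deriv (\<lambda>y. - cvec (e y)) d y \<and> fps_X *s d = 0 - (fps_X * fps_const (a y)) *s cvec (v y)" for y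
  proof (intro exI conjI)
    have "has_fpsv_deriv (\<lambda>y. 0 - cvec (e y)) (0 - cvec (a y *\<^sub>R v y)) y"
      by (rule fps_deriv_rules cvec_deriv e')+
    then show "has_fpsv_deriv (\<lambda>y. - cvec (e y)) (0 - cvec (a y *\<^sub>R v y)) y" by simp
    show "fps_X *s (0 - cvec (a y *\<^sub>R v y)) = 0 - (fps_X * fps_const (a y)) *s cvec (v y)"
      by (simp add: cvec_simps vec_eq_iff algebra_simps)
  qed
  have "1 *s dLq v e x = (fps_X * fps_const (a x)) *s Lr v x - Lp v x *s 0 - ((- fps_X) *s cvec (e x)) v* LU v x
      + Lq v x v* 0"
    by (rule variation_eq_bracket(2)[OF v e A B C D E])
      (simp_all add: vec_eq_iff skew_def)
  then have "dLq v e x = (fps_X * fps_const (a x)) *s Lr v x + fps_X *s (cvec (e x) v* LU v x)"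
    by (simp add: row_simps vec_eq_iff)
  \<comment> \<open>V carries a factor X, so the variation of q at index k + 1 involves r and U at
    index k.\<close>
  then have "fps_nth (dLq v e x $ i) (Suc k) = fps_nth (((fps_X * fps_const (a x)) *s Lr v x
      + fps_X *s (cvec (e x) v* LU v x)) $ i) (Suc k)" for i
    by simp
  moreover have "fps_nth ((cvec (e x) v* LU v x) $ i) k = (e x v* lax_U k v x) $ i" for i
    by (simp add: vector_matrix_mult_def fps_sum_nth cvec_def fps_nth_sers)
  ultimately have "variation (\<lambda>v x. lax_q (Suc k) v x $ i) v e x = a x * lax_r k v x $ i + (e x v* lax_U k v x) $ i" for i
    by (simp add: fps_nth_sers fps_nth_dsers mult.assoc del: lax_q.simps)
  then show ?thesis
    by (simp add: vec_eq_iff gateaux_hierarchy[OF v e])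
qed

text \<open>The variation f of e is prescribed, and it remains to find a matching variation g of a.
  The Lax equation then shows that (f, g) solves the linearised constraints.\<close>

lemma hierarchy_commutes_with_neg_flow:
  "commutes_with_neg_flow (hierarchy k :: (real \<Rightarrow> real^'n) \<Rightarrow> real \<Rightarrow> real^'n)"
  unfolding commutes_with_neg_flow_def
proof (intro allI impI)
  fix v e :: "real \<Rightarrow> real^'n" and a :: "real \<Rightarrow> real"
  assume n: "neg_flow_vector v e a"
  then have v: "smooth v" and e: "smooth e" and a: "smooth a"
    and c: "\<And>x. neg_constraint v e a x = 0" by (auto simp: neg_flow_vector_def)
  have c1: "dx e x = a x *\<^sub>R v x" and c2: "dx a x = - (v x \<bullet> e x)" for x
    using c[of x] by (auto simp: neg_constraint_def J_with_def zero_prod_def)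
  have e': "(e has_vector_derivative a x *\<^sub>R v x) (at x)" for x
    using smooth_has_derivative'[OF e] c1 by metis
  have a': "(a has_real_derivative - (v x \<bullet> e x)) (at x)" for x
    using smooth_real_derivative[OF a] c2 by metis
  define P where "P = lax_q (Suc k) v"
  define r where "r = lax_r k v"
  define U where "U = lax_U k v"
  define f where "f = (\<lambda>x. a x *\<^sub>R r x + e x v* U x)"
  \<comment> \<open>Linearising a^2 + |e|^2 = 1 gives a g + e \<bullet> f = 0. Since U is skew, e
    \<bullet> f = a (e \<bullet> r), which suggests this g; it makes sense also where a
    vanishes.\<close>
  define g where "g = (\<lambda>x. - (e x \<bullet> r x))"
  have r': "(r has_vector_derivative P x - v x v* U x) (at x)" for x
    unfolding r_def P_def U_def by (rule lax_r_deriv[OF v])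
  have U': "((\<lambda>y. U y $ i $ j) has_real_derivative wedge (v x) (r x) $ i $ j) (at x)" for i j x
    unfolding U_def r_def by (rule lax_U_deriv(2)[OF v])
  have sk: "b \<bullet> (d v* U x) = - (d \<bullet> (b v* U x))" for b d x
    unfolding U_def by (rule inner_row_lax_U)
  have G: "gateaux (hierarchy k) v e = f"
    unfolding f_def r_def U_def using gateaux_hierarchy_neg_flow[OF v e e' a'] by (simp add: fun_eq_iff)
  \<comment> \<open>The linearisation of e' = a v. The two terms a (v U) cancel, and e (v \<and> r)
    = (e \<bullet> v) r - (e \<bullet> r) v supplies the term g v and cancels the contribution of
    a'.\<close>
  have f': "(f has_vector_derivative a x *\<^sub>R P x + g x *\<^sub>R v x) (at x)" for x
  proof -
    have "(f has_vector_derivative (a x *\<^sub>R (P x - v x v* U x) + (- (v x \<bullet> e x)) *\<^sub>R r x)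
        + ((a x *\<^sub>R v x) v* U x + e x v* wedge (v x) (r x))) (at x)"
      unfolding f_def
      by (intro has_vector_derivative_add has_vector_derivative_scaleR a' r' has_vector_derivative_row e' U')
    moreover have "(a x *\<^sub>R v x) v* U x = a x *\<^sub>R (v x v* U x)"
      using row_scale[of "a x" "v x" "U x"] by (simp add: scalar_mult_eq_scaleR)
    ultimately show ?thesis
      by (simp add: row_wedge_real g_def algebra_simps inner_commute)
  qed
  have g': "(g has_real_derivative - (P x \<bullet> e x) - v x \<bullet> f x) (at x)" for x
  proof -
    have "((\<lambda>x. e x \<bullet> r x) has_vector_derivative (e x \<bullet> (P x - v x v* U x) + (a x *\<^sub>R v x) \<bullet> r x)) (at x)"
      using has_derivative_inner[OF e'[of x, unfolded has_vector_derivative_def] r'[of x, unfolded has_vector_derivative_def]]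
      unfolding has_vector_derivative_def by (simp add: algebra_simps)
    then have "((\<lambda>x. e x \<bullet> r x) has_real_derivative (e x \<bullet> (P x - v x v* U x) + (a x *\<^sub>R v x) \<bullet> r x)) (at x)"
      by (simp add: has_real_derivative_iff_has_vector_derivative)
    then have "(g has_real_derivative - (e x \<bullet> (P x - v x v* U x) + (a x *\<^sub>R v x) \<bullet> r x)) (at x)"
      unfolding g_def by (rule DERIV_minus)
    moreover have "- (e x \<bullet> (P x - v x v* U x) + (a x *\<^sub>R v x) \<bullet> r x) = - (P x \<bullet> e x) - v x \<bullet> f x"
      using sk[of "e x" "v x" x] by (simp add: f_def inner_diff_right inner_add_right inner_commute)
    ultimately show ?thesis by simp
  qed
  have ag: "a x * g x + e x \<bullet> f x = 0" for x
    using sk[of "e x" "e x" x] by (simp add: f_def g_def inner_add_right)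
  have hv: "hierarchy k v = P" unfolding P_def by (rule hierarchy_eq_lax_q[OF v])
  show "\<exists>g. smooth g \<and> (\<forall>x. ((\<lambda>\<epsilon>. neg_constraint (\<lambda>y. v y + \<epsilon> *\<^sub>R hierarchy k v y)
       (\<lambda>y. e y + \<epsilon> *\<^sub>R gateaux (hierarchy k) v e y) (\<lambda>y. a y + \<epsilon> * g y) x) has_vector_derivative 0) (at 0))"
  proof (intro exI[of _ g] conjI allI)
    show "smooth g"
      unfolding g_def r_def
      by (intro smooth_uminus smooth_inner e smooth_diff_polyv[OF diff_polyv_lax_r v])
    fix x
    have E: "dx (\<lambda>y. e y + \<epsilon> *\<^sub>R f y) x = a x *\<^sub>R v x + \<epsilon> *\<^sub>R (a x *\<^sub>R P x + g x *\<^sub>R v x)" for \<epsilon>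
      by (rule dx_eqI) (auto intro!: derivative_eq_intros e' f')
    have A: "dx (\<lambda>y. a y + \<epsilon> * g y) x = - (v x \<bullet> e x) + \<epsilon> * (- (P x \<bullet> e x) - v x \<bullet> f x)" for \<epsilon>
      by (rule dx_real_eqI) (rule derivative_eq_intros a' g' | simp)+
    have 1: "((\<lambda>\<epsilon>. J_with (\<lambda>y. v y + \<epsilon> *\<^sub>R P y) (\<lambda>y. - (a y + \<epsilon> * g y)) (\<lambda>y. e y + \<epsilon> *\<^sub>R f y) x)
       has_vector_derivative 0) (at 0)"
    proof -
      \<comment> \<open>The constant and the linear terms in \<epsilon> drop out; the same happens
        in the other two constraints, apart from the constant term of the normalisation.\<close>
      have "J_with (\<lambda>y. v y + \<epsilon> *\<^sub>R P y) (\<lambda>y. - (a y + \<epsilon> * g y)) (\<lambda>y. e y + \<epsilon> *\<^sub>R f y) x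
         = (- (\<epsilon>\<^sup>2 * g x)) *\<^sub>R P x" for \<epsilon>
        unfolding J_with_def E by (simp add: algebra_simps power2_eq_square)
      moreover have "((\<lambda>\<epsilon>. (- (\<epsilon>\<^sup>2 * g x)) *\<^sub>R P x) has_vector_derivative 0) (at 0)"
        by (auto intro!: derivative_eq_intros)
      ultimately show ?thesis by simp
    qed
    have 2: "((\<lambda>\<epsilon>. dx (\<lambda>y. a y + \<epsilon> * g y) x + (v x + \<epsilon> *\<^sub>R P x) \<bullet> (e x + \<epsilon> *\<^sub>R f x)) has_vector_derivative 0) (at 0)"
    proof -
      have "dx (\<lambda>y. a y + \<epsilon> * g y) x + (v x + \<epsilon> *\<^sub>R P x) \<bullet> (e x + \<epsilon> *\<^sub>R f x) = \<epsilon>\<^sup>2 * (P x \<bullet> f x)" for \<epsilon>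
        unfolding A by (simp add: algebra_simps power2_eq_square inner_add_left inner_add_right)
      moreover have "((\<lambda>\<epsilon>. \<epsilon>\<^sup>2 * (P x \<bullet> f x)) has_vector_derivative 0) (at 0)"
        by (auto intro!: derivative_eq_intros simp flip: has_real_derivative_iff_has_vector_derivative)
      ultimately show ?thesis by simp
    qed
    have 3: "((\<lambda>\<epsilon>. (a x + \<epsilon> * g x)\<^sup>2 + (norm (e x + \<epsilon> *\<^sub>R f x))\<^sup>2 - 1) has_vector_derivative 0) (at 0)"
    proof -
      have "(a x + \<epsilon> * g x)\<^sup>2 + (norm (e x + \<epsilon> *\<^sub>R f x))\<^sup>2 - 1
         = (a x)\<^sup>2 + e x \<bullet> e x - 1 + 2 * \<epsilon> * (a x * g x + e x \<bullet> f x) + \<epsilon>\<^sup>2 * ((g x)\<^sup>2 + f x \<bullet> f x)" for \<epsilon>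
        unfolding power2_norm_eq_inner
        by (simp add: inner_add_left inner_add_right inner_commute algebra_simps power2_eq_square)
      moreover have "((\<lambda>\<epsilon>. (a x)\<^sup>2 + e x \<bullet> e x - 1 + 2 * \<epsilon> * (a x * g x + e x \<bullet> f x)
          + \<epsilon>\<^sup>2 * ((g x)\<^sup>2 + f x \<bullet> f x)) has_vector_derivative 0) (at 0)"
        unfolding ag by (auto intro!: derivative_eq_intros simp flip: has_real_derivative_iff_has_vector_derivative)
      ultimately show ?thesis by (simp only:)
    qed
    show "((\<lambda>\<epsilon>. neg_constraint (\<lambda>y. v y + \<epsilon> *\<^sub>R hierarchy k v y)
       (\<lambda>y. e y + \<epsilon> *\<^sub>R gateaux (hierarchy k) v e y) (\<lambda>y. a y + \<epsilon> * g y) x) has_vector_derivative 0) (at 0)"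
      unfolding neg_constraint_def G hv zero_prod_def
      by (intro has_vector_derivative_Pair 1 2 3)
  qed
qed

subsection \<open>The vector sine-Gordon equation\<close>

text \<open>For a > 0 the tangential part is the positive root of 1 - |e|^2, so the prefactor in
  \<open>sg_normal\<close> is 1 / a, while e' = a v.\<close>

lemma sg_normal_eq:
  assumes "neg_flow_vector v e a" "a x > 0"
  shows "sg_normal e x = v x"
proof -
  have c: "neg_constraint v e a x = 0" using assms(1) by (auto simp: neg_flow_vector_def)
  then have e: "dx e x = a x *\<^sub>R v x" and n: "1 - (norm (e x))\<^sup>2 = (a x)\<^sup>2"
    by (auto simp: neg_constraint_def J_with_def zero_prod_def)
  show ?thesis
    unfolding sg_normal_def e n using assms(2) by (simp add: real_sqrt_inverse)
qed

lemma neg_flow_iff_sine_gordon: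
  fixes v e :: "real \<Rightarrow> real \<Rightarrow> real^'n" and a :: "real \<Rightarrow> real \<Rightarrow> real"
  assumes R: "R\<^sup>2 = (1 :: real)"
    and n: "\<And>\<tau>. neg_flow_vector (v \<tau>) (e \<tau>) (a \<tau>)"
    and c: "continuous_on UNIV (\<lambda>\<tau>. a \<tau> x)" and pos: "a \<tau> x > 0"
  shows "((\<lambda>t. v t x) has_vector_derivative - (R *\<^sub>R e \<tau> x)) (at \<tau>) \<longleftrightarrow>
         sine_gordon_at (\<lambda>s. e (R * s)) (R * \<tau>) x"
proof -
  \<comment> \<open>Scaling the flow parameter by R is an involution; this drives both directions of
    the chain rule below.\<close>
  have RR: "R * (R * t) = t" for t using R by (metis mult.assoc mult_1 power2_eq_square)
  have R0: "R \<noteq> 0" using R by auto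
  \<comment> \<open>Equality of v and \<open>sg_normal\<close> at the single parameter \<tau> would
    say nothing about derivatives; continuity of a extends it to a neighbourhood.\<close>
  have "open {t. a t x > 0}"
    using open_Collect_less[OF continuous_on_const c] .
  then have ev: "\<forall>\<^sub>F t in nhds \<tau>. v t x = sg_normal (e t) x"
    using sg_normal_eq[OF n] pos unfolding eventually_nhds by (metis mem_Collect_eq)
  have "((\<lambda>t. v t x) has_vector_derivative - (R *\<^sub>R e \<tau> x)) (at \<tau>) \<longleftrightarrow>
      ((\<lambda>t. sg_normal (e t) x) has_vector_derivative - (R *\<^sub>R e \<tau> x)) (at \<tau>)"
    by (rule has_vector_derivative_cong_ev)
      (use ev in \<open>auto elim: eventually_mono dest: eventually_nhds_x_imp_x\<close>)
  also have "\<dots> \<longleftrightarrow> ((\<lambda>t. sg_normal (e (R * t)) x) has_vector_derivative - e \<tau> x) (at (R * \<tau>))"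
  proof
    assume "((\<lambda>t. sg_normal (e t) x) has_vector_derivative - (R *\<^sub>R e \<tau> x)) (at \<tau>)"
    moreover have "((\<lambda>t. R * t) has_real_derivative R) (at (R * \<tau>))"
      by (auto intro!: derivative_eq_intros)
    ultimately have "((\<lambda>t. sg_normal (e t) x) \<circ> (\<lambda>t. R * t) has_vector_derivative R *\<^sub>R (- (R *\<^sub>R e \<tau> x))) (at (R * \<tau>))"
      by (intro vector_diff_chain_at) (simp_all add: has_real_derivative_iff_has_vector_derivative RR)
    then show "((\<lambda>t. sg_normal (e (R * t)) x) has_vector_derivative - e \<tau> x) (at (R * \<tau>))"
      using R by (simp add: o_def power2_eq_square)
  next
    assume "((\<lambda>t. sg_normal (e (R * t)) x) has_vector_derivative - e \<tau> x) (at (R * \<tau>))"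
    moreover have "((\<lambda>t. R * t) has_real_derivative R) (at \<tau>)"
      by (auto intro!: derivative_eq_intros)
    ultimately have "((\<lambda>t. sg_normal (e (R * t)) x) \<circ> (\<lambda>t. R * t) has_vector_derivative R *\<^sub>R (- e \<tau> x)) (at \<tau>)"
      by (intro vector_diff_chain_at) (simp_all add: has_real_derivative_iff_has_vector_derivative)
    then show "((\<lambda>t. sg_normal (e t) x) has_vector_derivative - (R *\<^sub>R e \<tau> x)) (at \<tau>)"
      by (simp add: o_def RR)
  qed
  finally show ?thesis by (simp add: sine_gordon_at_def RR)
qed

lemma neg_flow_vector_sg_normal:
  fixes e :: "real \<Rightarrow> real^'n"
  assumes e: "smooth e" and less: "\<And>x. norm (e x) < 1"
  shows "neg_flow_vector (sg_normal e) e (\<lambda>x. sqrt (1 - (norm (e x))\<^sup>2))"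
proof -
  define h where "h = (\<lambda>x. 1 - e x \<bullet> e x)"
  \<comment> \<open>Both functions in question are products with c: sqrt h = h c, and
    \<open>sg_normal e\<close> is c times the derivative of e. As c' = - c^3 h' / 2, adjoining c to
    the smooth functions generates an algebra closed under differentiation.\<close>
  define c where "c = (\<lambda>x. inverse (sqrt (h x)))"
  have h_eq: "1 - (norm (e x))\<^sup>2 = h x" for x by (simp add: h_def power2_norm_eq_inner)
  have hpos: "h x > 0" for x
  proof -
    have "(norm (e x))\<^sup>2 < 1" using less[of x] by (simp add: power_less_one_iff abs_square_less_1)
    then show ?thesis by (simp flip: h_eq)
  qed
  have sh: "smooth h"
    using smooth_add[OF smooth_const smooth_uminus[OF smooth_inner[OF e e]], of 1] by (simp add: h_def)
  have h': "(h has_real_derivative - 2 * (e x \<bullet> dx e x)) (at x)" for x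
  proof -
    have "((\<lambda>x. e x \<bullet> e x) has_real_derivative 2 * (e x \<bullet> dx e x)) (at x)"
      using has_derivative_inner[OF smooth_has_derivative'[OF e, of x, unfolded has_vector_derivative_def]
          smooth_has_derivative'[OF e, of x, unfolded has_vector_derivative_def]]
      by (simp add: has_field_derivative_def inner_commute mult_commute_abs algebra_simps)
    then show ?thesis unfolding h_def by (auto intro!: derivative_eq_intros)
  qed
  have c': "(c has_real_derivative - (1/2) * (c x * (c x * (c x * dx h x)))) (at x)" for x
    unfolding c_def using hpos[of x]
    by (auto intro!: derivative_eq_intros smooth_real_derivative[OF sh] simp: field_simps)
  let ?S = "insert c {f. smooth f}"
  have sc: "smooth c"
  proof (rule smooth_algebra_generated[of ?S])
    show "c \<in> algebra_generated ?S" by (simp add: algebra_generated.base)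
    fix f assume "f \<in> ?S"
    then consider "f = c" | "smooth f" by blast
    then show "\<exists>f'\<in>algebra_generated ?S. \<forall>x. (f has_real_derivative f' x) (at x)"
    proof cases
      case 1
      have "(\<lambda>x. - (1/2) * (c x * (c x * (c x * dx h x)))) \<in> algebra_generated ?S"
        by (intro algebra_generated.mult algebra_generated.const algebra_generated.base)
          (simp_all add: smooth_dx[OF sh])
      then show ?thesis unfolding 1 by (rule bexI[rotated]) (intro allI c')
    next
      case 2
      then show ?thesis
        by (intro bexI[of _ "dx f"]) (auto intro: smooth_real_derivative algebra_generated.base smooth_dx)
    qed
  qed
  have a_eq: "sqrt (h x) = h x * c x" for x
    using hpos[of x] by (simp add: c_def field_simps)
  have v_eq: "sg_normal e = (\<lambda>x. c x *\<^sub>R dx e x)"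
    by (simp add: fun_eq_iff sg_normal_def h_eq c_def real_sqrt_inverse)
  have "smooth (sg_normal e)"
    unfolding v_eq smooth_vec_iff[of "\<lambda>x. c x *\<^sub>R dx e x"]
    using smooth_mult[OF sc] smooth_dx[OF e] unfolding smooth_vec_iff by simp
  moreover have "smooth (\<lambda>x. sqrt (h x))"
    unfolding a_eq by (rule smooth_mult[OF sh sc])
  moreover have "neg_constraint (sg_normal e) e (\<lambda>x. sqrt (h x)) x = 0" for x
  proof -
    have "((\<lambda>x. sqrt (h x)) has_real_derivative - (c x * (e x \<bullet> dx e x))) (at x)"
      unfolding c_def using hpos[of x] by (auto intro!: derivative_eq_intros h' simp: field_simps)
    then have "dx (\<lambda>x. sqrt (h x)) x = - (c x * (e x \<bullet> dx e x))" by (rule dx_real_eqI)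
    moreover have "sqrt (h x) * c x = 1" using hpos[of x] by (simp add: c_def)
    ultimately show ?thesis
      using hpos[of x]
      by (simp add: neg_constraint_def J_with_def v_eq zero_prod_def inner_commute flip: h_eq)
  qed
  ultimately show ?thesis
    unfolding neg_flow_vector_def h_eq using e by blast
qed

lemma neg_flow_is_sine_gordon_unit:
  assumes "R\<^sup>2 = 1" shows "neg_flow_is_sine_gordon TYPE('n::finite) R"
  unfolding neg_flow_is_sine_gordon_def
proof (intro conjI allI impI)
  fix v e :: "real \<Rightarrow> real \<Rightarrow> real^'n" and a \<tau> x
  assume n: "\<forall>\<tau>. neg_flow_vector (v \<tau>) (e \<tau>) (a \<tau>)" and c: "\<forall>x. continuous_on UNIV (\<lambda>\<tau>. a \<tau> x)"
    and pos: "a \<tau> x > 0"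
  show "v \<tau> x = sg_normal (e \<tau>) x" using sg_normal_eq n pos by metis
  show "((\<lambda>t. v t x) has_vector_derivative - (R *\<^sub>R e \<tau> x)) (at \<tau>) \<longleftrightarrow>
         sine_gordon_at (\<lambda>s. e (R * s)) (R * \<tau>) x"
    by (rule neg_flow_iff_sine_gordon[OF assms]) (use n c pos in auto)
next
  fix e :: "real \<Rightarrow> real^'n" assume "smooth e" "\<forall>x. norm (e x) < 1"
  then show "neg_flow_vector (sg_normal e) e (\<lambda>x. sqrt (1 - (norm (e x))\<^sup>2))"
    by (intro neg_flow_vector_sg_normal) auto
qed

subsection \<open>Commutation with the vector mKdV flow\<close>

lemma lax_p_1: "lax_p (Suc 0) v x = (v x \<bullet> v x) / 2"
  by simp

lemma lax_r_1: "lax_r (Suc 0) v x = dx (dx v) x + ((v x \<bullet> v x) / 2) *\<^sub>R v x"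
  unfolding lax_r.simps lax_q_1 lax_p_1 ..

lemma lax_U_1: "lax_U (Suc 0) v x = wedge (v x) (dx v x)"
  by (simp add: lax_q_1 del: lax_q.simps(2))

lemma has_real_derivative_inner:
  fixes f g :: "real \<Rightarrow> real^'n"
  assumes "(f has_vector_derivative f') (at x)" "(g has_vector_derivative g') (at x)"
  shows "((\<lambda>y. f y \<bullet> g y) has_real_derivative f' \<bullet> g x + f x \<bullet> g') (at x)"
  using has_derivative_inner[OF assms[unfolded has_vector_derivative_def]]
  unfolding has_real_derivative_iff_has_vector_derivative has_vector_derivative_def
  by (simp add: algebra_simps)

lemma smooth_derivs:
  assumes "smooth v"
  shows "(v has_vector_derivative dx v x) (at x)"
    and "(dx v has_vector_derivative dx (dx v) x) (at x)"
    and "(dx (dx v) has_vector_derivative dx (dx (dx v)) x) (at x)"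
  using assms by (intro smooth_has_derivative' smooth_dx; assumption)+

lemma lax_q_2:
  fixes v :: "real \<Rightarrow> real^'n"
  assumes "smooth v"
  shows "lax_q (Suc (Suc 0)) v x = dx (dx (dx v)) x + (3/2 * (v x \<bullet> v x)) *\<^sub>R dx v x"
proof -
  have "(lax_r (Suc 0) v has_vector_derivative dx (dx (dx v)) x
     + (((v x \<bullet> v x) / 2) *\<^sub>R dx v x + ((dx v x \<bullet> v x + v x \<bullet> dx v x) / 2) *\<^sub>R v x)) (at x)"
    unfolding lax_r_1[abs_def]
    by (intro has_vector_derivative_add has_vector_derivative_scaleR DERIV_cdivide
        has_real_derivative_inner smooth_derivs assms)
  from dx_eqI[OF this] show ?thesis
    unfolding lax_q.simps(2)[of "Suc 0"] lax_U_1 row_wedge_real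
    by (simp add: inner_commute algebra_simps flip: scaleR_add_left)
qed

lemma lax_q_2_fun:
  assumes "smooth v"
  shows "lax_q (Suc (Suc 0)) v = (\<lambda>x. (dx ^^ 3) v x + (3/2 * (v x \<bullet> v x)) *\<^sub>R (dx ^^ 1) v x)"
  using lax_q_2[OF assms] by (simp add: fun_eq_iff numeral_3_eq_3 del: lax_q.simps)

lemma gateaux_mkdv:
  fixes v w :: "real \<Rightarrow> real^'n"
  assumes "smooth v" "smooth w"
  shows "gateaux (hierarchy 1) v w x =
    dx (dx (dx w)) x + (3/2 * (v x \<bullet> v x)) *\<^sub>R dx w x + (3 * (v x \<bullet> w x)) *\<^sub>R dx v x"
proof -
  have "((\<lambda>e. ((dx ^^ 3) v x + e *\<^sub>R (dx ^^ 3) w x)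
      + (3/2 * ((v x + e *\<^sub>R w x) \<bullet> (v x + e *\<^sub>R w x))) *\<^sub>R ((dx ^^ 1) v x + e *\<^sub>R (dx ^^ 1) w x))
     has_vector_derivative (dx ^^ 3) w x + ((3/2 * (v x \<bullet> v x)) *\<^sub>R (dx ^^ 1) w x
        + (3/2 * (w x \<bullet> v x + v x \<bullet> w x)) *\<^sub>R (dx ^^ 1) v x)) (at 0)"
  proof -
    have l: "((\<lambda>e. a + e *\<^sub>R b) has_vector_derivative b) (at 0)" for a b :: "real^'n"
      by (auto intro!: derivative_eq_intros)
    show ?thesis
      using has_vector_derivative_add[OF l has_vector_derivative_scaleR[OF DERIV_cmult[OF has_real_derivative_inner[OF l l], of "3/2"] l]]
      by simp
  qed
  then have "((\<lambda>e. hierarchy 1 (\<lambda>y. v y + e *\<^sub>R w y) x) has_vector_derivative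
     (dx ^^ 3) w x + ((3/2 * (v x \<bullet> v x)) *\<^sub>R (dx ^^ 1) w x
        + (3/2 * (w x \<bullet> v x + v x \<bullet> w x)) *\<^sub>R (dx ^^ 1) v x)) (at 0)"
    unfolding One_nat_def[symmetric]
    by (simp only: hierarchy_eq_lax_q[OF smooth_comb[OF assms]] One_nat_def lax_q_2_fun[OF smooth_comb[OF assms]] dx_comb[OF assms])
  from vector_derivative_at[OF this] show ?thesis
    unfolding gateaux_def by (simp add: numeral_3_eq_3 inner_commute add.assoc)
qed

lemma cvec_row_wedge:
  "cvec u v* mscale fps_X (vwedge (cvec a) (cvec b)) = fps_X *s cvec (u v* wedge a b)"
  unfolding row_mscale row_wedge row_wedge_real vdot_cvec_cvec cvec_simps ..

text \<open>V is the Lax solution truncated after the first power of X. All its equations survive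
  truncation except the one for r, which misses X times the coefficient q of index 2. That
  coefficient is the mKdV flow, so V satisfies the zero curvature equation with m = X.\<close>

lemma gateaux_hierarchy_mkdv:
  fixes v :: "real \<Rightarrow> real^'n" and k :: nat
  assumes v: "smooth v"
  defines "j \<equiv> Suc k"
  shows "gateaux (hierarchy k) v (hierarchy 1 v) x =
    lax_r (Suc j) v x + ((v x \<bullet> v x) / 2) *\<^sub>R lax_r j v x - lax_p (Suc j) v x *\<^sub>R v x - lax_p j v x *\<^sub>R lax_r (Suc 0) v x
    - dx v x v* lax_U j v x + lax_q j v x v* wedge (v x) (dx v x)"
proof -
  let ?w = "lax_q (Suc (Suc 0)) v"
  let ?P = "\<lambda>y. 1 + fps_X * fps_const (lax_p (Suc 0) v y)"
  let ?Qt = "\<lambda>y. cvec (lax_q (Suc 0) v y)"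
  let ?R = "\<lambda>y. cvec (v y) + fps_X *s cvec (lax_r (Suc 0) v y)"
  let ?T = "\<lambda>y. mscale fps_X (vwedge (cvec (v y)) (cvec (dx v y)))"
  have w: "smooth ?w" by (rule smooth_diff_polyv[OF diff_polyv_lax_q v])
  have sm: "mscale c (0 :: real fps^'n^'n) = 0" for c by (simp add: mscale_def vec_eq_iff)
  have A: "has_fps_deriv ?P (vdot (cvec (v y)) (fps_X *s ?Qt y)) y" for y
  proof -
    have "has_fps_deriv ?P (0 + (0 * fps_const (lax_p (Suc 0) v y) + fps_X * fps_const (v y \<bullet> lax_q (Suc 0) v y))) y"
      by (rule fps_deriv_rules fps_const_deriv lax_p_deriv v)+
    then show ?thesis by (simp add: vdot_scale_right vdot_cvec_cvec del: lax_q.simps lax_p.simps)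
  qed
  have B': "has_fpsv_deriv ?Qt (cvec (lax_r (Suc 0) v y) - fps_const (lax_p (Suc 0) v y) *s cvec (v y)) y" for y
    using cvec_deriv[OF lax_q_deriv[OF v, of "Suc 0" y]] by (simp only: cvec_simps)
  have B: "has_fpsv_deriv (\<lambda>y. fps_X *s ?Qt y) (?R y - ?P y *s cvec (v y)) y" for y
    by (rule has_fpsv_deriv_eq, rule has_fpsv_deriv_scale[OF has_fps_deriv_const B'])
      (simp add: vec_eq_iff algebra_simps del: lax_q.simps lax_p.simps lax_r.simps)
  \<comment> \<open>The truncated Q / X ends with the coefficient of index 1, and the forcing term
    restores that of index 2.\<close>
  have C: "has_fpsv_deriv ?R (?Qt y - cvec (v y) v* ?T y + fps_X *s cvec (?w y)) y" for y
    by (rule has_fpsv_deriv_eq, (rule fps_deriv_rules cvec_deriv smooth_derivs(1)[OF v] lax_r_deriv[OF v])+)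
      (simp add: cvec_row_wedge lax_q_1 lax_U_1 cvec_simps vec_eq_iff algebra_simps
        del: lax_q.simps lax_p.simps lax_r.simps lax_U.simps)
  have D: "has_fpsm_deriv ?T (vwedge (cvec (v y)) (?R y)) y" for y
  proof -
    have "has_fpsm_deriv ?T (mscale 0 (vwedge (cvec (v y)) (cvec (dx v y)))
        + mscale fps_X (vwedge (cvec (dx v y)) (cvec (dx v y)) + vwedge (cvec (v y)) (cvec (dx (dx v) y)))) y"
      by (rule fps_deriv_rules cvec_deriv smooth_derivs[OF v])+
    moreover have "mscale 0 (vwedge (cvec (v y)) (cvec (dx v y)))
        + mscale fps_X (vwedge (cvec (dx v y)) (cvec (dx v y)) + vwedge (cvec (v y)) (cvec (dx (dx v) y)))
       = vwedge (cvec (v y)) (?R y)"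
      unfolding lax_r_1 cvec_simps vwedge_simps mscale_simps sm by (simp add: mscale_def vec_eq_iff)
    ultimately show ?thesis by (simp only:)
  qed
  have E: "\<exists>d. has_fpsv_deriv ?Qt d y \<and> fps_X *s d = ?R y - ?P y *s cvec (v y)" for y
    by (rule exI, rule conjI[OF B']) (simp add: vec_eq_iff algebra_simps del: lax_q.simps lax_p.simps lax_r.simps)
  have T: "skew (?T y)" for y
    by (simp add: skew_def mscale_def vwedge_def algebra_simps)
  have "fps_X *s dLq v ?w x = ?P x *s Lr v x - Lp v x *s ?R x - (fps_X *s ?Qt x) v* LU v x + Lq v x v* ?T x"
    by (rule variation_eq_bracket(2)[OF v w A B C D E refl T])
  \<comment> \<open>The factor m = X shifts the left side, so the variation of q at index j sits at
    the power j + 1.\<close>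
  then have c: "fps_nth ((fps_X *s dLq v ?w x) $ i) (Suc j) = fps_nth ((?P x *s Lr v x - Lp v x *s ?R x
     - (fps_X *s ?Qt x) v* LU v x + Lq v x v* ?T x) $ i) (Suc j)" for i by (simp only:)
  have u: "fps_nth ((cvec a v* LU v x) $ i) m = (a v* lax_U m v x) $ i" for a i m
    by (simp add: vector_matrix_mult_def fps_sum_nth cvec_def fps_nth_sers)
  have d: "fps_nth (vdot (Lq v x) (cvec a) * b) m = fps_nth (b * vdot (cvec a) (Lq v x)) m" for a b m
    by (simp add: vdot_commute mult.commute)
  have t: "fps_nth ((Lq v x v* ?T x) $ i) (Suc j) = (lax_q j v x v* wedge (v x) (dx v x)) $ i" for i
  proof -
    have "(Lq v x v* ?T x) $ i = fps_X * (fps_const (dx v x $ i) * vdot (cvec (v x)) (Lq v x)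
        - fps_const (v x $ i) * vdot (cvec (dx v x)) (Lq v x))"
      unfolding row_mscale row_wedge by (simp add: cvec_def vdot_commute mult.commute mult.left_commute right_diff_distrib)
    then show ?thesis
      unfolding row_wedge_real by (simp add: vdot_cvec fps_nth_sers inner_vec_def mult_ac del: lax_q.simps)
  qed
  have p: "fps_nth ((?P x *s Lr v x) $ i) (Suc j) = lax_r (Suc j) v x $ i + lax_p (Suc 0) v x * lax_r j v x $ i" for i
    by (simp add: fps_nth_sers distrib_right mult.assoc del: lax_q.simps lax_p.simps lax_r.simps)
  have r: "fps_nth ((Lp v x *s ?R x) $ i) (Suc j) = lax_p (Suc j) v x * v x $ i + lax_p j v x * lax_r (Suc 0) v x $ i" for i
  proof -
    have "(Lp v x *s ?R x) $ i = fps_const (v x $ i) * Lp v x + fps_X * (fps_const (lax_r (Suc 0) v x $ i) * Lp v x)"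
      by (simp add: cvec_def algebra_simps del: lax_r.simps)
    then show ?thesis by (simp add: fps_nth_sers mult.commute del: lax_p.simps lax_r.simps)
  qed
  have "variation (\<lambda>v x. lax_q j v x $ i) v ?w x = lax_r (Suc j) v x $ i + lax_p (Suc 0) v x * lax_r j v x $ i
    - (lax_p (Suc j) v x * v x $ i + lax_p j v x * lax_r (Suc 0) v x $ i) - (dx v x v* lax_U j v x) $ i
    + (lax_q j v x v* wedge (v x) (dx v x)) $ i" for i
    using c[of i] t[of i] p[of i] r[of i] u[of "lax_q (Suc 0) v x" i j]
    by (simp add: row_scale fps_nth_dsers lax_q_1 del: lax_q.simps lax_p.simps lax_r.simps)
  then have "gateaux (hierarchy k) v ?w x $ i = lax_r (Suc j) v x $ i + lax_p (Suc 0) v x * lax_r j v x $ i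
    - (lax_p (Suc j) v x * v x $ i + lax_p j v x * lax_r (Suc 0) v x $ i) - (dx v x v* lax_U j v x) $ i
    + (lax_q j v x v* wedge (v x) (dx v x)) $ i" for i
    unfolding gateaux_hierarchy[OF v w] j_def by (simp only:)
  moreover have "hierarchy 1 v = ?w" unfolding One_nat_def by (rule hierarchy_eq_lax_q[OF v])
  ultimately show ?thesis
    by (simp add: vec_eq_iff lax_p_1 del: lax_q.simps lax_p.simps lax_r.simps)
qed

text \<open>The linearised mKdV operator is applied to q of index k + 1, and the Lax equation
  eliminates its three derivatives. Both sides then become expressions in the same coefficients, v
  and two derivatives of v, and agree by algebra.\<close>

lemma hierarchy_commutes_with_mkdv: "flows_commute (hierarchy k) (hierarchy 1)"
  unfolding flows_commute_def
proof (intro allI impI)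
  fix v :: "real \<Rightarrow> real^'a" and x assume v: "smooth v"
  define q where "q = lax_q (Suc k) v"
  define r where "r = lax_r (Suc k) v"
  define p where "p = lax_p (Suc k) v"
  define U where "U = lax_U (Suc k) v"
  define q2 where "q2 = lax_q (Suc (Suc k)) v"
  define r2 where "r2 = lax_r (Suc (Suc k)) v"
  define p2 where "p2 = lax_p (Suc (Suc k)) v"
  note defs = q_def r_def p_def U_def q2_def r2_def p2_def
  have q': "(q has_vector_derivative r x - p x *\<^sub>R v x) (at x)"
    and r': "(r has_vector_derivative q2 x - v x v* U x) (at x)"
    and p': "(p has_real_derivative v x \<bullet> q x) (at x)"
    and U': "((\<lambda>y. U y $ i $ j) has_real_derivative wedge (v x) (r x) $ i $ j) (at x)"
    and q2': "(q2 has_vector_derivative r2 x - p2 x *\<^sub>R v x) (at x)" for x i j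
    unfolding defs
    by (rule lax_q_deriv[OF v] lax_r_deriv[OF v] lax_p_deriv[OF v] lax_U_deriv(2)[OF v])+
  have d1: "dx q = (\<lambda>x. r x - p x *\<^sub>R v x)" by (rule ext, rule dx_eqI, rule q')
  have d2: "dx (dx q) = (\<lambda>x. (q2 x - v x v* U x) - (p x *\<^sub>R dx v x + (v x \<bullet> q x) *\<^sub>R v x))"
    unfolding d1 by (rule ext, rule dx_eqI)
      (intro has_vector_derivative_diff has_vector_derivative_scaleR r' p' smooth_derivs v)
  have d3: "dx (dx (dx q)) x = (r2 x - p2 x *\<^sub>R v x) - (dx v x v* U x + v x v* wedge (v x) (r x))
     - ((p x *\<^sub>R dx (dx v) x + (v x \<bullet> q x) *\<^sub>R dx v x)
        + ((v x \<bullet> q x) *\<^sub>R dx v x + (dx v x \<bullet> q x + v x \<bullet> (r x - p x *\<^sub>R v x)) *\<^sub>R v x))"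
    unfolding d2 by (rule dx_eqI)
      (intro has_vector_derivative_diff has_vector_derivative_add has_vector_derivative_scaleR
        has_vector_derivative_row has_real_derivative_inner U' q' q2' p' smooth_derivs v)
  have hv: "hierarchy k v = q" unfolding q_def by (rule hierarchy_eq_lax_q[OF v])
  have sq: "smooth q" unfolding q_def by (rule smooth_diff_polyv[OF diff_polyv_lax_q v])
  show "gateaux (hierarchy k) v (hierarchy 1 v) x = gateaux (hierarchy 1) v (hierarchy k v) x"
    unfolding gateaux_hierarchy_mkdv[OF v] hv gateaux_mkdv[OF v sq] d3 lax_r_1
    unfolding defs[symmetric] d1 row_wedge_real
    by (simp add: algebra_simps inner_commute) (simp add: vec_eq_iff algebra_simps)
qed

subsection \<open>The fifth order flow\<close>

lemma lax_p_2:
  fixes v :: "real \<Rightarrow> real^'n"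
  assumes "smooth v"
  shows "lax_p (Suc (Suc 0)) v x = v x \<bullet> dx (dx v) x + 3/8 * (v x \<bullet> v x)\<^sup>2 - (dx v x \<bullet> dx v x) / 2"
proof -
  \<comment> \<open>The terms with U drop out, because U of index 0 is zero.\<close>
  have "lax_p (Suc (Suc 0)) v x = ((lax_r 0 v x \<bullet> lax_r (Suc 0) v x + lax_r (Suc 0) v x \<bullet> lax_r 0 v x)
     + (lax_U 0 v x \<bullet> lax_U (Suc 0) v x + lax_U (Suc 0) v x \<bullet> lax_U 0 v x) / 2
     - lax_p (Suc 0) v x * lax_p (Suc 0) v x - lax_q (Suc 0) v x \<bullet> lax_q (Suc 0) v x) / 2"
    unfolding lax_p.simps(2)[of "Suc 0"] by (simp del: lax_q.simps(2) lax_p.simps(2) lax_r.simps(2) lax_U.simps(2))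
  then show ?thesis
    unfolding lax_r_1 lax_p_1 lax_q_1 lax_r.simps(1) lax_U.simps(1)
    by (simp add: inner_add_right inner_commute power2_eq_square field_simps)
qed

lemma lax_U_2:
  "lax_U (Suc (Suc 0)) v x = wedge (v x) (lax_q (Suc (Suc 0)) v x) + wedge (lax_r (Suc 0) v x) (dx v x)
     - ((v x \<bullet> v x) / 2) *\<^sub>R wedge (v x) (dx v x)"
  unfolding lax_U.simps(2)[of "Suc 0"]
  by (simp add: lax_q_1 lax_p_1 lax_U_1 del: lax_q.simps(2) lax_p.simps(2) lax_r.simps(2) lax_U.simps(2))

text \<open>The components along v cancel between the derivative of r and v U, both of index 2, so
  no summand proportional to v remains. All terms have weight 6 under the scaling of v(x) to c v(c
  x).\<close>

lemma lax_q_3: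
  fixes v :: "real \<Rightarrow> real^'n"
  assumes "smooth v"
  shows "lax_q (Suc (Suc (Suc 0))) v x = (dx ^^ 5) v x
    + (5/2) *\<^sub>R dx (\<lambda>y. (norm (v y))\<^sup>2 *\<^sub>R (dx ^^ 2) v y) x
    + (5/2 * (dx (dx (\<lambda>y. (norm (v y))\<^sup>2)) x - (norm (dx v x))\<^sup>2 + 3/4 * (norm (v x)) ^ 4)) *\<^sub>R dx v x"
proof -
  \<comment> \<open>Opaque names for the derivatives turn the final identity into polynomial algebra
    in their components.\<close>
  define v1 where "v1 = dx v"
  define v2 where "v2 = dx v1"
  define v3 where "v3 = dx v2"
  define v4 where "v4 = dx v3"
  define v5 where "v5 = dx v4"
  have s: "smooth v" "smooth v1" "smooth v2" "smooth v3" "smooth v4"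
    unfolding v1_def v2_def v3_def v4_def by (intro smooth_dx assms)+
  have d: "(v has_vector_derivative v1 x) (at x)" "(v1 has_vector_derivative v2 x) (at x)"
    "(v2 has_vector_derivative v3 x) (at x)" "(v3 has_vector_derivative v4 x) (at x)"
    "(v4 has_vector_derivative v5 x) (at x)" for x
    using s[THEN smooth_has_derivative'] unfolding v1_def v2_def v3_def v4_def v5_def by blast+
  note vd = v1_def[symmetric] v2_def[symmetric] v3_def[symmetric] v4_def[symmetric] v5_def[symmetric]
  have q2: "lax_q (Suc (Suc 0)) v = (\<lambda>x. v3 x + (3/2 * (v x \<bullet> v x)) *\<^sub>R v1 x)"
    using lax_q_2[OF assms] by (simp add: fun_eq_iff vd del: lax_q.simps)
  have q2': "dx (lax_q (Suc (Suc 0)) v) = (\<lambda>x. v4 x + ((3/2 * (v x \<bullet> v x)) *\<^sub>R v2 x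
      + (3/2 * (v1 x \<bullet> v x + v x \<bullet> v1 x)) *\<^sub>R v1 x))"
    unfolding q2 by (rule ext, rule dx_eqI)
      (intro has_vector_derivative_add has_vector_derivative_scaleR DERIV_cmult has_real_derivative_inner d)
  have r2: "lax_r (Suc (Suc 0)) v = (\<lambda>x. v4 x + ((3/2 * (v x \<bullet> v x)) *\<^sub>R v2 x
      + (3/2 * (v1 x \<bullet> v x + v x \<bullet> v1 x)) *\<^sub>R v1 x)
      + (v x \<bullet> v2 x + 3/8 * ((v x \<bullet> v x) * (v x \<bullet> v x)) - (v1 x \<bullet> v1 x) / 2) *\<^sub>R v x)"
    unfolding lax_r.simps(2)[of "Suc 0"] q2' using lax_p_2[OF assms]
    by (simp add: vd power2_eq_square del: lax_p.simps)
  have r2': "dx (lax_r (Suc (Suc 0)) v) x = v5 x + ((3/2 * (v x \<bullet> v x)) *\<^sub>R v3 x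
        + (3/2 * (v1 x \<bullet> v x + v x \<bullet> v1 x)) *\<^sub>R v2 x
      + ((3/2 * (v1 x \<bullet> v x + v x \<bullet> v1 x)) *\<^sub>R v2 x
        + (3/2 * ((v2 x \<bullet> v x + v1 x \<bullet> v1 x) + (v1 x \<bullet> v1 x + v x \<bullet> v2 x))) *\<^sub>R v1 x))
      + ((v x \<bullet> v2 x + 3/8 * ((v x \<bullet> v x) * (v x \<bullet> v x)) - (v1 x \<bullet> v1 x) / 2) *\<^sub>R v1 x
        + (((v1 x \<bullet> v2 x + v x \<bullet> v3 x)
            + 3/8 * ((v x \<bullet> v x) * (v1 x \<bullet> v x + v x \<bullet> v1 x) + (v1 x \<bullet> v x + v x \<bullet> v1 x) * (v x \<bullet> v x)))
           - (v2 x \<bullet> v1 x + v1 x \<bullet> v2 x) / 2) *\<^sub>R v x)"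
    unfolding r2 by (rule dx_eqI)
      (intro has_vector_derivative_add has_vector_derivative_scaleR DERIV_cmult DERIV_add DERIV_diff
        DERIV_mult' DERIV_cdivide has_real_derivative_inner d)
  have n: "(norm (v y))\<^sup>2 = v y \<bullet> v y" "(norm (v1 y))\<^sup>2 = v1 y \<bullet> v1 y" for y
    by (simp_all add: power2_norm_eq_inner)
  have n4: "norm (v x) ^ 4 = (v x \<bullet> v x) * (v x \<bullet> v x)"
    unfolding n(1)[symmetric] by (simp flip: power_add)
  have f1: "dx (\<lambda>y. (v y \<bullet> v y) *\<^sub>R v2 y) x = (v x \<bullet> v x) *\<^sub>R v3 x + (v1 x \<bullet> v x + v x \<bullet> v1 x) *\<^sub>R v2 x"
    by (rule dx_eqI) (intro has_vector_derivative_scaleR has_real_derivative_inner d)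
  have f2: "dx (\<lambda>y. v y \<bullet> v y) = (\<lambda>y. v1 y \<bullet> v y + v y \<bullet> v1 y)"
    by (rule ext, rule dx_real_eqI) (intro has_real_derivative_inner d)
  have f3: "dx (\<lambda>y. v1 y \<bullet> v y + v y \<bullet> v1 y) x = (v2 x \<bullet> v x + v1 x \<bullet> v1 x) + (v1 x \<bullet> v1 x + v x \<bullet> v2 x)"
    by (rule dx_real_eqI) (intro DERIV_add has_real_derivative_inner d)
  have 5: "(dx ^^ 5) v = v5" "(dx ^^ 2) v = v2"
    by (simp_all add: numeral_eq_Suc vd)
  have row: "v x v* (A + B - c *\<^sub>R C) = v x v* A + v x v* B - c *\<^sub>R (v x v* C)" for A B C :: "real^'n^'n" and c
    by (simp add: vec_eq_iff vector_matrix_mult_def sum.distrib sum_subtractf sum_distrib_left algebra_simps)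
  have "lax_q (Suc (Suc (Suc 0))) v x = dx (lax_r (Suc (Suc 0)) v) x + v x v* lax_U (Suc (Suc 0)) v x"
    by (rule lax_q.simps(2)[THEN fun_cong, THEN fun_cong])
  also have "v x v* lax_U (Suc (Suc 0)) v x =
     (v x \<bullet> v x) *\<^sub>R (v3 x + (3/2 * (v x \<bullet> v x)) *\<^sub>R v1 x) - (v x \<bullet> (v3 x + (3/2 * (v x \<bullet> v x)) *\<^sub>R v1 x)) *\<^sub>R v x
     + ((v x \<bullet> (v2 x + ((v x \<bullet> v x) / 2) *\<^sub>R v x)) *\<^sub>R v1 x - (v x \<bullet> v1 x) *\<^sub>R (v2 x + ((v x \<bullet> v x) / 2) *\<^sub>R v x))
     - ((v x \<bullet> v x) / 2) *\<^sub>R ((v x \<bullet> v x) *\<^sub>R v1 x - (v x \<bullet> v1 x) *\<^sub>R v x)"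
    unfolding lax_U_2 row row_wedge_real q2 lax_r_1 vd ..
  finally show ?thesis
    unfolding r2' vd n n4 5 f1 f2 f3
    by (simp add: vec_eq_iff inner_add_right inner_commute)
      (simp add: field_simps)
qed

lemma hierarchy_low_orders:
  fixes v :: "real \<Rightarrow> real^'n"
  assumes v: "smooth v"
  shows "hierarchy 0 v x = dx v x \<and>
       hierarchy 1 v x = opR dx v x \<and>
       opR dx v x = (dx ^^ 3) v x + (3/2 * (norm (v x))\<^sup>2) *\<^sub>R dx v x \<and>
       hierarchy 2 v x = (opR ^^ 2) dx v x \<and>
       (opR ^^ 2) dx v x =
         (dx ^^ 5) v x
         + (5/2) *\<^sub>R dx (\<lambda>y. (norm (v y))\<^sup>2 *\<^sub>R (dx ^^ 2) v y) x
         + (5/2 * (dx (dx (\<lambda>y. (norm (v y))\<^sup>2)) x - (norm (dx v x))\<^sup>2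
                   + 3/4 * (norm (v x)) ^ 4)) *\<^sub>R dx v x"
proof -
  have h: "hierarchy 0 = dx" "hierarchy 1 = opR dx" "hierarchy 2 = (opR ^^ 2) dx"
    by (simp_all add: hierarchy_def)
  have "opR dx v x = lax_q (Suc (Suc 0)) v x"
    unfolding h(2)[symmetric] One_nat_def hierarchy_eq_lax_q[OF v] ..
  then have 1: "opR dx v x = (dx ^^ 3) v x + (3/2 * (norm (v x))\<^sup>2) *\<^sub>R dx v x"
    unfolding lax_q_2[OF v] by (simp add: numeral_3_eq_3 power2_norm_eq_inner)
  have "(opR ^^ 2) dx v x = lax_q (Suc (Suc (Suc 0))) v x"
    unfolding h(3)[symmetric] hierarchy_eq_lax_q[OF v] by (simp only: numeral_2_eq_2)
  then show ?thesis using 1 unfolding lax_q_3[OF v] h by blast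
qed

theorem mainTheorem4:
  fixes R S :: real
  assumes "R\<^sup>2 = 1" and "S\<^sup>2 = 1"
  shows
   "(\<forall>k. (d_opR ^^ k) ((dx :: (real \<Rightarrow> real^'n) \<Rightarrow> real \<Rightarrow> real^'n),
                     (dx :: (real \<Rightarrow> real^'m) \<Rightarrow> real \<Rightarrow> real^'m))
          = (hierarchy k, hierarchy k)) \<and>
    (\<forall>k. opR_defined (hierarchy k :: (real \<Rightarrow> real^'n) \<Rightarrow> real \<Rightarrow> real^'n)) \<and>
    (\<forall>k. diff_poly_vec (hierarchy k :: (real \<Rightarrow> real^'n) \<Rightarrow> real \<Rightarrow> real^'n)) \<and>
    (\<forall>(v :: real \<Rightarrow> real^'n) x. smooth v \<longrightarrow>
       hierarchy 0 v x = dx v x \<and>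
       hierarchy 1 v x = opR dx v x \<and>
       opR dx v x = (dx ^^ 3) v x + (3/2 * (norm (v x))\<^sup>2) *\<^sub>R dx v x \<and>
       hierarchy 2 v x = (opR ^^ 2) dx v x \<and>
       (opR ^^ 2) dx v x =
         (dx ^^ 5) v x
         + (5/2) *\<^sub>R dx (\<lambda>y. (norm (v y))\<^sup>2 *\<^sub>R (dx ^^ 2) v y) x
         + (5/2 * (dx (dx (\<lambda>y. (norm (v y))\<^sup>2)) x - (norm (dx v x))\<^sup>2
                   + 3/4 * (norm (v x)) ^ 4)) *\<^sub>R dx v x) \<and>
    (\<forall>k. flows_commute (hierarchy k :: (real \<Rightarrow> real^'n) \<Rightarrow> real \<Rightarrow> real^'n) (hierarchy 1)) \<and>
    (\<forall>k. commutes_with_neg_flow (hierarchy k :: (real \<Rightarrow> real^'n) \<Rightarrow> real \<Rightarrow> real^'n)) \<and>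
    neg_flow_is_sine_gordon TYPE('n) R \<and>
    (\<forall>k. opR_defined (hierarchy k :: (real \<Rightarrow> real^'m) \<Rightarrow> real \<Rightarrow> real^'m)) \<and>
    (\<forall>k. diff_poly_vec (hierarchy k :: (real \<Rightarrow> real^'m) \<Rightarrow> real \<Rightarrow> real^'m)) \<and>
    (\<forall>(w :: real \<Rightarrow> real^'m) x. smooth w \<longrightarrow>
       hierarchy 0 w x = dx w x \<and>
       hierarchy 1 w x = opR dx w x \<and>
       opR dx w x = (dx ^^ 3) w x + (3/2 * (norm (w x))\<^sup>2) *\<^sub>R dx w x \<and>
       hierarchy 2 w x = (opR ^^ 2) dx w x \<and>
       (opR ^^ 2) dx w x =
         (dx ^^ 5) w x
         + (5/2) *\<^sub>R dx (\<lambda>y. (norm (w y))\<^sup>2 *\<^sub>R (dx ^^ 2) w y) x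
         + (5/2 * (dx (dx (\<lambda>y. (norm (w y))\<^sup>2)) x - (norm (dx w x))\<^sup>2
                   + 3/4 * (norm (w x)) ^ 4)) *\<^sub>R dx w x) \<and>
    (\<forall>k. flows_commute (hierarchy k :: (real \<Rightarrow> real^'m) \<Rightarrow> real \<Rightarrow> real^'m) (hierarchy 1)) \<and>
    (\<forall>k. commutes_with_neg_flow (hierarchy k :: (real \<Rightarrow> real^'m) \<Rightarrow> real \<Rightarrow> real^'m)) \<and>
    neg_flow_is_sine_gordon TYPE('m) S"
  by (intro conjI allI impI hierarchy_d_opR hierarchy_opR_defined hierarchy_diff_poly
      hierarchy_low_orders[THEN conjunct1]
      hierarchy_low_orders[THEN conjunct2, THEN conjunct1]
      hierarchy_low_orders[THEN conjunct2, THEN conjunct2, THEN conjunct1]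
      hierarchy_low_orders[THEN conjunct2, THEN conjunct2, THEN conjunct2, THEN conjunct1]
      hierarchy_low_orders[THEN conjunct2, THEN conjunct2, THEN conjunct2, THEN conjunct2]
      hierarchy_commutes_with_mkdv hierarchy_commutes_with_neg_flow
      neg_flow_is_sine_gordon_unit assms)

end
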